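(* Let $n\ge 1$, $t_0\in\mathbb{R}$, $\theta\in\mathbb{R}\setminus\{0\}$, and let $\alpha,\beta:\mathbb{R}\to\mathbb{R}$ be periodic piecewise constant functions, with periods $T_1>0$ and $1$ respectively, of the form $$\alpha(t)=\begin{cases}\alpha^+,&0<t\le t_+,\\-\alpha^-,&t_+-T_1<t\le 0,\end{cases}\qquad \beta(t)=\begin{cases}\beta^+,&0<t\le \tau_+,\\-\beta^-,&\tau_+-1<t\le 0,\end{cases}$$ with constants $\alpha^\pm,\beta^\pm>0$, $t_+\in(0,T_1)$, $\tau_+\in(0,1)$, $\alpha(t+T_1)=\alpha(t)$ and $\beta(t+1)=\beta(t)$ for all $t$. For $\epsilon>0$ put $\alpha_\epsilon(t)=\alpha(t/\epsilon)$, $\beta_\epsilon(t)=\beta(t/\epsilon)$, and let $m(\alpha)=\frac1{T_1}\int_0^{T_1}\alpha(r)\,dr$, $m(\beta)=\int_0^1\beta(r)\,dr$. Let $\varphi\in H^s(\mathbb{R}^n)$ with $s>\frac n2$, and let $u^\epsilon,u^0\in C(\mathbb{R};H^s(\mathbb{R}^n))$ be the global mild solutions of, respectively, $$i\partial_tu^\epsilon+\alpha_\epsilon(t)\Delta u^\epsilon+\beta_\epsilon(t)\Delta^2u^\epsilon+\theta|u^\epsilon|^2u^\epsilon=0,\qquad u^\epsilon(x,t_0)=\varphi(x),$$ for each $\epsilon>0$, and $$i\partial_tu^0+m(\alpha)\Delta u^0+m(\beta)\Delta^2u^0+\theta|u^0|^2u^0=0,\qquad u^0(x,t_0)=\varphi(x).$$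 Then, for all $T>0$, $$\lim_{\epsilon\to0^+}\|u^\epsilon-u^0\|_{L^\infty([t_0-T,t_0+T];H^s(\mathbb{R}^n))}=0.$$
   Context: Mild solution of $i\partial_tu+a(t)\Delta u+b(t)\Delta^2u+\theta|u|^2u=0$, $u(\cdot,t_0)=\varphi$ (with $a,b$ real, locally integrable) means a solution of $$u(t)=U_{a,b}(t,t_0)\varphi+i\theta\int_{t_0}^tU_{a,b}(t,\tau)|u(\tau)|^2u(\tau)\,d\tau,$$ where $$U_{a,b}(t,r)f=\left[e^{-i|\xi|^2\int_r^ta(\tau)d\tau+i|\xi|^4\int_r^tb(\tau)d\tau}\widehat f(\xi)\right]^{\vee}.$$ The functions $u^\epsilon,u^0$ are complex-valued; $H^s(\mathbb{R}^n)$ is the $L^2$-based inhomogeneous Sobolev space. *)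

theory Defs
  imports "HOL-Analysis.Analysis" "HOL-Probability.Essential_Supremum"
begin

text \<open>
  Elements of \<open>L\<^sup>2\<close> and of \<open>H\<^sup>s\<close> are represented by Borel functions; equality of such elements is
  equality almost everywhere, and all notions below are invariant under it.
\<close>

definition square_integrable :: "('a::euclidean_space \<Rightarrow> complex) \<Rightarrow> bool" where
  "square_integrable f \<longleftrightarrow>
     f \<in> borel_measurable lborel \<and> integrable lborel (\<lambda>x. (cmod (f x))\<^sup>2)"

text \<open>
  The Fourier transform uses the angular frequency, so that the Laplacian has symbol
  \<open>- |\<xi>|\<^sup>2\<close>, and is normalised to be unitary on \<open>L\<^sup>2\<close>.
\<close>

definition fourier_integral :: "('a::euclidean_space \<Rightarrow> complex) \<Rightarrow> 'a \<Rightarrow> complex" where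
  "fourier_integral f \<xi> =
     complex_of_real ((2 * pi) powr (- real DIM('a) / 2)) *
     (LINT x|lborel. cis (- (x \<bullet> \<xi>)) * f x)"

text \<open>
  On \<open>L\<^sup>2\<close> the Fourier transform is the limit in \<open>L\<^sup>2\<close>, as \<open>R \<rightarrow> \<infinity>\<close>, of the Fourier integrals
  over the balls of radius \<open>R\<close>.
\<close>

definition is_fourier_transform ::
    "('a::euclidean_space \<Rightarrow> complex) \<Rightarrow> ('a \<Rightarrow> complex) \<Rightarrow> bool" where
  "is_fourier_transform f g \<longleftrightarrow>
     square_integrable f \<and> square_integrable g \<and>
     ((\<lambda>R. \<integral>\<^sup>+ \<xi>. ennreal ((cmod (fourier_integral
          (\<lambda>x. if x \<in> cball 0 R then f x else 0) \<xi> - g \<xi>))\<^sup>2) \<partial>lborel) \<longlongrightarrow> 0) at_top"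

definition fourier :: "('a::euclidean_space \<Rightarrow> complex) \<Rightarrow> 'a \<Rightarrow> complex" where
  "fourier f = (SOME g. is_fourier_transform f g)"

definition inverse_fourier :: "('a::euclidean_space \<Rightarrow> complex) \<Rightarrow> 'a \<Rightarrow> complex" where
  "inverse_fourier g x = fourier g (- x)"

text \<open>
  The inhomogeneous Sobolev space \<open>H\<^sup>s\<close> based on \<open>L\<^sup>2\<close>, for \<open>s \<ge> 0\<close> (for negative \<open>s\<close> it would
  contain distributions that are not in \<open>L\<^sup>2\<close>).
\<close>

definition sobolev :: "real \<Rightarrow> ('a::euclidean_space \<Rightarrow> complex) set" where
  "sobolev s = {f. square_integrable f \<and>
     integrable lborel (\<lambda>\<xi>. (1 + (norm \<xi>)\<^sup>2) powr s * (cmod (fourier f \<xi>))\<^sup>2)}"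

definition sobolev_norm :: "real \<Rightarrow> ('a::euclidean_space \<Rightarrow> complex) \<Rightarrow> real" where
  "sobolev_norm s f =
     sqrt (LINT \<xi>|lborel. (1 + (norm \<xi>)\<^sup>2) powr s * (cmod (fourier f \<xi>))\<^sup>2)"

definition sobolev_continuous :: "real \<Rightarrow> (real \<Rightarrow> 'a::euclidean_space \<Rightarrow> complex) \<Rightarrow> bool" where
  "sobolev_continuous s u \<longleftrightarrow>
     (\<forall>t. u t \<in> sobolev s) \<and>
     (\<forall>t. ((\<lambda>r. sobolev_norm s (\<lambda>x. u r x - u t x)) \<longlongrightarrow> 0) (at t))"

definition sobolev_Linf_norm ::
    "real \<Rightarrow> real set \<Rightarrow> (real \<Rightarrow> 'a::euclidean_space \<Rightarrow> complex) \<Rightarrow> ereal" where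
  "sobolev_Linf_norm s I u =
     esssup (restrict_space lborel I) (\<lambda>t. ereal (sobolev_norm s (u t)))"

text \<open>
  Integrals of \<open>H\<^sup>s\<close>-valued functions of time: this is \<open>has_integral\<close> with convergence of the
  Riemann sums in the norm of \<open>H\<^sup>s\<close> (which, as \<open>s\<close> is a real parameter, is not a type). For
  integrands that are continuous into \<open>H\<^sup>s\<close> it is the ordinary Riemann (and Bochner) integral.
\<close>

definition has_sobolev_integral ::
    "real \<Rightarrow> (real \<Rightarrow> 'a::euclidean_space \<Rightarrow> complex) \<Rightarrow> ('a \<Rightarrow> complex) \<Rightarrow> real \<Rightarrow> real \<Rightarrow> bool" where
  "has_sobolev_integral s G J a b \<longleftrightarrow>
     (\<forall>\<tau>\<in>{a..b}. G \<tau> \<in> sobolev s) \<and> J \<in> sobolev s \<and>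
     ((\<lambda>p. sobolev_norm s (\<lambda>x. (\<Sum>(\<tau>, k)\<in>p. measure lborel k *\<^sub>R G \<tau> x) - J x)) \<longlongrightarrow> 0)
       (division_filter {a..b})"

definition has_oriented_sobolev_integral ::
    "real \<Rightarrow> (real \<Rightarrow> 'a::euclidean_space \<Rightarrow> complex) \<Rightarrow> ('a \<Rightarrow> complex) \<Rightarrow> real \<Rightarrow> real \<Rightarrow> bool" where
  "has_oriented_sobolev_integral s G J a b \<longleftrightarrow>
     (if a \<le> b then has_sobolev_integral s G J a b
      else has_sobolev_integral s G (\<lambda>x. - J x) b a)"

definition propagator ::
    "(real \<Rightarrow> real) \<Rightarrow> (real \<Rightarrow> real) \<Rightarrow> real \<Rightarrow> real \<Rightarrow>
     ('a::euclidean_space \<Rightarrow> complex) \<Rightarrow> 'a \<Rightarrow> complex" where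
  "propagator a b t r f = inverse_fourier (\<lambda>\<xi>.
     exp (- \<i> * complex_of_real ((norm \<xi>)\<^sup>2 * (LBINT \<tau>=ereal r..ereal t. a \<tau>))
          + \<i> * complex_of_real ((norm \<xi>) ^ 4 * (LBINT \<tau>=ereal r..ereal t. b \<tau>)))
     * fourier f \<xi>)"

definition mild_solution ::
    "real \<Rightarrow> (real \<Rightarrow> real) \<Rightarrow> (real \<Rightarrow> real) \<Rightarrow> real \<Rightarrow> real \<Rightarrow>
     ('a::euclidean_space \<Rightarrow> complex) \<Rightarrow> (real \<Rightarrow> 'a \<Rightarrow> complex) \<Rightarrow> bool" where
  "mild_solution s a b \<theta> t0 \<phi> u \<longleftrightarrow>
     (\<forall>t. \<exists>J.
        has_oriented_sobolev_integral s
          (\<lambda>\<tau>. propagator a b t \<tau> (\<lambda>x. complex_of_real ((cmod (u \<tau> x))\<^sup>2) * u \<tau> x)) J t0 t \<and>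
        (AE x in lborel. u t x = propagator a b t t0 \<phi> x + \<i> * complex_of_real \<theta> * J x))"

definition period_mean :: "real \<Rightarrow> (real \<Rightarrow> real) \<Rightarrow> real" where
  "period_mean T f = 1 / T * (LBINT r=ereal 0..ereal T. f r)"

end

theory Submission
  imports Defs "HOL-Probability.Characteristic_Functions"
begin

text \<open>
  The propagators depend on the coefficients only through \<open>\<integral>\<^sub>r\<^sup>t a\<close> and \<open>\<integral>\<^sub>r\<^sup>t b\<close>. For a periodic
  coefficient, replacing \<open>a(t/\<epsilon>)\<close> by its mean changes these integrals by at most \<open>C \<epsilon>\<close>, uniformly in
  \<open>r\<close> and \<open>t\<close>, because the primitive of \<open>a - m(a)\<close> is periodic. Hence the two propagators differ on
  a fixed \<open>f \<in> H\<^sup>s\<close> by at most the \<open>L\<^sup>2\<close> norm of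
  \<open>(1 + |\<xi>|\<^sup>2)\<^bsup>s/2\<^esup> min 2 (C \<epsilon> (|\<xi>|\<^sup>2 + |\<xi>|\<^sup>4)) fourier f\<close>, which tends to \<open>0\<close> by dominated convergence
  and does so uniformly for \<open>f\<close> in the compact set of the \<open>|u\<^sup>0(t)|\<^sup>2 u\<^sup>0(t)\<close>. Since \<open>H\<^sup>s\<close> is an algebra
  for \<open>s > n/2\<close>, the nonlinearity is locally Lipschitz, and Duhamel's formula, Gronwall's inequality
  and a continuity argument that keeps \<open>u\<^sup>\<epsilon>\<close> within distance \<open>1\<close> of \<open>u\<^sup>0\<close> give the convergence.

  Plancherel's identity comes from Gaussian regularisation:
  \<open>\<integral>|FI f(\<xi>)|\<^sup>2 exp (- a\<^sup>2|\<xi>|\<^sup>2/2) d\<xi>\<close> is an average of autocorrelations of \<open>f\<close>, which are continuous by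
  the continuity of translations in \<open>L\<^sup>1\<close>.
\<close>


subsection \<open>The space \<open>L\<^sup>2\<close>\<close>

text \<open>The phase error grows like \<open>|\<xi>|\<^sup>4\<close>, so the oscillating
  propagators need not converge in operator norm on \<open>H\<^sup>s\<close>; they converge on each
  fixed function only. This dictates the splitting of the Duhamel terms: with N the cubic
  nonlinearity, U N(u) - U' N(v) = U (N(u) - N(v)) + (U - U') N(v). The difference of the
  propagators then meets only the limit solution v, whose orbit over a bounded time interval is
  compact and independent of \<epsilon>, while U is an isometry. The Lipschitz constant of N is
  controlled on bounded sets only, and no bound of the oscillating solutions uniform in \<epsilon>
  is known beforehand; hence the bootstrap. Accordingly the stability statement chooses a threshold
  \<delta> before the oscillating coefficients are given, and \<epsilon> enters only through a bound
  of the form C \<epsilon> \<le> \<delta>. \<open>fourier\<close> picks an arbitrary representative,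
  so identities between transforms hold almost everywhere and are used through
  \<open>L2norm\<close>, which ignores null sets.\<close>

definition L2norm :: "('a::euclidean_space \<Rightarrow> complex) \<Rightarrow> real" where
  "L2norm f = sqrt (LINT x|lborel. (cmod (f x))\<^sup>2)"

lemma square_integrable_measurable:
  "square_integrable f \<Longrightarrow> f \<in> borel_measurable borel"
  by (simp add: square_integrable_def)

lemma square_integrable_integrable:
  "square_integrable f \<Longrightarrow> integrable lborel (\<lambda>x. (cmod (f x))\<^sup>2)"
  by (simp add: square_integrable_def)

lemma L2norm_nonneg [simp]: "0 \<le> L2norm f"
  by (simp add: L2norm_def)

lemma L2norm_power2: "(L2norm f)\<^sup>2 = (LINT x|lborel. (cmod (f x))\<^sup>2)"
  by (simp add: L2norm_def)

lemma nn_integral_square_integrable: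
  "square_integrable f \<Longrightarrow> (\<integral>\<^sup>+ x. ennreal ((cmod (f x))\<^sup>2) \<partial>lborel) = ennreal ((L2norm f)\<^sup>2)"
  by (simp add: L2norm_power2 square_integrable_integrable nn_integral_eq_integral)

lemma square_integrableI_nn:
  assumes "f \<in> borel_measurable borel" "(\<integral>\<^sup>+ x. ennreal ((cmod (f x))\<^sup>2) \<partial>lborel) < \<infinity>"
  shows "square_integrable f"
  using assms by (auto simp: square_integrable_def intro!: integrableI_bounded)

lemma square_integrable_L2norm_leI:
  assumes "f \<in> borel_measurable borel" "0 \<le> c"
    and "(\<integral>\<^sup>+ x. ennreal ((cmod (f x))\<^sup>2) \<partial>lborel) \<le> ennreal (c\<^sup>2)"
  shows "square_integrable f" "L2norm f \<le> c"
proof -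
  show *: "square_integrable f"
    by (rule square_integrableI_nn) (use assms in \<open>auto simp: less_top[symmetric] top_unique\<close>)
  from assms(3) have "(L2norm f)\<^sup>2 \<le> c\<^sup>2"
    by (simp add: nn_integral_square_integrable[OF *])
  then show "L2norm f \<le> c"
    using assms(2) by (simp add: power2_le_iff_abs_le)
qed

lemma square_integrable_bound:
  assumes "square_integrable f" "g \<in> borel_measurable borel" "\<And>x. cmod (g x) \<le> cmod (f x)"
  shows "square_integrable g" "L2norm g \<le> L2norm f"
proof -
  have "(\<integral>\<^sup>+ x. ennreal ((cmod (g x))\<^sup>2) \<partial>lborel) \<le> (\<integral>\<^sup>+ x. ennreal ((cmod (f x))\<^sup>2) \<partial>lborel)"
    by (intro nn_integral_mono ennreal_leI power_mono assms) auto
  also have "\<dots> = ennreal ((L2norm f)\<^sup>2)"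
    by (rule nn_integral_square_integrable[OF assms(1)])
  finally show "square_integrable g" "L2norm g \<le> L2norm f"
    by (auto intro: square_integrable_L2norm_leI[OF assms(2), of "L2norm f"])
qed

lemma square_integrable_AE_cong:
  assumes "square_integrable f" "g \<in> borel_measurable borel" "AE x in lborel. f x = g x"
  shows "square_integrable g"
proof -
  have [measurable]: "f \<in> borel_measurable borel" "g \<in> borel_measurable borel"
    using assms square_integrable_measurable by auto
  have "integrable lborel (\<lambda>x. (cmod (f x))\<^sup>2) \<longleftrightarrow> integrable lborel (\<lambda>x. (cmod (g x))\<^sup>2)"
    by (rule integrable_cong_AE) (use assms(3) in auto)
  then show ?thesis
    using assms by (simp add: square_integrable_def)
qed

lemma L2norm_AE_cong:
  assumes "f \<in> borel_measurable borel" "g \<in> borel_measurable borel" "AE x in lborel. f x = g x"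
  shows "L2norm f = L2norm g"
  unfolding L2norm_def
  by (rule arg_cong[where f=sqrt], rule integral_cong_AE) (use assms in auto)

text \<open>The cross term is controlled by expanding
  \<open>(l |z| - |w|)\<^sup>2 / l \<ge> 0\<close>. The parameter \<open>l\<close> stays free:
  \<open>l = 1\<close> gives the crude bound behind \<open>square_integrable_add\<close>, and the
  choice \<open>l = b / a\<close> in \<open>L2norm_triangle\<close> is the sharp one.\<close>

lemma cmod_add_power2_le:
  fixes z w :: complex
  assumes "0 < l"
  shows "(cmod (z + w))\<^sup>2 \<le> (1 + l) * (cmod z)\<^sup>2 + (1 + 1 / l) * (cmod w)\<^sup>2"
proof -
  have "(cmod (z + w))\<^sup>2 \<le> (cmod z + cmod w)\<^sup>2"
    by (intro power_mono norm_triangle_ineq) auto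
  also have "\<dots> = (cmod z)\<^sup>2 + (cmod w)\<^sup>2 + 2 * cmod z * cmod w"
    by (simp add: power2_sum)
  also have "2 * cmod z * cmod w \<le> l * (cmod z)\<^sup>2 + 1 / l * (cmod w)\<^sup>2"
  proof -
    have "0 \<le> (l * cmod z - cmod w)\<^sup>2 / l"
      using assms by simp
    also have "\<dots> = l * (cmod z)\<^sup>2 + 1 / l * (cmod w)\<^sup>2 - 2 * cmod z * cmod w"
      using assms by (simp add: power2_diff field_simps power2_eq_square)
    finally show ?thesis by simp
  qed
  finally show ?thesis by (simp add: algebra_simps)
qed

lemma square_integrable_add:
  assumes "square_integrable f" "square_integrable g"
  shows "square_integrable (\<lambda>x. f x + g x)"
proof -
  have [measurable]: "f \<in> borel_measurable borel" "g \<in> borel_measurable borel"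
    using assms square_integrable_measurable by auto
  have "integrable lborel (\<lambda>x. (cmod (f x + g x))\<^sup>2)"
  proof (rule Bochner_Integration.integrable_bound)
    show "integrable lborel (\<lambda>x. 2 * (cmod (f x))\<^sup>2 + 2 * (cmod (g x))\<^sup>2)"
      using assms by (intro Bochner_Integration.integrable_add integrable_mult_right)
        (auto simp: square_integrable_def)
    show "AE x in lborel. norm ((cmod (f x + g x))\<^sup>2)
        \<le> norm (2 * (cmod (f x))\<^sup>2 + 2 * (cmod (g x))\<^sup>2)"
      using cmod_add_power2_le[of 1] by auto
  qed simp
  then show ?thesis by (simp add: square_integrable_def)
qed

lemma square_integrable_cmult:
  "square_integrable f \<Longrightarrow> square_integrable (\<lambda>x. c * f x)"
  by (auto simp: square_integrable_def norm_mult power_mult_distrib)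

lemma L2norm_cmult: "L2norm (\<lambda>x. c * f x) = cmod c * L2norm f"
  by (simp add: L2norm_def norm_mult power_mult_distrib real_sqrt_mult)

lemma square_integrable_minus: "square_integrable f \<Longrightarrow> square_integrable (\<lambda>x. - f x)"
  by (simp add: square_integrable_def)

lemma L2norm_minus: "L2norm (\<lambda>x. - f x) = L2norm f"
  by (simp add: L2norm_def)

lemma square_integrable_diff:
  "square_integrable f \<Longrightarrow> square_integrable g \<Longrightarrow> square_integrable (\<lambda>x. f x - g x)"
  using square_integrable_add[OF _ square_integrable_minus, of f g] by simp

lemma L2norm_diff_commute: "L2norm (\<lambda>x. f x - g x) = L2norm (\<lambda>x. g x - f x)"
  by (simp add: L2norm_def norm_minus_commute)

lemma square_integrable_zero [simp]: "square_integrable (\<lambda>x. 0)"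
  by (simp add: square_integrable_def)

lemma L2norm_zero [simp]: "L2norm (\<lambda>x. 0) = 0"
  by (simp add: L2norm_def)

lemma square_integrable_cnj: "square_integrable f \<Longrightarrow> square_integrable (\<lambda>x. cnj (f x))"
  by (auto simp: square_integrable_def intro!: measurable_compose[OF _ borel_measurable_continuous_onI[of cnj]]
      continuous_intros)

lemma L2norm_cnj: "L2norm (\<lambda>x. cnj (f x)) = L2norm f"
  by (simp add: L2norm_def)

section \<open>Reflections and translations of Lebesgue measure\<close>

lemma lborel_distr_reflect: "distr lborel borel uminus = (lborel :: 'a::euclidean_space measure)"
proof -
  have "(lborel :: 'a measure) = density (distr lborel borel (\<lambda>x. 0 + (- 1) *\<^sub>R x)) (\<lambda>_. ennreal (\<bar>- 1\<bar> ^ DIM('a)))"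
    by (rule lborel_affine) simp
  also have "\<dots> = distr lborel borel uminus"
    by (simp add: density_1)
  finally show ?thesis by simp
qed

lemma AE_lborel_reflect:
  fixes P :: "'a::euclidean_space \<Rightarrow> bool"
  assumes "AE x in lborel. P x" 
  shows "AE x in lborel. P (- x)"
proof -
  have "AE x in distr lborel borel (uminus :: 'a \<Rightarrow> 'a). P x"
    using assms by (simp only: lborel_distr_reflect)
  then show ?thesis
    by (rule AE_distrD[rotated]) simp
qed

lemma lborel_integral_reflect:
  fixes f :: "'a::euclidean_space \<Rightarrow> 'b::{banach, second_countable_topology}"
  assumes [measurable]: "f \<in> borel_measurable borel"
  shows "(LINT x|lborel. f (- x)) = (LINT x|lborel. f x)"
    and "integrable lborel (\<lambda>x. f (- x)) \<longleftrightarrow> integrable lborel f"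
proof -
  have "(LINT x|distr lborel borel uminus. f x) = (LINT x|lborel. f (- x))"
    by (rule integral_distr) auto
  then show "(LINT x|lborel. f (- x)) = (LINT x|lborel. f x)"
    by (simp add: lborel_distr_reflect)
  have "integrable (distr lborel borel uminus) f \<longleftrightarrow> integrable lborel (\<lambda>x. f (- x))"
    by (rule integrable_distr_eq) auto
  then show "integrable lborel (\<lambda>x. f (- x)) \<longleftrightarrow> integrable lborel f"
    by (simp add: lborel_distr_reflect)
qed

lemma lborel_integral_translate:
  fixes f :: "'a::euclidean_space \<Rightarrow> 'b::{banach, second_countable_topology}"
  assumes [measurable]: "f \<in> borel_measurable borel"
  shows "(LINT x|lborel. f (c + x)) = (LINT x|lborel. f x)"
    and "integrable lborel (\<lambda>x. f (c + x)) \<longleftrightarrow> integrable lborel f"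
proof -
  have "(LINT x|distr lborel borel ((+) c). f x) = (LINT x|lborel. f (c + x))"
    by (rule integral_distr) auto
  then show "(LINT x|lborel. f (c + x)) = (LINT x|lborel. f x)"
    by (simp add: lborel_distr_plus)
  have "integrable (distr lborel borel ((+) c)) f \<longleftrightarrow> integrable lborel (\<lambda>x. f (c + x))"
    by (rule integrable_distr_eq) auto
  then show "integrable lborel (\<lambda>x. f (c + x)) \<longleftrightarrow> integrable lborel f"
    by (simp add: lborel_distr_plus)
qed

lemma nn_integral_lborel_translate:
  fixes f :: "'a::euclidean_space \<Rightarrow> ennreal"
  assumes [measurable]: "f \<in> borel_measurable borel"
  shows "(\<integral>\<^sup>+ x. f (c + x) \<partial>lborel) = (\<integral>\<^sup>+ x. f x \<partial>lborel)"
proof -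
  have "(\<integral>\<^sup>+ x. f x \<partial>distr lborel borel ((+) c)) = (\<integral>\<^sup>+ x. f (c + x) \<partial>lborel)"
    by (rule nn_integral_distr) auto
  then show ?thesis
    by (simp add: lborel_distr_plus)
qed

lemma nn_integral_lborel_reflect:
  fixes f :: "'a::euclidean_space \<Rightarrow> ennreal"
  assumes [measurable]: "f \<in> borel_measurable borel"
  shows "(\<integral>\<^sup>+ x. f (- x) \<partial>lborel) = (\<integral>\<^sup>+ x. f x \<partial>lborel)"
proof -
  have "(\<integral>\<^sup>+ x. f x \<partial>distr lborel borel uminus) = (\<integral>\<^sup>+ x. f (- x) \<partial>lborel)"
    by (rule nn_integral_distr) auto
  then show ?thesis
    by (simp add: lborel_distr_reflect)
qed

lemma square_integrable_reflect:
  assumes "square_integrable f" shows "square_integrable (\<lambda>x. f (- x))"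
proof -
  have [measurable]: "f \<in> borel_measurable borel"
    using assms square_integrable_measurable by auto
  show ?thesis
    using assms lborel_integral_reflect(2)[of "\<lambda>x. (cmod (f x))\<^sup>2"]
    by (simp add: square_integrable_def)
qed

lemma L2norm_reflect:
  assumes "f \<in> borel_measurable borel" shows "L2norm (\<lambda>x. f (- x)) = L2norm f"
  using assms lborel_integral_reflect(1)[of "\<lambda>x. (cmod (f x))\<^sup>2"]
  by (simp add: L2norm_def)

text \<open>Minkowski's inequality by integrating \<open>cmod_add_power2_le\<close> with
  \<open>l = b / a\<close>: if a and b were the two norms themselves, the right-hand side would be
  exactly \<open>(a + b)\<^sup>2\<close>.\<close>

lemma L2norm_triangle:
  assumes "square_integrable f" "square_integrable g"
  shows "L2norm (\<lambda>x. f x + g x) \<le> L2norm f + L2norm g"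
proof (rule field_le_epsilon)
  fix e :: real assume "0 < e"
  \<comment> \<open>The padding by \<open>e / 2\<close> keeps both numbers positive, so the
    quotients \<open>b / a\<close> and \<open>a / b\<close> are meaningful even when a norm
    vanishes; letting e tend to 0 removes it.\<close>
  define a b where "a = L2norm f + e / 2" and "b = L2norm g + e / 2"
  have ab: "0 < a" "0 < b" "L2norm f \<le> a" "L2norm g \<le> b"
    using \<open>0 < e\<close> by (auto simp: a_def b_def add_nonneg_pos)
  have "(L2norm (\<lambda>x. f x + g x))\<^sup>2
      \<le> (LINT x|lborel. (1 + b / a) * (cmod (f x))\<^sup>2 + (1 + a / b) * (cmod (g x))\<^sup>2)"
    unfolding L2norm_power2
  proof (rule integral_mono)
    show "integrable lborel (\<lambda>x. (cmod (f x + g x))\<^sup>2)"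
      using square_integrable_add[OF assms] by (simp add: square_integrable_def)
    show "integrable lborel (\<lambda>x. (1 + b / a) * (cmod (f x))\<^sup>2 + (1 + a / b) * (cmod (g x))\<^sup>2)"
      using assms by (intro Bochner_Integration.integrable_add integrable_mult_right)
        (auto simp: square_integrable_def)
    show "(cmod (f x + g x))\<^sup>2 \<le> (1 + b / a) * (cmod (f x))\<^sup>2 + (1 + a / b) * (cmod (g x))\<^sup>2" for x
      using cmod_add_power2_le[of "b / a" "f x" "g x"] ab by simp
  qed
  also have "\<dots> = (1 + b / a) * (L2norm f)\<^sup>2 + (1 + a / b) * (L2norm g)\<^sup>2"
    using assms by (simp add: L2norm_power2 square_integrable_def)
  also have "\<dots> \<le> (1 + b / a) * a\<^sup>2 + (1 + a / b) * b\<^sup>2"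
    using ab by (intro add_mono mult_left_mono power_mono) auto
  also have "\<dots> = (a + b)\<^sup>2"
    using ab by (simp add: field_simps power2_eq_square)
  finally have "L2norm (\<lambda>x. f x + g x) \<le> a + b"
    using ab by (simp add: power2_le_iff_abs_le)
  then show "L2norm (\<lambda>x. f x + g x) \<le> L2norm f + L2norm g + e"
    by (simp add: a_def b_def)
qed

lemma L2norm_triangle_diff3:
  assumes "square_integrable f" "square_integrable g" "square_integrable h"
  shows "L2norm (\<lambda>x. f x - h x) \<le> L2norm (\<lambda>x. f x - g x) + L2norm (\<lambda>x. g x - h x)"
  using L2norm_triangle[OF square_integrable_diff[OF assms(1,2)] square_integrable_diff[OF assms(2,3)]]
  by simp

lemma L2norm_reverse_triangle:
  assumes "square_integrable f" "square_integrable g"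
  shows "\<bar>L2norm f - L2norm g\<bar> \<le> L2norm (\<lambda>x. f x - g x)"
  using L2norm_triangle[OF square_integrable_diff[OF assms] assms(2)]
    L2norm_triangle[OF square_integrable_diff[OF assms(2,1)] assms(1)]
  by (simp add: L2norm_diff_commute[of g f])

section \<open>Limits in L2: pairings, Fatou, completeness\<close>

lemma L2norm_tendsto:
  assumes "\<And>k. square_integrable (F k)" "square_integrable f"
    and "((\<lambda>k. L2norm (\<lambda>x. F k x - f x)) \<longlongrightarrow> 0) A"
  shows "((\<lambda>k. L2norm (F k)) \<longlongrightarrow> L2norm f) A"
proof (rule Lim_transform_bound[OF always_eventually, OF allI assms(3), THEN LIM_zero_cancel, unfolded o_def])
qed (use L2norm_reverse_triangle[OF assms(1,2)] in auto)

lemma L2norm_eq_0D: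
  assumes "square_integrable f" "L2norm f = 0"
  shows "AE x in lborel. f x = 0"
proof -
  have "(LINT x|lborel. (cmod (f x))\<^sup>2) = 0"
    using assms(2) L2norm_power2[of f] by simp
  then have "AE x in lborel. (cmod (f x))\<^sup>2 = 0"
    using integral_nonneg_eq_0_iff_AE[of lborel "\<lambda>x. (cmod (f x))\<^sup>2"] assms(1)
    by (auto simp: square_integrable_def)
  then show ?thesis by auto
qed

lemma integrable_mult_square_integrable:
  assumes "square_integrable f" "square_integrable g"
  shows "integrable lborel (\<lambda>x. f x * g x)"
proof (rule Bochner_Integration.integrable_bound)
  show "integrable lborel (\<lambda>x. (cmod (f x))\<^sup>2 + (cmod (g x))\<^sup>2)"
    using assms by (simp add: square_integrable_def)
  show "(\<lambda>x. f x * g x) \<in> borel_measurable lborel"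
    using assms[THEN square_integrable_measurable] by measurable
  have "cmod (f x) * cmod (g x) \<le> (cmod (f x))\<^sup>2 + (cmod (g x))\<^sup>2" for x
    using sum_squares_bound[of "cmod (f x)" "cmod (g x)"]
      mult_nonneg_nonneg[OF norm_ge_zero[of "f x"] norm_ge_zero[of "g x"]]
    by linarith
  then show "AE x in lborel. norm (f x * g x) \<le> norm ((cmod (f x))\<^sup>2 + (cmod (g x))\<^sup>2)"
    by (simp add: norm_mult)
qed

lemma L2_Cauchy_Schwarz:
  assumes "square_integrable f" "square_integrable g"
  shows "cmod (LINT x|lborel. f x * g x) \<le> L2norm f * L2norm g"
proof -
  have [measurable]: "f \<in> borel_measurable borel" "g \<in> borel_measurable borel"
    using assms square_integrable_measurable by auto
  have I: "integrable lborel (\<lambda>x. f x * g x)"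
    by (rule integrable_mult_square_integrable[OF assms])
  have "(\<integral>\<^sup>+ x. ennreal (cmod (f x)) * ennreal (cmod (g x)) \<partial>lborel)\<^sup>2
      \<le> (\<integral>\<^sup>+ x. (ennreal (cmod (f x)))\<^sup>2 \<partial>lborel) * (\<integral>\<^sup>+ x. (ennreal (cmod (g x)))\<^sup>2 \<partial>lborel)"
    by (rule Cauchy_Schwarz_nn_integral) auto
  also have "(\<integral>\<^sup>+ x. (ennreal (cmod (f x)))\<^sup>2 \<partial>lborel) = ennreal ((L2norm f)\<^sup>2)"
    using nn_integral_square_integrable[OF assms(1)] by (simp add: ennreal_power)
  also have "(\<integral>\<^sup>+ x. (ennreal (cmod (g x)))\<^sup>2 \<partial>lborel) = ennreal ((L2norm g)\<^sup>2)"
    using nn_integral_square_integrable[OF assms(2)] by (simp add: ennreal_power)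
  also have "(\<integral>\<^sup>+ x. ennreal (cmod (f x)) * ennreal (cmod (g x)) \<partial>lborel)
      = ennreal (LINT x|lborel. cmod (f x * g x))"
    using I by (simp add: ennreal_mult'[symmetric] norm_mult[symmetric] nn_integral_eq_integral)
  finally have "(LINT x|lborel. cmod (f x * g x))\<^sup>2 \<le> (L2norm f * L2norm g)\<^sup>2"
    by (simp add: ennreal_power ennreal_mult'[symmetric] power_mult_distrib)
  then have "(LINT x|lborel. cmod (f x * g x)) \<le> L2norm f * L2norm g"
    by (simp add: power2_le_iff_abs_le)
  then show ?thesis
    using integral_norm_bound[of lborel "\<lambda>x. f x * g x"] by linarith
qed

lemma L2_pairing_tendsto:
  assumes F: "\<And>k. square_integrable (F k)" "square_integrable f" "((\<lambda>k. L2norm (\<lambda>x. F k x - f x)) \<longlongrightarrow> 0) A"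
    and G: "\<And>k. square_integrable (G k)" "square_integrable g" "((\<lambda>k. L2norm (\<lambda>x. G k x - g x)) \<longlongrightarrow> 0) A"
  shows "((\<lambda>k. LINT x|lborel. F k x * G k x) \<longlongrightarrow> (LINT x|lborel. f x * g x)) A"
proof (rule LIM_zero_cancel, rule Lim_null_comparison)
  have "((\<lambda>k. L2norm (\<lambda>x. F k x - f x) * L2norm (G k) + L2norm f * L2norm (\<lambda>x. G k x - g x))
      \<longlongrightarrow> 0 * L2norm g + L2norm f * 0) A"
    by (intro tendsto_intros F G L2norm_tendsto)
  then show "((\<lambda>k. L2norm (\<lambda>x. F k x - f x) * L2norm (G k) + L2norm f * L2norm (\<lambda>x. G k x - g x))
      \<longlongrightarrow> 0) A"
    by simp
  show "\<forall>\<^sub>F k in A. norm ((LINT x|lborel. F k x * G k x) - (LINT x|lborel. f x * g x))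
      \<le> L2norm (\<lambda>x. F k x - f x) * L2norm (G k) + L2norm f * L2norm (\<lambda>x. G k x - g x)"
  proof (rule always_eventually, rule allI)
    fix k
    have "(LINT x|lborel. F k x * G k x) - (LINT x|lborel. f x * g x)
        = (LINT x|lborel. (F k x - f x) * G k x) + (LINT x|lborel. f x * (G k x - g x))"
      using integrable_mult_square_integrable[OF F(1)[of k] G(1)[of k]]
        integrable_mult_square_integrable[OF F(2) G(2)] integrable_mult_square_integrable[OF F(2) G(1)[of k]]
      by (simp add: algebra_simps)
    also have "norm \<dots> \<le> L2norm (\<lambda>x. F k x - f x) * L2norm (G k) + L2norm f * L2norm (\<lambda>x. G k x - g x)"
      by (intro norm_triangle_mono L2_Cauchy_Schwarz square_integrable_diff F G)
    finally show "norm ((LINT x|lborel. F k x * G k x) - (LINT x|lborel. f x * g x))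
      \<le> L2norm (\<lambda>x. F k x - f x) * L2norm (G k) + L2norm f * L2norm (\<lambda>x. G k x - g x)" .
  qed
qed

text \<open>Lower semicontinuity of the norm under pointwise convergence. It is the only device used
  below to show that a pointwise limit belongs to L2.\<close>

lemma L2_Fatou:
  assumes F: "\<And>k. square_integrable (F k)" and f: "f \<in> borel_measurable borel"
    and lim: "AE x in lborel. (\<lambda>k. F k x) \<longlonglongrightarrow> f x"
    and le: "\<And>k. L2norm (F k) \<le> c" and "0 \<le> c"
  shows "square_integrable f" "L2norm f \<le> c"
proof -
  have [measurable]: "F k \<in> borel_measurable borel" "f \<in> borel_measurable borel" for k
    using F f square_integrable_measurable by auto
  have "(\<integral>\<^sup>+ x. ennreal ((cmod (f x))\<^sup>2) \<partial>lborel)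
      = (\<integral>\<^sup>+ x. liminf (\<lambda>k. ennreal ((cmod (F k x))\<^sup>2)) \<partial>lborel)"
  proof (rule nn_integral_cong_AE)
    show "AE x in lborel. ennreal ((cmod (f x))\<^sup>2) = liminf (\<lambda>k. ennreal ((cmod (F k x))\<^sup>2))"
      using lim
    proof eventually_elim
      fix x assume "(\<lambda>k. F k x) \<longlonglongrightarrow> f x"
      then have "(\<lambda>k. ennreal ((cmod (F k x))\<^sup>2)) \<longlonglongrightarrow> ennreal ((cmod (f x))\<^sup>2)"
        by (intro tendsto_ennrealI tendsto_power tendsto_norm)
      then show "ennreal ((cmod (f x))\<^sup>2) = liminf (\<lambda>k. ennreal ((cmod (F k x))\<^sup>2))"
        by (simp only: lim_imp_Liminf[OF sequentially_bot])
    qed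
  qed
  also have "\<dots> \<le> liminf (\<lambda>k. \<integral>\<^sup>+ x. ennreal ((cmod (F k x))\<^sup>2) \<partial>lborel)"
    by (rule nn_integral_liminf) simp
  also have "\<dots> \<le> liminf (\<lambda>k. ennreal (c\<^sup>2))"
    by (intro Liminf_mono always_eventually allI)
      (simp add: nn_integral_square_integrable[OF F] power_mono le)
  also have "\<dots> = ennreal (c\<^sup>2)"
    by (simp add: Liminf_const)
  finally show "square_integrable f" "L2norm f \<le> c"
    by (auto intro: square_integrable_L2norm_leI[OF f \<open>0 \<le> c\<close>])
qed

text \<open>A pointwise limit and an L2 limit of the same sequence agree: Fatou applied to the tails
  of \<open>F k - g\<close> bounds the norm of \<open>f - g\<close> by every positive e.\<close>

lemma L2_limit_unique_pointwise:
  assumes F: "\<And>k. square_integrable (F k)" and g: "square_integrable g"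
    and f: "f \<in> borel_measurable borel"
    and lim: "AE x in lborel. (\<lambda>k. F k x) \<longlonglongrightarrow> f x"
    and L2: "(\<lambda>k. L2norm (\<lambda>x. F k x - g x)) \<longlonglongrightarrow> 0"
  shows "AE x in lborel. f x = g x"
proof -
  have [measurable]: "g \<in> borel_measurable borel" "f \<in> borel_measurable borel"
    using g f square_integrable_measurable by auto
  have *: "square_integrable (\<lambda>x. f x - g x) \<and> L2norm (\<lambda>x. f x - g x) \<le> e" if "0 < e" for e
  proof -
    obtain N where N: "\<And>k. k \<ge> N \<Longrightarrow> L2norm (\<lambda>x. F k x - g x) < e"
      using order_tendstoD(2)[OF L2 \<open>0 < e\<close>] by (auto simp: eventually_sequentially)
    have "AE x in lborel. (\<lambda>k. F (k + N) x - g x) \<longlonglongrightarrow> f x - g x"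
      using lim by eventually_elim (intro tendsto_intros LIMSEQ_ignore_initial_segment)
    then show ?thesis
      using L2_Fatou[of "\<lambda>k x. F (k + N) x - g x" "\<lambda>x. f x - g x" e] N F g that
      by (auto simp: square_integrable_diff less_imp_le)
  qed
  then have "L2norm (\<lambda>x. f x - g x) \<le> 0"
    using dense_ge[of 0 "L2norm (\<lambda>x. f x - g x)"] by blast
  then have "L2norm (\<lambda>x. f x - g x) = 0"
    using L2norm_nonneg[of "\<lambda>x. f x - g x"] by linarith
  from L2norm_eq_0D[OF _ this] *[of 1] show ?thesis by simp
qed

text \<open>Riesz-Fischer. Along a subsequence whose consecutive differences \<open>d k\<close> have
  norm at most \<open>(1/2) ^ k\<close>, the series of \<open>2 ^ k |d k|\<^sup>2\<close> has finite
  integral, hence is finite almost everywhere. This forces absolute convergence of the telescoping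
  series, and Fatou upgrades the pointwise limit to an L2 limit of the whole sequence.\<close>

lemma L2_complete:
  fixes F :: "nat \<Rightarrow> 'a::euclidean_space \<Rightarrow> complex"
  assumes F: "\<And>k. square_integrable (F k)"
    and Cauchy: "\<And>e. 0 < e \<Longrightarrow> \<exists>N. \<forall>m\<ge>N. \<forall>n\<ge>N. L2norm (\<lambda>x. F m x - F n x) \<le> e"
  obtains g where "square_integrable g" "(\<lambda>k. L2norm (\<lambda>x. F k x - g x)) \<longlonglongrightarrow> 0"
proof -
  have [measurable]: "F k \<in> borel_measurable borel" for k
    using F square_integrable_measurable by auto
  have "\<exists>N. \<forall>m\<ge>N. \<forall>n\<ge>N. L2norm (\<lambda>x. F m x - F n x) \<le> (1/2) ^ k" for k
    by (rule Cauchy) simp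
  then obtain N where N: "\<And>k m n. m \<ge> N k \<Longrightarrow> n \<ge> N k \<Longrightarrow> L2norm (\<lambda>x. F m x - F n x) \<le> (1/2) ^ k"
    by metis
  \<comment> \<open>Adding k and all earlier thresholds yields \<open>r k \<ge> k\<close> as well as
    \<open>r k \<ge> N k\<close> and \<open>r (Suc k) \<ge> N k\<close>, so the Cauchy bound of
    level k covers the pair \<open>r k\<close>, \<open>r (Suc k)\<close>.\<close>
  define r where "r k = k + (\<Sum>i\<le>k. N i)" for k
  have rN: "N k \<le> r k" for k
    unfolding r_def by (simp add: member_le_sum trans_le_add2)
  have rk: "k \<le> r k" and r_Suc: "N k \<le> r (Suc k)" for k
    using rN[of k] by (auto simp: r_def)
  define d where "d k x = F (r (Suc k)) x - F (r k) x" for k x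
  have d2: "(\<integral>\<^sup>+ x. ennreal ((cmod (d k x))\<^sup>2) \<partial>lborel) \<le> ennreal ((1/4) ^ k)" for k
  proof -
    have "square_integrable (d k)"
      unfolding d_def by (intro square_integrable_diff F)
    moreover have "(L2norm (d k))\<^sup>2 \<le> ((1/2) ^ k)\<^sup>2"
      using N[OF r_Suc rN, of k] unfolding d_def by (intro power_mono) auto
    moreover have "((1/2::real) ^ k)\<^sup>2 = (1/4) ^ k"
      by (simp add: power2_eq_square power_mult_distrib[symmetric])
    ultimately show ?thesis
      by (simp add: nn_integral_square_integrable)
  qed
  have [measurable]: "d k \<in> borel_measurable borel" for k
    unfolding d_def[abs_def] by measurable
  have "(\<integral>\<^sup>+ x. (\<Sum>k. ennreal (2 ^ k * (cmod (d k x))\<^sup>2)) \<partial>lborel)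
      = (\<Sum>k. \<integral>\<^sup>+ x. ennreal (2 ^ k * (cmod (d k x))\<^sup>2) \<partial>lborel)"
    by (rule nn_integral_suminf) simp
  also have "\<dots> \<le> (\<Sum>k. ennreal ((1/2) ^ k))"
  proof (intro suminf_le summableI)
    fix k
    have "(\<integral>\<^sup>+ x. ennreal (2 ^ k * (cmod (d k x))\<^sup>2) \<partial>lborel)
        = ennreal (2 ^ k) * (\<integral>\<^sup>+ x. ennreal ((cmod (d k x))\<^sup>2) \<partial>lborel)"
    proof -
      have "ennreal (2 ^ k * (cmod (d k x))\<^sup>2) = ennreal (2 ^ k) * ennreal ((cmod (d k x))\<^sup>2)" for x
        by (rule ennreal_mult) auto
      then show ?thesis
        by (simp only:) (rule nn_integral_cmult, measurable)
    qed
    also have "\<dots> \<le> ennreal (2 ^ k) * ennreal ((1/4) ^ k)"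
      by (intro mult_left_mono d2) simp
    also have "\<dots> = ennreal ((1/2) ^ k)"
    proof -
      have "(2::real) ^ k * (1/4) ^ k = (1/2) ^ k"
        by (simp only: power_mult_distrib[symmetric]) simp
      then show ?thesis
        by (subst ennreal_mult'[symmetric]) (auto simp only: zero_le_numeral zero_le_power)
    qed
    finally show "(\<integral>\<^sup>+ x. ennreal (2 ^ k * (cmod (d k x))\<^sup>2) \<partial>lborel) \<le> ennreal ((1/2) ^ k)" .
  qed
  also have "\<dots> < \<infinity>"
  proof -
    have "(\<Sum>k. ennreal ((1/2) ^ k)) = ennreal (\<Sum>k. (1/2) ^ k)"
      by (rule suminf_ennreal2) (auto intro!: summable_geometric)
    then show ?thesis by (simp only: ennreal_less_top infinity_ennreal_def)
  qed
  finally have "AE x in lborel. (\<Sum>k. ennreal (2 ^ k * (cmod (d k x))\<^sup>2)) \<noteq> \<infinity>"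
    by (intro nn_integral_noteq_infinite) auto
  then have conv: "AE x in lborel. convergent (\<lambda>k. F (r k) x)"
  proof eventually_elim
    fix x assume "(\<Sum>k. ennreal (2 ^ k * (cmod (d k x))\<^sup>2)) \<noteq> \<infinity>"
    then have s: "summable (\<lambda>k. 2 ^ k * (cmod (d k x))\<^sup>2)"
      by (intro summable_suminf_not_top) auto
    have "summable (\<lambda>k. cmod (d k x))"
    proof (rule summable_comparison_test)
      show "summable (\<lambda>k. 2 ^ k * (cmod (d k x))\<^sup>2 + (1/2) ^ k)"
        by (intro summable_add s) (simp add: summable_geometric)
      \<comment> \<open>Either the term is at most \<open>(1/2) ^ k\<close>, or
        \<open>1 \<le> 2 ^ k |d k x|\<close> and multiplying by \<open>|d k x|\<close> gives the
        quadratic bound; both majorants are summable.\<close>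
      have "cmod (d k x) \<le> 2 ^ k * (cmod (d k x))\<^sup>2 + (1/2) ^ k" for k
      proof (cases "cmod (d k x) \<le> (1/2) ^ k")
        case True
        moreover have "0 \<le> 2 ^ k * (cmod (d k x))\<^sup>2" by simp
        ultimately show ?thesis by linarith
      next
        case False
        then have "2 ^ k * (1/2) ^ k \<le> 2 ^ k * cmod (d k x)"
          by (intro mult_left_mono) auto
        moreover have "2 ^ k * (1/2) ^ k = (1::real)"
          by (simp only: power_mult_distrib[symmetric]) simp
        ultimately have "1 \<le> 2 ^ k * cmod (d k x)" by simp
        then have "1 * cmod (d k x) \<le> (2 ^ k * cmod (d k x)) * cmod (d k x)"
          by (intro mult_right_mono) auto
        then have "cmod (d k x) \<le> 2 ^ k * (cmod (d k x))\<^sup>2"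
          by (simp only: power2_eq_square mult.assoc mult_1)
        moreover have "(0::real) \<le> (1/2) ^ k" by simp
        ultimately show ?thesis by linarith
      qed
      then show "\<exists>N. \<forall>n\<ge>N. norm (cmod (d n x)) \<le> 2 ^ n * (cmod (d n x))\<^sup>2 + (1/2) ^ n"
        by simp
    qed
    then have "summable (\<lambda>k. d k x)"
      by (rule summable_norm_cancel)
    then have "convergent (\<lambda>n. \<Sum>k<n. d k x)"
      by (simp add: summable_iff_convergent)
    then have "convergent (\<lambda>n. F (r n) x - F (r 0) x)"
      unfolding d_def sum_lessThan_telescope[of "\<lambda>k. F (r k) x"] .
    then have "convergent (\<lambda>n. (F (r n) x - F (r 0) x) + F (r 0) x)"
      by (rule convergent_add) (rule convergent_const)
    then show "convergent (\<lambda>k. F (r k) x)" by simp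
  qed
  define g where "g x = lim (\<lambda>k. F (r k) x)" for x
  have [measurable]: "g \<in> borel_measurable borel"
    unfolding g_def by simp
  have lim: "AE x in lborel. (\<lambda>k. F (r k) x) \<longlonglongrightarrow> g x"
    using conv by eventually_elim (simp add: g_def convergent_LIMSEQ_iff)
  \<comment> \<open>With n fixed and the second index running along the subsequence, Fatou turns the
    Cauchy estimate into an estimate of the distance to \<open>g\<close>.\<close>
  have *: "square_integrable (\<lambda>x. F n x - g x) \<and> L2norm (\<lambda>x. F n x - g x) \<le> e"
    if e: "0 < e" and M: "\<And>m n. m \<ge> M \<Longrightarrow> n \<ge> M \<Longrightarrow> L2norm (\<lambda>x. F m x - F n x) \<le> e" and n: "n \<ge> M"
    for e M n
  proof -
    have "AE x in lborel. (\<lambda>k. F n x - F (r (k + M)) x) \<longlonglongrightarrow> F n x - g x"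
      using lim by eventually_elim (intro tendsto_intros LIMSEQ_ignore_initial_segment[where f="\<lambda>k. F (r k) _"])
    moreover have "L2norm (\<lambda>x. F n x - F (r (k + M)) x) \<le> e" for k
      by (rule M[OF n]) (use rk[of "k + M"] in linarith)
    ultimately show ?thesis
      using L2_Fatou[of "\<lambda>k x. F n x - F (r (k + M)) x" "\<lambda>x. F n x - g x" e] e F
      by (auto simp: square_integrable_diff)
  qed
  show thesis
  proof
    obtain M where "\<And>m n. m \<ge> M \<Longrightarrow> n \<ge> M \<Longrightarrow> L2norm (\<lambda>x. F m x - F n x) \<le> 1"
      using Cauchy[of 1] by auto
    from *[OF _ this order_refl] have "square_integrable (\<lambda>x. F M x - g x)" by auto
    from square_integrable_diff[OF F[of M] this] show "square_integrable g" by simp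
    show "(\<lambda>k. L2norm (\<lambda>x. F k x - g x)) \<longlonglongrightarrow> 0"
    proof (rule LIMSEQ_I)
      fix e :: real assume "0 < e"
      obtain M where M: "\<And>m n. m \<ge> M \<Longrightarrow> n \<ge> M \<Longrightarrow> L2norm (\<lambda>x. F m x - F n x) \<le> e / 2"
        using Cauchy[of "e / 2"] \<open>0 < e\<close> by auto
      from *[OF _ this] \<open>0 < e\<close> show "\<exists>no. \<forall>n\<ge>no. norm (L2norm (\<lambda>x. F n x - g x) - 0) < e"
        by (intro exI[of _ M]) fastforce
    qed
  qed
qed


subsection \<open>Fourier integrals and Gaussians\<close>

lemma borel_measurable_cis [measurable]: "cis \<in> borel_measurable borel"
  by (intro borel_measurable_continuous_onI continuous_intros)

lemma borel_measurable_cnj [measurable]: "cnj \<in> borel_measurable borel"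
  by (intro borel_measurable_continuous_onI continuous_intros)

lemma integrable_cis_mult:
  fixes f :: "'a::euclidean_space \<Rightarrow> complex"
  assumes "integrable lborel f"
  shows "integrable lborel (\<lambda>x. cis (- (x \<bullet> \<xi>)) * f x)"
proof (rule Bochner_Integration.integrable_bound[OF assms])
  have [measurable]: "f \<in> borel_measurable borel"
    using borel_measurable_integrable[OF assms] by simp
  show "(\<lambda>x. cis (- (x \<bullet> \<xi>)) * f x) \<in> borel_measurable lborel"
    by measurable
qed (simp add: norm_mult)

lemma borel_measurable_fourier_integral [measurable]:
  fixes f :: "'a::euclidean_space \<Rightarrow> complex"
  assumes [measurable]: "f \<in> borel_measurable borel"
  shows "fourier_integral f \<in> borel_measurable borel"
  unfolding fourier_integral_def[abs_def] by measurable

abbreviation fourier_const :: "'a::euclidean_space itself \<Rightarrow> real" where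
  "fourier_const _ \<equiv> (2 * pi) powr (- real DIM('a) / 2)"

lemma norm_fourier_integral_le:
  fixes f :: "'a::euclidean_space \<Rightarrow> complex"
  shows "cmod (fourier_integral f \<xi>) \<le> fourier_const TYPE('a) * (LINT x|lborel. cmod (f x))"
proof -
  have "cmod (LINT x|lborel. cis (- (x \<bullet> \<xi>)) * f x) \<le> (LINT x|lborel. cmod (cis (- (x \<bullet> \<xi>)) * f x))"
    by (rule integral_norm_bound)
  also have "\<dots> = (LINT x|lborel. cmod (f x))"
    by (simp add: norm_mult)
  finally show ?thesis
    by (simp add: fourier_integral_def norm_mult mult_left_mono)
qed

lemma fourier_integral_add:
  "integrable lborel f \<Longrightarrow> integrable lborel g \<Longrightarrow>
    fourier_integral (\<lambda>x. f x + g x) \<xi> = fourier_integral f \<xi> + fourier_integral g \<xi>"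
  using integrable_cis_mult[of f \<xi>] integrable_cis_mult[of g \<xi>]
  by (simp add: fourier_integral_def algebra_simps)

lemma fourier_integral_diff:
  "integrable lborel f \<Longrightarrow> integrable lborel g \<Longrightarrow>
    fourier_integral (\<lambda>x. f x - g x) \<xi> = fourier_integral f \<xi> - fourier_integral g \<xi>"
  using integrable_cis_mult[of f \<xi>] integrable_cis_mult[of g \<xi>]
  by (simp add: fourier_integral_def algebra_simps)

lemma fourier_integral_cmult:
  "fourier_integral (\<lambda>x. c * f x) \<xi> = c * fourier_integral f \<xi>"
proof -
  have "(LINT x|lborel. cis (- (x \<bullet> \<xi>)) * (c * f x)) = (LINT x|lborel. c * (cis (- (x \<bullet> \<xi>)) * f x))"
    by (simp add: algebra_simps)
  then show ?thesis by (simp add: fourier_integral_def)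
qed

lemma fourier_integral_cnj:
  "fourier_integral (\<lambda>x. cnj (f x)) \<xi> = cnj (fourier_integral f (- \<xi>))"
proof -
  have "cnj (LINT x|lborel. cis (x \<bullet> \<xi>) * f x) = (LINT x|lborel. cnj (cis (x \<bullet> \<xi>) * f x))"
    by (rule Bochner_Integration.integral_cnj[symmetric])
  then show ?thesis
    by (simp add: fourier_integral_def cis_cnj)
qed

text \<open>The hypothesis of Fubini's theorem for a bounded kernel. It serves twice: with the
  oscillating kernel of the multiplication formula, and with a translate of a bounded function as
  kernel in \<open>plancherel_bounded\<close>.\<close>

lemma integrable_pair_mult:
  fixes f g :: "'a::euclidean_space \<Rightarrow> complex"
  assumes f: "integrable lborel f" and g: "integrable lborel g"
    and K: "(\<lambda>(x, y). K x y) \<in> borel_measurable (borel \<Otimes>\<^sub>M borel)" and K1: "\<And>x y. cmod (K x y) \<le> B"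
  shows "integrable (lborel \<Otimes>\<^sub>M lborel) (\<lambda>(x, y). K x y * (f x * g y))"
proof (rule Bochner_Integration.integrable_bound)
  have [measurable]: "f \<in> borel_measurable borel" "g \<in> borel_measurable borel"
    using borel_measurable_integrable[OF f] borel_measurable_integrable[OF g] by auto
  have "integrable (lborel \<Otimes>\<^sub>M lborel) (\<lambda>(x, y). f x * g y)"
  proof (rule lborel_pair.Fubini_integrable)
    show "(\<lambda>(x, y). f x * g y) \<in> borel_measurable (lborel \<Otimes>\<^sub>M lborel)"
      by measurable
    show "integrable lborel (\<lambda>x. LINT y|lborel. norm (case (x, y) of (x, y) \<Rightarrow> f x * g y))"
      using f by (simp add: norm_mult)
    show "AE x in lborel. integrable lborel (\<lambda>y. case (x, y) of (x, y) \<Rightarrow> f x * g y)"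
      using g by simp
  qed
  then show "integrable (lborel \<Otimes>\<^sub>M lborel) (\<lambda>p. of_real B * (case p of (x, y) \<Rightarrow> f x * g y))"
    by (rule integrable_mult_right)
  show "(\<lambda>(x, y). K x y * (f x * g y)) \<in> borel_measurable (lborel \<Otimes>\<^sub>M lborel)"
    using K by (simp add: split_beta') measurable
  show "AE p in lborel \<Otimes>\<^sub>M lborel. norm (case p of (x, y) \<Rightarrow> K x y * (f x * g y))
      \<le> norm (of_real B * (case p of (x, y) \<Rightarrow> f x * g y))"
    by (rule AE_I2) (auto simp: norm_mult intro!: mult_right_mono order_trans[OF K1 abs_ge_self])
qed

text \<open>Fubini's theorem, since the kernel \<open>cis (- (x \<bullet> y))\<close> is symmetric
  in its two variables.\<close>

lemma fourier_integral_multiplication: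
  fixes f g :: "'a::euclidean_space \<Rightarrow> complex"
  assumes f: "integrable lborel f" and g: "integrable lborel g"
  shows "(LINT x|lborel. fourier_integral f x * g x) = (LINT x|lborel. f x * fourier_integral g x)"
proof -
  let ?c = "complex_of_real (fourier_const TYPE('a))"
  have "integrable (lborel \<Otimes>\<^sub>M lborel) (\<lambda>(x, y). cis (- (x \<bullet> y)) * (f x * g y))"
    by (rule integrable_pair_mult[OF f g, where B=1]) auto
  then have "(LINT y|lborel. LINT x|lborel. cis (- (x \<bullet> y)) * (f x * g y))
      = (LINT x|lborel. LINT y|lborel. cis (- (x \<bullet> y)) * (f x * g y))"
    by (rule lborel_pair.Fubini_integral)
  moreover have "(LINT x|lborel. cis (- (x \<bullet> y)) * (f x * g y)) = (LINT x|lborel. cis (- (x \<bullet> y)) * f x) * g y" for y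
    by (simp add: mult.assoc[symmetric])
  moreover have "(LINT y|lborel. cis (- (x \<bullet> y)) * (f x * g y)) = f x * (LINT y|lborel. cis (- (y \<bullet> x)) * g y)" for x
    by (simp add: mult.left_commute inner_commute)
  ultimately have eq: "(LINT y|lborel. (LINT x|lborel. cis (- (x \<bullet> y)) * f x) * g y)
      = (LINT x|lborel. f x * (LINT y|lborel. cis (- (y \<bullet> x)) * g y))"
    by simp
  have "(LINT x|lborel. fourier_integral f x * g x)
      = ?c * (LINT y|lborel. (LINT x|lborel. cis (- (x \<bullet> y)) * f x) * g y)"
    by (simp add: fourier_integral_def mult.assoc)
  also have "\<dots> = (LINT x|lborel. f x * fourier_integral g x)"
    by (simp add: eq fourier_integral_def mult.left_commute[of "f _"])
  finally show ?thesis .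
qed

lemma lborel_integral_scale:
  fixes f :: "'a::euclidean_space \<Rightarrow> complex"
  assumes [measurable]: "f \<in> borel_measurable borel" and "0 < a"
  shows "(LINT x|lborel. f x) = of_real (a ^ DIM('a)) * (LINT x|lborel. f (a *\<^sub>R x))"
proof -
  have "(LINT x|lborel. f x) =
      (LINT x|density (distr lborel borel (\<lambda>x. 0 + a *\<^sub>R x)) (\<lambda>_. ennreal (\<bar>a\<bar> ^ DIM('a))). f x)"
    using lborel_affine[of a "0 :: 'a"] \<open>0 < a\<close> by simp
  also have "\<dots> = (LINT x|distr lborel borel (\<lambda>x. 0 + a *\<^sub>R x). (\<bar>a\<bar> ^ DIM('a)) *\<^sub>R f x)"
    by (rule integral_density) auto
  also have "\<dots> = (LINT x|lborel. (\<bar>a\<bar> ^ DIM('a)) *\<^sub>R f (0 + a *\<^sub>R x))"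
    by (rule integral_distr) auto
  finally show ?thesis
    using \<open>0 < a\<close> by (simp add: scaleR_conv_of_real)
qed

text \<open>The width is the one for which the function is its own transform under the unitary
  normalisation; the values are complex because \<open>fourier_integral\<close> acts on complex
  functions.\<close>

definition gaussian :: "'a::euclidean_space \<Rightarrow> complex" where
  "gaussian x = complex_of_real (exp (- (norm x)\<^sup>2 / 2))"

lemma borel_measurable_gaussian [measurable]: "gaussian \<in> borel_measurable borel"
  unfolding gaussian_def[abs_def] by measurable

text \<open>The characteristic function of the standard normal law, taken at \<open>- t\<close> to
  match the sign in the Fourier kernel.\<close>

lemma std_normal_integral:
  "(LINT x|lborel. complex_of_real (std_normal_density x) * cis (- (x * t))) = of_real (exp (- t\<^sup>2 / 2))"
  "integrable lborel (\<lambda>x. complex_of_real (std_normal_density x) * cis (- (x * t)))"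
proof -
  have "char std_normal_distribution (- t) = of_real (exp (- t\<^sup>2 / 2))"
    by (simp add: char_std_normal_distribution)
  moreover have "char std_normal_distribution (- t)
      = (LINT x|lborel. std_normal_density x *\<^sub>R iexp (- t * x))"
    unfolding char_def by (rule integral_density) auto
  moreover have "iexp (- t * x) = cis (- (x * t))" for x
    by (simp add: cis_conv_exp mult.commute)
  ultimately show "(LINT x|lborel. complex_of_real (std_normal_density x) * cis (- (x * t))) = of_real (exp (- t\<^sup>2 / 2))"
    by (simp add: scaleR_conv_of_real)
  show "integrable lborel (\<lambda>x. complex_of_real (std_normal_density x) * cis (- (x * t)))"
  proof (rule Bochner_Integration.integrable_bound)
    show "integrable lborel std_normal_density"
      using integrable_normal_density[of 1 0] by simp
    show "(\<lambda>x. complex_of_real (std_normal_density x) * cis (- (x * t))) \<in> borel_measurable lborel"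
      by measurable
  qed (simp add: norm_mult)
qed

text \<open>\<open>fourier_const\<close> contributes one factor \<open>1 / sqrt (2 * pi)\<close> per
  coordinate, which is what turns each one-dimensional Gaussian into the standard normal density.
  The multidimensional transform thereby reduces to a product of one-dimensional characteristic
  functions.\<close>

lemma gaussian_cis_eq_prod:
  fixes \<xi> :: "'a::euclidean_space" and f :: "'a \<Rightarrow> real"
  defines "x \<equiv> (\<Sum>b\<in>Basis. f b *\<^sub>R b)"
  shows "of_real (fourier_const TYPE('a)) * (cis (- (x \<bullet> \<xi>)) * gaussian x)
    = (\<Prod>b\<in>Basis. complex_of_real (std_normal_density (f b)) * cis (- (f b * (b \<bullet> \<xi>))))"
proof -
  have 1: "cis (- (x \<bullet> \<xi>)) = (\<Prod>b\<in>Basis. cis (- (f b * (b \<bullet> \<xi>))))"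
    unfolding x_def by (simp add: cis_conv_exp exp_sum[symmetric] inner_sum_left sum_negf sum_distrib_left
        sum_distrib_right)
  have nx: "(norm x)\<^sup>2 = (\<Sum>b\<in>Basis. (f b)\<^sup>2)"
    by (simp add: norm_eq_sqrt_inner x_def power2_eq_square inner_sum_left inner_sum_right inner_Basis
        if_distrib sum.If_cases sum_nonneg cong: if_cong)
  have 2: "exp (- (norm x)\<^sup>2 / 2) = (\<Prod>b\<in>Basis. exp (- (f b)\<^sup>2 / 2))"
    by (simp add: nx exp_sum[symmetric] sum_negf sum_divide_distrib)
  have 3: "fourier_const TYPE('a) = (\<Prod>b\<in>(Basis::'a set). 1 / sqrt (2 * pi))"
  proof -
    have "(1 / sqrt (2 * pi)) = (2 * pi) powr (- 1 / 2)"
      by (simp add: powr_minus powr_half_sqrt field_simps)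
    then show ?thesis
      by (simp add: powr_power[symmetric] powr_realpow[symmetric] powr_powr)
  qed
  show ?thesis
    unfolding 1 gaussian_def 2 3 of_real_prod prod.distrib[symmetric]
    by (rule prod.cong) (auto simp: std_normal_density_def mult_ac)
qed

lemma fourier_integral_gaussian:
  fixes \<xi> :: "'a::euclidean_space"
  shows "fourier_integral gaussian \<xi> = gaussian \<xi>"
    and "integrable lborel (gaussian :: 'a \<Rightarrow> complex)"
proof -
  interpret P: product_sigma_finite "\<lambda>b::'a. lborel :: real measure" by standard
  let ?c = "of_real (fourier_const TYPE('a)) :: complex"
  let ?F = "\<lambda>\<xi> (x::'a). ?c * (cis (- (x \<bullet> \<xi>)) * gaussian x)"
  let ?M = "\<Pi>\<^sub>M b\<in>(Basis::'a set). (lborel :: real measure)"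
  have T [measurable]: "(\<lambda>f. \<Sum>b\<in>(Basis::'a set). f b *\<^sub>R b) \<in> measurable ?M borel"
    by measurable
  have m: "?F \<xi> \<in> borel_measurable borel" for \<xi> :: 'a
    by measurable
  have "(LINT x|lborel. ?F \<xi> x) = (LINT f|?M. ?F \<xi> (\<Sum>b\<in>Basis. f b *\<^sub>R b))"
    by (subst lborel_eq, rule integral_distr[OF T m])
  also have "\<dots> = (LINT f|?M. (\<Prod>b\<in>Basis. complex_of_real (std_normal_density (f b)) * cis (- (f b * (b \<bullet> \<xi>)))))"
    by (simp only: gaussian_cis_eq_prod)
  also have "\<dots> = (\<Prod>b\<in>Basis. LINT y|lborel. complex_of_real (std_normal_density y) * cis (- (y * (b \<bullet> \<xi>))))"
    by (rule P.product_integral_prod) (auto intro: std_normal_integral)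
  also have "\<dots> = (\<Prod>b\<in>Basis. of_real (exp (- (b \<bullet> \<xi>)\<^sup>2 / 2)))"
    by (simp only: std_normal_integral)
  also have "\<dots> = of_real (exp (- (\<Sum>b\<in>Basis. (b \<bullet> \<xi>)\<^sup>2) / 2))"
    by (simp only: of_real_prod[symmetric] exp_sum[OF finite_Basis, symmetric] sum_negf[symmetric] sum_divide_distrib)
  also have "(\<Sum>b\<in>Basis. (b \<bullet> \<xi>)\<^sup>2) = (norm \<xi>)\<^sup>2"
    by (simp add: norm_eq_sqrt_inner euclidean_inner[of \<xi> \<xi>] sum_nonneg inner_commute power2_eq_square)
  finally show "fourier_integral gaussian \<xi> = gaussian \<xi>"
    by (simp add: fourier_integral_def gaussian_def)
  \<comment> \<open>At frequency 0 the oscillating factor is 1, so integrability of the product at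
    this frequency is integrability of the Gaussian itself, up to the constant
    \<open>?c\<close>.\<close>
  have "integrable ?M (\<lambda>f. \<Prod>b\<in>Basis. complex_of_real (std_normal_density (f b)) * cis (- (f b * (b \<bullet> (0::'a)))))"
    by (rule P.product_integrable_prod) (auto intro: std_normal_integral)
  then have "integrable ?M (\<lambda>f. ?F 0 (\<Sum>b\<in>Basis. f b *\<^sub>R b))"
    by (simp only: gaussian_cis_eq_prod)
  then have "integrable lborel (?F 0)"
    by (subst lborel_eq) (subst integrable_distr_eq[OF T m])
  then have "integrable lborel (\<lambda>x. inverse ?c * ?F 0 x)"
    by (rule integrable_mult_right)
  then show "integrable lborel (gaussian :: 'a \<Rightarrow> complex)"
    by (simp add: mult.assoc[symmetric])
qed

text \<open>Measure-theoretic induction whose base case is an open set: small translations keep a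
  given point of an open set inside it. Outer regularity carries this to measurable sets of finite
  measure; sums and dominated limits give all integrable functions.\<close>

lemma L1_translation_continuous:
  fixes f :: "'a::euclidean_space \<Rightarrow> complex"
  assumes f: "integrable lborel f" and y: "y \<longlonglongrightarrow> 0"
  shows "(\<lambda>k. LINT x|lborel. cmod (f (y k + x) - f x)) \<longlonglongrightarrow> 0"
proof -
  have trI: "integrable lborel (\<lambda>x. g (c + x))" if "integrable lborel g" for g :: "'a \<Rightarrow> complex" and c
    using lborel_integral_translate(2)[of g c] that borel_measurable_integrable[OF that] by simp
  \<comment> \<open>The symmetric difference of \<open>U\<close> and its translate has measure twice
    that of \<open>U\<close> minus twice that of the overlap, and the overlap converges to
    \<open>U\<close> by dominated convergence.\<close>
  have open_case: "(\<lambda>k. LINT x|lborel. \<bar>indicat_real U (y k + x) - indicat_real U x\<bar>) \<longlonglongrightarrow> 0"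
    if U: "open U" "emeasure lborel U < \<infinity>" for U :: "'a set"
  proof -
    have [measurable]: "U \<in> sets borel" using U by simp
    have I: "integrable lborel (indicat_real U)"
      using U by simp
    have I': "integrable lborel (\<lambda>x. indicat_real U (c + x))" "(LINT x|lborel. indicat_real U (c + x)) = measure lborel U" for c
      using lborel_integral_translate[of "indicat_real U" c] I by simp_all
    have I2: "integrable lborel (\<lambda>x. indicat_real U x * indicat_real U (c + x))" for c
      by (rule Bochner_Integration.integrable_bound[OF I]) (auto simp: indicator_def)
    have "(\<lambda>k. LINT x|lborel. indicat_real U x * indicat_real U (y k + x)) \<longlonglongrightarrow> (LINT x|lborel. indicat_real U x)"
    proof (rule integral_dominated_convergence[where w="indicat_real U"])
      show "AE x in lborel. (\<lambda>k. indicat_real U x * indicat_real U (y k + x)) \<longlonglongrightarrow> indicat_real U x"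
      proof (rule AE_I2)
        fix x
        show "(\<lambda>k. indicat_real U x * indicat_real U (y k + x)) \<longlonglongrightarrow> indicat_real U x"
        proof (cases "x \<in> U")
          case True
          have "(\<lambda>k. y k + x) \<longlonglongrightarrow> 0 + x" by (intro tendsto_intros y)
          then have "\<forall>\<^sub>F k in sequentially. y k + x \<in> U"
            using topological_tendstoD[OF _ U(1), of _ "0 + x"] True by simp
          then have "\<forall>\<^sub>F k in sequentially. indicat_real U x * indicat_real U (y k + x) = indicat_real U x"
            by eventually_elim (simp add: True)
          then show ?thesis by (rule tendsto_eventually)
        qed simp
      qed
    qed (use I in \<open>auto simp: indicator_def\<close>)
    then have "(\<lambda>k. 2 * measure lborel U - 2 * (LINT x|lborel. indicat_real U x * indicat_real U (y k + x)))
        \<longlonglongrightarrow> 2 * measure lborel U - 2 * (LINT x|lborel. indicat_real U x)"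
      by (intro tendsto_intros)
    moreover have "(LINT x|lborel. \<bar>indicat_real U (c + x) - indicat_real U x\<bar>)
        = 2 * measure lborel U - 2 * (LINT x|lborel. indicat_real U x * indicat_real U (c + x))" for c
    proof -
      have "(LINT x|lborel. \<bar>indicat_real U (c + x) - indicat_real U x\<bar>)
          = (LINT x|lborel. indicat_real U (c + x) + indicat_real U x - 2 * (indicat_real U x * indicat_real U (c + x)))"
        by (rule Bochner_Integration.integral_cong) (auto simp: indicator_def)
      also have "\<dots> = 2 * measure lborel U - 2 * (LINT x|lborel. indicat_real U x * indicat_real U (c + x))"
        using I I' I2 by simp
      finally show ?thesis .
    qed
    ultimately show ?thesis by simp
  qed
  show ?thesis using f
  proof (induction rule: integrable_induct)
    case (base A c)
    then have [measurable]: "A \<in> sets borel" by simp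
    have "(\<lambda>k. LINT x|lborel. \<bar>indicat_real A (y k + x) - indicat_real A x\<bar>) \<longlonglongrightarrow> 0"
    proof (rule LIMSEQ_I)
      fix e :: real assume "0 < e"
      \<comment> \<open>Replacing \<open>A\<close> by \<open>U\<close> costs
        \<open>indicat_real (U - A)\<close> and its translate, each of integral below
        \<open>e / 4\<close>; the remaining \<open>e / 2\<close> is left to the open set.\<close>
      then obtain U where U: "open U" "A \<subseteq> U" "emeasure lborel (U - A) < ennreal (e / 4)"
        using outer_regular_lborel[of A "e / 4"] by auto
      have [measurable]: "U \<in> sets borel" using U by simp
      have fU: "emeasure lborel U < \<infinity>"
      proof -
        have "emeasure lborel U \<le> emeasure lborel A + emeasure lborel (U - A)"
          using emeasure_subadditive[of A lborel "U - A"] U(2) by (simp add: Un_absorb1)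
        also have "\<dots> < \<infinity>" using base U(3) by (simp add: less_top order.strict_trans)
        finally show ?thesis .
      qed
      have fD: "emeasure lborel (U - A) < \<infinity>" using U(3) by (simp add: less_top order.strict_trans)
      have mD: "measure lborel (U - A) < e / 4"
      proof -
        have "emeasure lborel (U - A) = ennreal (measure lborel (U - A))"
          by (rule emeasure_eq_ennreal_measure) (use fD in \<open>simp add: less_top\<close>)
        with U(3) have "ennreal (measure lborel (U - A)) < ennreal (e / 4)" by simp
        then show ?thesis using measure_nonneg[of lborel "U - A"] by (simp only: ennreal_less_iff)
      qed
      have ID: "integrable lborel (indicat_real (U - A))" using fD by simp
      have ID': "integrable lborel (\<lambda>x. indicat_real (U - A) (c + x))"
          "(LINT x|lborel. indicat_real (U - A) (c + x)) = measure lborel (U - A)" for c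
        using lborel_integral_translate[of "indicat_real (U - A)" c] ID by simp_all
      have IU: "integrable lborel (\<lambda>x. \<bar>indicat_real B (c + x) - indicat_real B x\<bar>)"
        if [measurable]: "B \<in> sets borel" and "emeasure lborel B < \<infinity>" for B c
      proof -
        have "integrable lborel (indicat_real B)" using that by simp
        moreover from this have "integrable lborel (\<lambda>x. indicat_real B (c + x))"
          using lborel_integral_translate[of "indicat_real B" c] by simp
        ultimately show ?thesis by (intro integrable_abs Bochner_Integration.integrable_diff)
      qed
      obtain K where K: "\<And>k. k \<ge> K \<Longrightarrow> (LINT x|lborel. \<bar>indicat_real U (y k + x) - indicat_real U x\<bar>) < e / 2"
        using order_tendstoD(2)[OF open_case[OF U(1) fU], of "e / 2"] \<open>0 < e\<close>
        by (auto simp: eventually_sequentially)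
      have "norm ((LINT x|lborel. \<bar>indicat_real A (y k + x) - indicat_real A x\<bar>) - 0) < e" if "k \<ge> K" for k
      proof -
        have "(LINT x|lborel. \<bar>indicat_real A (y k + x) - indicat_real A x\<bar>)
          \<le> (LINT x|lborel. \<bar>indicat_real U (y k + x) - indicat_real U x\<bar>
              + (indicat_real (U - A) (y k + x) + indicat_real (U - A) x))"
        proof (intro integral_mono Bochner_Integration.integrable_add ID ID' IU)
          show "\<bar>indicat_real A (y k + x) - indicat_real A x\<bar> \<le> \<bar>indicat_real U (y k + x) - indicat_real U x\<bar>
              + (indicat_real (U - A) (y k + x) + indicat_real (U - A) x)" for x
            using U(2) by (auto simp: indicator_def)
        qed (use base fU in auto)
        also have "\<dots> = (LINT x|lborel. \<bar>indicat_real U (y k + x) - indicat_real U x\<bar>) + 2 * measure lborel (U - A)"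
          using IU[of U] ID ID' fU by simp
        also have "\<dots> < e" using K[OF that] mD by simp
        finally show ?thesis by simp
      qed
      then show "\<exists>K. \<forall>k\<ge>K. norm ((LINT x|lborel. \<bar>indicat_real A (y k + x) - indicat_real A x\<bar>) - 0) < e"
        by blast
    qed
    then have "(\<lambda>k. (LINT x|lborel. \<bar>indicat_real A (y k + x) - indicat_real A x\<bar>) * cmod c) \<longlonglongrightarrow> 0"
      by (rule tendsto_mult_left_zero)
    then show ?case
      by (simp add: scaleR_diff_left[symmetric])
  next
    case (add f g)
    show ?case
    proof (rule Lim_null_comparison[OF always_eventually, OF allI])
      show "(\<lambda>k. (LINT x|lborel. cmod (f (y k + x) - f x)) + (LINT x|lborel. cmod (g (y k + x) - g x))) \<longlonglongrightarrow> 0"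
        using tendsto_add[OF add.IH] by simp
      fix k
      have "(LINT x|lborel. cmod (f (y k + x) + g (y k + x) - (f x + g x)))
          \<le> (LINT x|lborel. cmod (f (y k + x) - f x) + cmod (g (y k + x) - g x))"
        using add.hyps trI[OF add.hyps(1)] trI[OF add.hyps(2)]
        by (intro integral_mono Bochner_Integration.integrable_add Bochner_Integration.integrable_diff
            integrable_norm) (auto simp: add_diff_add intro: norm_triangle_ineq)
      also have "\<dots> = (LINT x|lborel. cmod (f (y k + x) - f x)) + (LINT x|lborel. cmod (g (y k + x) - g x))"
        using add.hyps trI[OF add.hyps(1)] trI[OF add.hyps(2)]
        by (intro Bochner_Integration.integral_add integrable_norm Bochner_Integration.integrable_diff)
      finally show "norm (LINT x|lborel. cmod (f (y k + x) + g (y k + x) - (f x + g x)))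
          \<le> (LINT x|lborel. cmod (f (y k + x) - f x)) + (LINT x|lborel. cmod (g (y k + x) - g x))"
        by simp
    qed
  next
    case (lim f s)
    have [measurable]: "f \<in> borel_measurable borel" "s i \<in> borel_measurable borel" for i
      using borel_measurable_integrable[OF lim.hyps(4)] borel_measurable_integrable[OF lim.hyps(1)] by auto
    have sf: "(\<lambda>i. LINT x|lborel. cmod (s i x - f x)) \<longlonglongrightarrow> (LINT x|(lborel :: 'a measure). (0::real))"
    proof (rule integral_dominated_convergence[where w="\<lambda>x. 3 * cmod (f x)"])
      show "AE x in lborel. (\<lambda>i. cmod (s i x - f x)) \<longlonglongrightarrow> 0"
        using lim.hyps(2) by (auto intro!: tendsto_norm_zero simp: LIM_zero_iff)
      show "AE x in lborel. norm (cmod (s i x - f x)) \<le> 3 * cmod (f x)" for i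
      proof (rule AE_I2)
        fix x
        have "cmod (s i x - f x) \<le> cmod (s i x) + cmod (f x)" by (rule norm_triangle_ineq4)
        also have "\<dots> \<le> 2 * cmod (f x) + cmod (f x)" using lim.hyps(3)[of x i] by simp
        finally show "norm (cmod (s i x - f x)) \<le> 3 * cmod (f x)" by simp
      qed
    qed (use lim.hyps(4) in auto)
    show ?case
    proof (rule LIMSEQ_I)
      fix e :: real assume "0 < e"
      then obtain i where i: "(LINT x|lborel. cmod (s i x - f x)) < e / 4"
        using order_tendstoD(2)[OF sf, of "e / 4"] by (auto simp: eventually_sequentially)
      obtain K where K: "\<And>k. k \<ge> K \<Longrightarrow> (LINT x|lborel. cmod (s i (y k + x) - s i x)) < e / 2"
        using order_tendstoD(2)[OF lim.IH[of i], of "e / 2"] \<open>0 < e\<close>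
        by (auto simp: eventually_sequentially)
      have Id: "integrable lborel (\<lambda>x. cmod (s i x - f x))"
        using lim.hyps(1,4) by (intro integrable_norm Bochner_Integration.integrable_diff)
      have Id': "integrable lborel (\<lambda>x. cmod (s i (c + x) - f (c + x)))"
         "(LINT x|lborel. cmod (s i (c + x) - f (c + x))) = (LINT x|lborel. cmod (s i x - f x))" for c
        using lborel_integral_translate[of "\<lambda>x. cmod (s i x - f x)" c] Id by simp_all
      have Is: "integrable lborel (\<lambda>x. cmod (s i (c + x) - s i x))" for c
        using lim.hyps(1) trI[OF lim.hyps(1)] by (intro integrable_norm Bochner_Integration.integrable_diff)
      have If: "integrable lborel (\<lambda>x. cmod (f (c + x) - f x))" for c
        using lim.hyps(4) trI[OF lim.hyps(4)] by (intro integrable_norm Bochner_Integration.integrable_diff)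
      have "norm ((LINT x|lborel. cmod (f (y k + x) - f x)) - 0) < e" if "k \<ge> K" for k
      proof -
        have "(LINT x|lborel. cmod (f (y k + x) - f x))
          \<le> (LINT x|lborel. cmod (s i (y k + x) - f (y k + x)) + (cmod (s i (y k + x) - s i x)
              + cmod (s i x - f x)))"
        proof (intro integral_mono Bochner_Integration.integrable_add Id Id' Is If)
          fix x
          have "f (y k + x) - f x = - (s i (y k + x) - f (y k + x)) + (s i (y k + x) - s i x + (s i x - f x))"
            by simp
          also have "cmod \<dots> \<le> cmod (s i (y k + x) - f (y k + x)) + (cmod (s i (y k + x) - s i x)
              + cmod (s i x - f x))"
            by (metis (no_types, opaque_lifting) norm_minus_cancel norm_triangle_mono norm_triangle_ineq order_refl)
          finally show "cmod (f (y k + x) - f x) \<le> cmod (s i (y k + x) - f (y k + x)) + (cmod (s i (y k + x) - s i x)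
              + cmod (s i x - f x))" .
        qed
        also have "\<dots> = (LINT x|lborel. cmod (s i x - f x)) + ((LINT x|lborel. cmod (s i (y k + x) - s i x))
            + (LINT x|lborel. cmod (s i x - f x)))"
          using Id Id' Is by simp
        also have "\<dots> < e" using i K[OF that] by simp
        finally show ?thesis by simp
      qed
      then show "\<exists>K. \<forall>k\<ge>K. norm ((LINT x|lborel. cmod (f (y k + x) - f x)) - 0) < e"
        by blast
    qed
  qed
qed


subsection \<open>Plancherel's identity for integrable functions\<close>

lemma lborel_integrable_scale:
  fixes f :: "'a::euclidean_space \<Rightarrow> complex"
  assumes f: "integrable lborel f" and a: "0 < a"
  shows "integrable lborel (\<lambda>x. f (a *\<^sub>R x))"
proof -
  have [measurable]: "f \<in> borel_measurable borel"
    using borel_measurable_integrable[OF f] by simp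
  have "integrable (density (distr lborel borel (\<lambda>x. 0 + a *\<^sub>R x)) (\<lambda>_. ennreal (\<bar>a\<bar> ^ DIM('a)))) f"
    using lborel_affine[of a "0 :: 'a"] a f by simp
  then have "integrable (distr lborel borel (\<lambda>x. 0 + a *\<^sub>R x)) (\<lambda>x. (\<bar>a\<bar> ^ DIM('a)) *\<^sub>R f x)"
    by (subst (asm) integrable_density) auto
  then have "integrable lborel (\<lambda>x. (\<bar>a\<bar> ^ DIM('a)) *\<^sub>R f (0 + a *\<^sub>R x))"
    by (subst (asm) integrable_distr_eq) auto
  then have "integrable lborel (\<lambda>x. (inverse (\<bar>a\<bar> ^ DIM('a))) *\<^sub>R ((\<bar>a\<bar> ^ DIM('a)) *\<^sub>R f (0 + a *\<^sub>R x)))"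
    by (rule integrable_scaleR_right)
  then show ?thesis using a by simp
qed

text \<open>The multiplication formula is used twice. It first moves the transform from
  \<open>f\<close> to \<open>h\<close>, the conjugate transform times a Gaussian. To evaluate
  \<open>fourier_integral h\<close>, it is applied to \<open>cnj f\<close> and a modulated Gaussian,
  whose transform is a translated Gaussian. After rescaling, the right-hand side averages the
  autocorrelation of \<open>f\<close> at scale a.\<close>

lemma gaussian_plancherel_identity:
  fixes f :: "'a::euclidean_space \<Rightarrow> complex"
  assumes f: "integrable lborel f" and a: "0 < a"
  shows "(LINT \<xi>|lborel. fourier_integral f \<xi> * (cnj (fourier_integral f \<xi>) * gaussian (a *\<^sub>R \<xi>)))
    = (LINT x|lborel. f x * (of_real (fourier_const TYPE('a)) * (LINT z|lborel. cnj (f (x + a *\<^sub>R z)) * gaussian z)))"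
proof -
  let ?C = "complex_of_real (fourier_const TYPE('a))"
  have [measurable]: "f \<in> borel_measurable borel"
    using borel_measurable_integrable[OF f] by simp
  define ga where "ga \<xi> = gaussian (a *\<^sub>R \<xi>)" for \<xi> :: 'a
  have ga_meas [measurable]: "ga \<in> borel_measurable borel"
    unfolding ga_def[abs_def] by measurable
  have ga_int: "integrable lborel ga"
    unfolding ga_def[abs_def] by (rule lborel_integrable_scale[OF fourier_integral_gaussian(2) a])
  have cnjf: "integrable lborel (\<lambda>x. cnj (f x))"
    using f by simp
  define h where "h \<xi> = cnj (fourier_integral f \<xi>) * ga \<xi>" for \<xi>
  have h_int: "integrable lborel h"
    unfolding h_def[abs_def]
  proof (rule Bochner_Integration.integrable_bound)
    let ?B = "complex_of_real (fourier_const TYPE('a) * (LINT x|lborel. cmod (f x)))"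
    show "integrable lborel (\<lambda>\<xi>. ?B * ga \<xi>)"
      using ga_int by (rule integrable_mult_right)
    show "(\<lambda>\<xi>. cnj (fourier_integral f \<xi>) * ga \<xi>) \<in> borel_measurable lborel"
      by measurable
    show "AE x in lborel. norm (cnj (fourier_integral f x) * ga x) \<le> norm (?B * ga x)"
      using norm_fourier_integral_le[of f]
      by (auto simp: norm_mult simp del: of_real_mult intro!: mult_right_mono order_trans[OF _ abs_ge_self])
  qed
  \<comment> \<open>The scaling rule for transforms, evaluated at \<open>a *\<^sub>R z\<close> so
    that no division by a occurs.\<close>
  have FIga: "of_real (a ^ DIM('a)) * fourier_integral ga (a *\<^sub>R z) = gaussian z" for z :: 'a
  proof -
    have "gaussian z = ?C * (LINT \<xi>|lborel. cis (- (\<xi> \<bullet> z)) * gaussian \<xi>)"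
      using fourier_integral_gaussian(1)[of z] by (simp add: fourier_integral_def)
    also have "(LINT \<xi>|lborel. cis (- (\<xi> \<bullet> z)) * gaussian \<xi>)
        = of_real (a ^ DIM('a)) * (LINT \<xi>|lborel. cis (- ((a *\<^sub>R \<xi>) \<bullet> z)) * gaussian (a *\<^sub>R \<xi>))"
      by (rule lborel_integral_scale[OF _ a]) measurable
    finally show ?thesis
      by (simp add: fourier_integral_def ga_def mult_ac)
  qed
  have FIh: "fourier_integral h x = ?C * (LINT z|lborel. cnj (f (x + a *\<^sub>R z)) * gaussian z)" for x
  proof -
    \<comment> \<open>Modulation by x on the frequency side becomes translation by x in the
      transform, as recorded in \<open>FIe\<close>.\<close>
    define e where "e \<xi> = cis (x \<bullet> \<xi>) * ga \<xi>" for \<xi>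
    have e_int: "integrable lborel e"
      unfolding e_def[abs_def]
      by (rule Bochner_Integration.integrable_bound[OF ga_int]) (auto simp: norm_mult)
    have FIe: "fourier_integral e y = fourier_integral ga (- x + y)" for y
      unfolding fourier_integral_def e_def mult.assoc[symmetric] cis_mult
      by (simp add: algebra_simps inner_commute)
    \<comment> \<open>The reflection is needed because conjugating a transform reflects its argument
      (\<open>fourier_integral_cnj\<close>).\<close>
    have "(LINT \<xi>|lborel. cis (- (\<xi> \<bullet> x)) * h \<xi>) = (LINT \<xi>|lborel. cis (- (- \<xi> \<bullet> x)) * h (- \<xi>))"
      by (rule lborel_integral_reflect(1)[symmetric]) (unfold h_def, measurable)
    also have "\<dots> = (LINT \<xi>|lborel. fourier_integral (\<lambda>x. cnj (f x)) \<xi> * e \<xi>)"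
      by (rule Bochner_Integration.integral_cong)
        (simp_all add: h_def e_def fourier_integral_cnj ga_def gaussian_def inner_commute mult_ac)
    also have "\<dots> = (LINT y|lborel. cnj (f y) * fourier_integral e y)"
      by (rule fourier_integral_multiplication[OF cnjf e_int])
    also have "\<dots> = (LINT y|lborel. cnj (f (x + y)) * fourier_integral e (x + y))"
      by (rule lborel_integral_translate(1)[symmetric]) (unfold FIe, measurable)
    also have "\<dots> = (LINT y|lborel. cnj (f (x + y)) * fourier_integral ga y)"
      by (simp add: FIe)
    also have "\<dots> = of_real (a ^ DIM('a)) * (LINT z|lborel. cnj (f (x + a *\<^sub>R z)) * fourier_integral ga (a *\<^sub>R z))"
      by (rule lborel_integral_scale[OF _ a]) measurable
    also have "\<dots> = (LINT z|lborel. cnj (f (x + a *\<^sub>R z)) * (of_real (a ^ DIM('a)) * fourier_integral ga (a *\<^sub>R z)))"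
      by (subst integral_mult_right_zero[symmetric]) (simp only: mult.left_commute)
    finally have "(LINT \<xi>|lborel. cis (- (\<xi> \<bullet> x)) * h \<xi>)
        = (LINT z|lborel. cnj (f (x + a *\<^sub>R z)) * gaussian z)"
      by (simp only: FIga)
    then show ?thesis
      by (simp only: fourier_integral_def[of h])
  qed
  have "(LINT \<xi>|lborel. fourier_integral f \<xi> * h \<xi>) = (LINT x|lborel. f x * fourier_integral h x)"
    by (rule fourier_integral_multiplication[OF f h_int])
  then show ?thesis
    by (simp only: FIh) (simp only: h_def ga_def)
qed

lemma square_integrable_bounded:
  assumes f: "integrable lborel f" and B: "\<And>x. cmod (f x) \<le> B"
  shows "square_integrable f"
  unfolding square_integrable_def
proof
  show m: "f \<in> borel_measurable lborel" using f by (rule borel_measurable_integrable)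
  show "integrable lborel (\<lambda>x. (cmod (f x))\<^sup>2)"
  proof (rule Bochner_Integration.integrable_bound)
    show "integrable lborel (\<lambda>x. B * cmod (f x))"
      using f by simp
    show "AE x in lborel. norm ((cmod (f x))\<^sup>2) \<le> norm (B * cmod (f x))"
      using B by (auto simp: power2_eq_square abs_mult intro!: mult_right_mono order_trans[OF B abs_ge_self])
  qed (use m in measurable)
qed

text \<open>Let the scale in \<open>gaussian_plancherel_identity\<close> tend to 0. Boundedness of
  \<open>f\<close> makes its autocorrelation finite everywhere, bounded, and controlled by the L1
  distance between \<open>f\<close> and its translates; its value at 0 is the squared norm of
  \<open>f\<close>.\<close>

lemma plancherel_bounded:
  fixes f :: "'a::euclidean_space \<Rightarrow> complex"
  assumes f: "integrable lborel f" and B: "\<And>x. cmod (f x) \<le> B"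
  shows "square_integrable (fourier_integral f)" "L2norm (fourier_integral f) = L2norm f"
proof -
  let ?C = "complex_of_real (fourier_const TYPE('a))"
  have [measurable]: "f \<in> borel_measurable borel"
    using borel_measurable_integrable[OF f] by simp
  have B0: "0 \<le> B" using norm_ge_zero B order_trans by blast
  \<comment> \<open>The autocorrelation of \<open>f\<close> at lag y.\<close>
  define R where "R y = (LINT x|lborel. f x * cnj (f (y + x)))" for y
  have R_meas [measurable]: "R \<in> borel_measurable borel"
    unfolding R_def[abs_def] by measurable
  have fI: "integrable lborel (\<lambda>x. f x * cnj (f (y + x)))" for y
  proof (rule Bochner_Integration.integrable_bound)
    show "integrable lborel (\<lambda>x. of_real B * f x)"
      using f by (rule integrable_mult_right)
    show "AE x in lborel. norm (f x * cnj (f (y + x))) \<le> norm (of_real B * f x)"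
      using B B0 by (auto simp: norm_mult mult.commute[of B] intro!: mult_left_mono)
  qed measurable
  have R_bound: "cmod (R y) \<le> B * (LINT x|lborel. cmod (f x))" for y
  proof -
    have "cmod (R y) \<le> (LINT x|lborel. cmod (f x * cnj (f (y + x))))"
      unfolding R_def by (rule integral_norm_bound)
    also have "\<dots> \<le> (LINT x|lborel. B * cmod (f x))"
      using f fI[of y, THEN integrable_norm] B B0
      by (intro integral_mono) (auto simp: norm_mult mult.commute[of B] intro!: mult_left_mono)
    finally show ?thesis by simp
  qed
  have R0: "R 0 = of_real ((L2norm f)\<^sup>2)"
    by (simp add: R_def L2norm_power2 complex_norm_square[symmetric] of_real_power[symmetric] del: of_real_power)
  have R_cont: "(\<lambda>k. R (y k)) \<longlonglongrightarrow> R 0" if y: "y \<longlonglongrightarrow> 0" for y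
  proof (rule LIM_zero_cancel, rule Lim_null_comparison[OF always_eventually, OF allI])
    show "(\<lambda>k. B * (LINT x|lborel. cmod (f (y k + x) - f x))) \<longlonglongrightarrow> 0"
      using tendsto_mult_right_zero[OF L1_translation_continuous[OF f y]] by simp
    fix k
    have If: "integrable lborel (\<lambda>x. cmod (f (y k + x) - f x))"
      using f lborel_integral_translate(2)[of f "y k"]
      by (intro integrable_norm Bochner_Integration.integrable_diff) auto
    have "R (y k) - R 0 = (LINT x|lborel. f x * cnj (f (y k + x)) - f x * cnj (f (0 + x)))"
      unfolding R_def by (rule Bochner_Integration.integral_diff[symmetric]) (rule fI)+
    also have "norm \<dots> \<le> (LINT x|lborel. cmod (f x * cnj (f (y k + x)) - f x * cnj (f (0 + x))))"
      by (rule integral_norm_bound)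
    also have "\<dots> \<le> (LINT x|lborel. B * cmod (f (y k + x) - f x))"
    proof (rule integral_mono)
      show "integrable lborel (\<lambda>x. cmod (f x * cnj (f (y k + x)) - f x * cnj (f (0 + x))))"
        by (intro integrable_norm Bochner_Integration.integrable_diff fI)
      fix x
      have "f x * cnj (f (y k + x)) - f x * cnj (f (0 + x)) = f x * cnj (f (y k + x) - f x)"
        by (simp add: algebra_simps)
      then show "cmod (f x * cnj (f (y k + x)) - f x * cnj (f (0 + x))) \<le> B * cmod (f (y k + x) - f x)"
        using B by (simp only: norm_mult complex_mod_cnj mult_right_mono norm_ge_zero)
    qed (use If in simp)
    finally show "norm (R (y k) - R 0) \<le> B * (LINT x|lborel. cmod (f (y k + x) - f x))"
      by simp
  qed
  define a where "a k = 1 / real (Suc k)" for k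
  have a: "0 < a k" "a \<longlonglongrightarrow> 0" for k
    unfolding a_def[abs_def] using LIMSEQ_inverse_real_of_nat by (auto simp: inverse_eq_divide)
  have RHS: "(LINT x|lborel. f x * (?C * (LINT z|lborel. cnj (f (x + a k *\<^sub>R z)) * gaussian z)))
      = ?C * (LINT z|lborel. gaussian z * R (a k *\<^sub>R z))" for k
  proof -
    have "integrable (lborel \<Otimes>\<^sub>M lborel) (\<lambda>(x, z). cnj (f (x + a k *\<^sub>R z)) * (f x * gaussian z))"
      by (rule integrable_pair_mult[OF f fourier_integral_gaussian(2), where B=B]) (use B in auto)
    then have F: "(LINT z|lborel. LINT x|lborel. cnj (f (x + a k *\<^sub>R z)) * (f x * gaussian z))
        = (LINT x|lborel. LINT z|lborel. cnj (f (x + a k *\<^sub>R z)) * (f x * gaussian z))"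
      by (rule lborel_pair.Fubini_integral)
    have 1: "(LINT x|lborel. cnj (f (x + a k *\<^sub>R z)) * (f x * gaussian z)) = gaussian z * R (a k *\<^sub>R z)" for z
    proof -
      have "(LINT x|lborel. cnj (f (x + a k *\<^sub>R z)) * (f x * gaussian z))
          = (LINT x|lborel. gaussian z * (f x * cnj (f (a k *\<^sub>R z + x))))"
        by (rule Bochner_Integration.integral_cong) (simp_all add: mult_ac add.commute)
      then show ?thesis by (simp add: R_def)
    qed
    have 2: "(LINT z|lborel. cnj (f (x + a k *\<^sub>R z)) * (f x * gaussian z))
        = f x * (LINT z|lborel. cnj (f (x + a k *\<^sub>R z)) * gaussian z)" for x
      by (subst integral_mult_right_zero[symmetric]) (simp only: mult.left_commute)
    have "(LINT x|lborel. f x * (?C * (LINT z|lborel. cnj (f (x + a k *\<^sub>R z)) * gaussian z)))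
        = (LINT x|lborel. ?C * (f x * (LINT z|lborel. cnj (f (x + a k *\<^sub>R z)) * gaussian z)))"
      by (simp only: mult.left_commute)
    also have "\<dots> = ?C * (LINT z|lborel. gaussian z * R (a k *\<^sub>R z))"
      using F unfolding 1 2 by simp
    finally show ?thesis .
  qed
  \<comment> \<open>The physical side passes to the limit by dominated convergence: \<open>R\<close>
    is bounded and continuous at 0, and the Gaussian is integrable with total mass 1 after
    multiplication by \<open>?C\<close>.\<close>
  have "(\<lambda>k. LINT z|lborel. gaussian z * R (a k *\<^sub>R z)) \<longlonglongrightarrow> (LINT z::'a|lborel. gaussian z * R 0)"
  proof (rule integral_dominated_convergence)
    show "integrable lborel (\<lambda>z::'a. cmod (gaussian z) * (B * (LINT x|lborel. cmod (f x))))"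
      by (intro integrable_mult_left integrable_norm fourier_integral_gaussian)
    show "AE z in lborel. (\<lambda>k. gaussian z * R (a k *\<^sub>R z)) \<longlonglongrightarrow> gaussian z * R 0"
    proof (rule AE_I2)
      fix z :: 'a
      have "(\<lambda>k. a k *\<^sub>R z) \<longlonglongrightarrow> 0 *\<^sub>R z"
        by (intro tendsto_intros a)
      then show "(\<lambda>k. gaussian z * R (a k *\<^sub>R z)) \<longlonglongrightarrow> gaussian z * R 0"
        by (intro tendsto_intros R_cont) simp
    qed
    show "AE z in lborel. norm (gaussian z * R (a k *\<^sub>R z)) \<le> cmod (gaussian z) * (B * (LINT x|lborel. cmod (f x)))" for k
      using R_bound by (auto simp: norm_mult intro!: mult_left_mono)
  qed measurable
  then have "(\<lambda>k. ?C * (LINT z|lborel. gaussian z * R (a k *\<^sub>R z))) \<longlonglongrightarrow> ?C * (LINT z::'a|lborel. gaussian z * R 0)"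
    by (rule tendsto_mult_left)
  also have "?C * (LINT z::'a|lborel. gaussian z * R 0) = (?C * (LINT z::'a|lborel. gaussian z)) * R 0"
    by (simp only: integral_mult_left_zero mult.assoc)
  also have "?C * (LINT z::'a|lborel. gaussian z) = 1"
    using fourier_integral_gaussian(1)[of "0::'a"] by (simp add: fourier_integral_def gaussian_def)
  finally have lim: "(\<lambda>k. ?C * (LINT z|lborel. gaussian z * R (a k *\<^sub>R z))) \<longlonglongrightarrow> of_real ((L2norm f)\<^sup>2)"
    by (simp add: R0)
  define F where "F k \<xi> = (cmod (fourier_integral f \<xi>))\<^sup>2 * exp (- (norm (a k *\<^sub>R \<xi>))\<^sup>2 / 2)" for k \<xi>
  have LHS: "complex_of_real (LINT \<xi>|lborel. F k \<xi>) = ?C * (LINT z|lborel. gaussian z * R (a k *\<^sub>R z))" for k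
  proof -
    have "complex_of_real (F k \<xi>) = fourier_integral f \<xi> * (cnj (fourier_integral f \<xi>) * gaussian (a k *\<^sub>R \<xi>))" for \<xi>
      by (simp only: F_def of_real_mult gaussian_def mult.assoc[symmetric] complex_norm_square[symmetric])
    then have "complex_of_real (LINT \<xi>|lborel. F k \<xi>)
        = (LINT \<xi>|lborel. fourier_integral f \<xi> * (cnj (fourier_integral f \<xi>) * gaussian (a k *\<^sub>R \<xi>)))"
      by (simp only: integral_complex_of_real[symmetric])
    then show ?thesis
      by (simp only: gaussian_plancherel_identity[OF f a(1)] RHS)
  qed
  have lim2: "(\<lambda>k. LINT \<xi>|lborel. F k \<xi>) \<longlonglongrightarrow> (L2norm f)\<^sup>2"
    using lim unfolding LHS[symmetric] tendsto_of_real_iff .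
  have F_int: "integrable lborel (F k)" for k
  proof (rule Bochner_Integration.integrable_bound)
    let ?b = "fourier_const TYPE('a) * (LINT x|lborel. cmod (f x))"
    have "integrable lborel (\<lambda>\<xi>::'a. gaussian (a k *\<^sub>R \<xi>))"
      by (rule lborel_integrable_scale[OF fourier_integral_gaussian(2) a(1)])
    then show "integrable lborel (\<lambda>\<xi>::'a. ?b\<^sup>2 * cmod (gaussian (a k *\<^sub>R \<xi>)))"
      by (intro integrable_mult_right integrable_norm)
    show "F k \<in> borel_measurable lborel"
      unfolding F_def[abs_def] by measurable
    show "AE x in lborel. norm (F k x) \<le> norm (?b\<^sup>2 * cmod (gaussian (a k *\<^sub>R x)))"
    proof (rule AE_I2)
      fix x
      have "norm (F k x) = F k x" by (simp add: F_def)
      also have "\<dots> \<le> ?b\<^sup>2 * exp (- (norm (a k *\<^sub>R x))\<^sup>2 / 2)"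
        unfolding F_def by (intro mult_right_mono power_mono norm_fourier_integral_le) auto
      also have "\<dots> = norm (?b\<^sup>2 * cmod (gaussian (a k *\<^sub>R x)))"
        by (simp add: gaussian_def abs_mult)
      finally show "norm (F k x) \<le> norm (?b\<^sup>2 * cmod (gaussian (a k *\<^sub>R x)))" .
    qed
  qed
  have mono: "mono (\<lambda>k. F k \<xi>)" for \<xi>
  proof (rule monoI)
    fix k l :: nat assume "k \<le> l"
    then have "a l \<le> a k" by (simp add: a_def frac_le)
    then have "(norm (a l *\<^sub>R \<xi>))\<^sup>2 \<le> (norm (a k *\<^sub>R \<xi>))\<^sup>2"
      using a(1)[of k] a(1)[of l] by (intro power_mono) (auto intro!: mult_right_mono)
    then show "F k \<xi> \<le> F l \<xi>"
      unfolding F_def by (intro mult_left_mono) auto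
  qed
  have conv: "(\<lambda>k. F k \<xi>) \<longlonglongrightarrow> (cmod (fourier_integral f \<xi>))\<^sup>2" for \<xi>
  proof -
    have "(\<lambda>k. (cmod (fourier_integral f \<xi>))\<^sup>2 * exp (- (norm (a k *\<^sub>R \<xi>))\<^sup>2 / 2))
        \<longlonglongrightarrow> (cmod (fourier_integral f \<xi>))\<^sup>2 * exp (- (norm (0 *\<^sub>R \<xi>))\<^sup>2 / 2)"
      by (intro tendsto_intros a) simp
    then show ?thesis by (simp add: F_def)
  qed
  \<comment> \<open>On the frequency side no integrable majorant is available yet. As the scales
    \<open>a k\<close> decrease, the Gaussian factors increase to 1, so monotone convergence
    delivers integrability of the square together with its value.\<close>
  have "has_bochner_integral lborel (\<lambda>\<xi>. (cmod (fourier_integral f \<xi>))\<^sup>2) ((L2norm f)\<^sup>2)"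
    by (rule has_bochner_integral_monotone_convergence[OF F_int _ _ lim2]) (use mono conv in auto)
  then show "square_integrable (fourier_integral f)" "L2norm (fourier_integral f) = L2norm f"
    unfolding has_bochner_integral_iff square_integrable_def
    by (auto simp: L2norm_def[of "fourier_integral f"])
qed

text \<open>Domination is required of the difference and not of \<open>F k\<close>, because
  truncations, which keep a value or replace it by 0, satisfy it directly.\<close>

lemma L2_dominated_convergence:
  fixes F :: "nat \<Rightarrow> 'a::euclidean_space \<Rightarrow> complex"
  assumes F: "\<And>k. F k \<in> borel_measurable borel" and f: "square_integrable f"
    and le: "\<And>k x. cmod (F k x - f x) \<le> cmod (f x)" and lim: "\<And>x. (\<lambda>k. F k x) \<longlonglongrightarrow> f x"
  shows "(\<lambda>k. L2norm (\<lambda>x. F k x - f x)) \<longlonglongrightarrow> 0"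
proof -
  have [measurable]: "F k \<in> borel_measurable borel" "f \<in> borel_measurable borel" for k
    using F f square_integrable_measurable by auto
  have "(\<lambda>k. LINT x|lborel. (cmod (F k x - f x))\<^sup>2) \<longlonglongrightarrow> (LINT x|(lborel :: 'a measure). (0::real))"
  proof (rule integral_dominated_convergence)
    show "integrable lborel (\<lambda>x. (cmod (f x))\<^sup>2)" using f by (simp add: square_integrable_def)
    show "AE x in lborel. (\<lambda>k. (cmod (F k x - f x))\<^sup>2) \<longlonglongrightarrow> 0"
    proof (rule AE_I2)
      fix x
      have "(\<lambda>k. (cmod (F k x - f x))\<^sup>2) \<longlonglongrightarrow> (cmod (f x - f x))\<^sup>2"
        by (intro tendsto_intros lim)
      then show "(\<lambda>k. (cmod (F k x - f x))\<^sup>2) \<longlonglongrightarrow> 0" by simp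
    qed
    show "AE x in lborel. norm ((cmod (F k x - f x))\<^sup>2) \<le> (cmod (f x))\<^sup>2" for k
      using le by (auto intro!: power_mono)
  qed simp_all
  then have "(\<lambda>k. sqrt (LINT x|lborel. (cmod (F k x - f x))\<^sup>2)) \<longlonglongrightarrow> sqrt 0"
    by (intro tendsto_intros) simp
  then show ?thesis by (simp add: L2norm_def)
qed

text \<open>Truncation in height reduces to bounded functions. By the bounded case the transforms of
  the truncations are Cauchy in L2, and by dominated convergence in L1 they converge pointwise to
  \<open>fourier_integral f\<close>; the two limits coincide almost everywhere.\<close>

lemma plancherel_L1:
  fixes f :: "'a::euclidean_space \<Rightarrow> complex"
  assumes f: "integrable lborel f" "square_integrable f"
  shows "square_integrable (fourier_integral f)" "L2norm (fourier_integral f) = L2norm f"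
proof -
  have [measurable]: "f \<in> borel_measurable borel"
    using borel_measurable_integrable[OF f(1)] by simp
  define F where "F k x = (if cmod (f x) \<le> real k then f x else 0)" for k :: nat and x
  have [measurable]: "F k \<in> borel_measurable borel" for k
    unfolding F_def[abs_def] by measurable
  have F_le: "cmod (F k x) \<le> cmod (f x)" "cmod (F k x) \<le> real k" "cmod (F k x - f x) \<le> cmod (f x)" for k x
    by (auto simp: F_def)
  have F_int: "integrable lborel (F k)" for k
    by (rule Bochner_Integration.integrable_bound[OF f(1)]) (auto simp: F_le)
  have F_sq: "square_integrable (F k)" for k
    by (rule square_integrable_bound[OF f(2)]) (auto simp: F_le)
  have F_lim: "(\<lambda>k. F k x) \<longlonglongrightarrow> f x" for x
  proof (rule tendsto_eventually)
    obtain N where "cmod (f x) \<le> real N" using real_arch_simple by blast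
    then show "\<forall>\<^sub>F k in sequentially. F k x = f x"
      unfolding eventually_sequentially by (intro exI[of _ N]) (auto simp: F_def)
  qed
  have L2: "(\<lambda>k. L2norm (\<lambda>x. F k x - f x)) \<longlonglongrightarrow> 0"
    by (rule L2_dominated_convergence[OF _ f(2) _ F_lim]) (auto simp: F_le)
  have FIF: "square_integrable (fourier_integral (F k))" "L2norm (fourier_integral (F k)) = L2norm (F k)" for k
    using plancherel_bounded[OF F_int F_le(2)] by auto
  have diff: "L2norm (\<lambda>x. fourier_integral (F m) x - fourier_integral (F n) x) = L2norm (\<lambda>x. F m x - F n x)" for m n
  proof -
    have "cmod (F m x - F n x) \<le> real m + real n" for x
      using norm_triangle_ineq4[of "F m x" "F n x"] F_le(2)[of m x] F_le(2)[of n x] by linarith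
    from plancherel_bounded(2)[OF Bochner_Integration.integrable_diff[OF F_int F_int] this]
    show ?thesis
      by (simp add: fourier_integral_diff[OF F_int F_int, abs_def])
  qed
  obtain g where g: "square_integrable g" "(\<lambda>k. L2norm (\<lambda>x. fourier_integral (F k) x - g x)) \<longlonglongrightarrow> 0"
  proof (rule L2_complete[of "\<lambda>k. fourier_integral (F k)"])
    fix e :: real assume "0 < e"
    then obtain N where N: "\<And>k. k \<ge> N \<Longrightarrow> L2norm (\<lambda>x. F k x - f x) < e / 2"
      using order_tendstoD(2)[OF L2, of "e / 2"] by (auto simp: eventually_sequentially)
    have "L2norm (\<lambda>x. fourier_integral (F m) x - fourier_integral (F n) x) \<le> e" if "m \<ge> N" "n \<ge> N" for m n
      using L2norm_triangle_diff3[OF F_sq f(2) F_sq, of m n] N[OF that(1)] N[OF that(2)]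
      by (simp add: diff L2norm_diff_commute[of f])
    then show "\<exists>N. \<forall>m\<ge>N. \<forall>n\<ge>N. L2norm (\<lambda>x. fourier_integral (F m) x - fourier_integral (F n) x) \<le> e"
      by blast
  qed (use FIF in auto)
  \<comment> \<open>Here integrability of \<open>f\<close> supplies the majorant, uniformly in the
    truncation level.\<close>
  have FI_lim: "(\<lambda>k. fourier_integral (F k) \<xi>) \<longlonglongrightarrow> fourier_integral f \<xi>" for \<xi>
    unfolding fourier_integral_def
  proof (intro tendsto_intros integral_dominated_convergence)
    show "integrable lborel (\<lambda>x. cmod (f x))" using f by simp
    show "AE x in lborel. (\<lambda>k. cis (- (x \<bullet> \<xi>)) * F k x) \<longlonglongrightarrow> cis (- (x \<bullet> \<xi>)) * f x"
      by (intro AE_I2 tendsto_intros F_lim)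
    show "AE x in lborel. norm (cis (- (x \<bullet> \<xi>)) * F k x) \<le> cmod (f x)" for k
      by (simp add: norm_mult F_le)
  qed measurable
  have ae: "AE x in lborel. fourier_integral f x = g x"
    by (rule L2_limit_unique_pointwise[OF FIF(1) g(1) _ _ g(2)]) (use FI_lim in auto)
  show "square_integrable (fourier_integral f)"
    by (rule square_integrable_AE_cong[OF g(1)]) (use ae in auto)
  have "L2norm (fourier_integral f) = L2norm g"
    by (rule L2norm_AE_cong[OF _ _ ae]) (use square_integrable_measurable[OF g(1)] in auto)
  also have "L2norm g = L2norm f"
    using L2norm_tendsto[OF FIF(1) g] L2norm_tendsto[OF F_sq f(2) L2] unfolding FIF(2)
    by (rule LIMSEQ_unique)
  finally show "L2norm (fourier_integral f) = L2norm f" .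
qed


subsection \<open>The Fourier transform on \<open>L\<^sup>2\<close>\<close>

abbreviation ball_cutoff :: "real \<Rightarrow> ('a::euclidean_space \<Rightarrow> complex) \<Rightarrow> 'a \<Rightarrow> complex" where
  "ball_cutoff R f \<equiv> (\<lambda>x. if x \<in> cball 0 R then f x else 0)"

lemma square_integrable_ball_cutoff:
  fixes f :: "'a::euclidean_space \<Rightarrow> complex"
  assumes "square_integrable f" shows "square_integrable (ball_cutoff R f)"
proof (rule square_integrable_bound(1)[OF assms])
  have [measurable]: "f \<in> borel_measurable borel" "cball 0 R \<in> sets (borel :: 'a measure)"
    using assms square_integrable_measurable by auto
  show "ball_cutoff R f \<in> borel_measurable borel" by measurable
qed simp

text \<open>The cutoff is the product of \<open>f\<close> with the indicator of a ball, both square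
  integrable. This is why the Fourier integrals in \<open>is_fourier_transform\<close> are genuine
  integrals.\<close>

lemma integrable_ball_cutoff:
  fixes f :: "'a::euclidean_space \<Rightarrow> complex"
  assumes "square_integrable f" shows "integrable lborel (ball_cutoff R f)"
proof -
  have "square_integrable (\<lambda>x::'a. complex_of_real (indicat_real (cball 0 R) x))"
  proof (rule square_integrable_bounded[where B=1])
    have "integrable lborel (indicat_real (cball (0::'a) R))"
      using emeasure_lborel_cball_finite[of "0::'a" R] by (intro integrable_real_indicator) auto
    then show "integrable lborel (\<lambda>x::'a. complex_of_real (indicat_real (cball 0 R) x))"
      by (rule integrable_of_real)
  qed (simp add: indicator_def)
  from integrable_mult_square_integrable[OF assms this] show ?thesis
    by (rule Bochner_Integration.integrable_cong[THEN iffD1, rotated -1]) auto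
qed

lemma ball_cutoff_tendsto:
  fixes f :: "'a::euclidean_space \<Rightarrow> complex"
  assumes f: "square_integrable f"
  shows "((\<lambda>R. L2norm (\<lambda>x. ball_cutoff R f x - f x)) \<longlongrightarrow> 0) at_top"
proof -
  have seq: "(\<lambda>k. L2norm (\<lambda>x. ball_cutoff (real k) f x - f x)) \<longlonglongrightarrow> 0"
  proof (rule L2_dominated_convergence[OF _ f])
    show "ball_cutoff (real k) f \<in> borel_measurable borel" for k
      by (rule square_integrable_measurable) (rule square_integrable_ball_cutoff[OF f])
    show "(\<lambda>k. ball_cutoff (real k) f x) \<longlonglongrightarrow> f x" for x
    proof (rule tendsto_eventually)
      obtain N where "norm x \<le> real N" using real_arch_simple by blast
      then show "\<forall>\<^sub>F k in sequentially. ball_cutoff (real k) f x = f x"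
        unfolding eventually_sequentially by (intro exI[of _ N]) (auto simp: )
    qed
  qed auto
  show ?thesis
  proof (rule tendstoI)
    fix e :: real assume "0 < e"
    then obtain k where k: "L2norm (\<lambda>x. ball_cutoff (real k) f x - f x) < e"
      using order_tendstoD(2)[OF seq] by (auto simp: eventually_sequentially)
    \<comment> \<open>The error does not increase with the radius, so smallness at one integer
      radius passes to all larger real radii.\<close>
    have "L2norm (\<lambda>x. ball_cutoff R f x - f x) < e" if "R \<ge> real k" for R
    proof -
      have "L2norm (\<lambda>x. ball_cutoff R f x - f x) \<le> L2norm (\<lambda>x. ball_cutoff (real k) f x - f x)"
      proof (rule square_integrable_bound(2))
        show "square_integrable (\<lambda>x. ball_cutoff (real k) f x - f x)"
          by (intro square_integrable_diff square_integrable_ball_cutoff f)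
        show "(\<lambda>x. ball_cutoff R f x - f x) \<in> borel_measurable borel"
          by (intro square_integrable_measurable square_integrable_diff square_integrable_ball_cutoff f)
        show "cmod (ball_cutoff R f x - f x) \<le> cmod (ball_cutoff (real k) f x - f x)" for x
          using that by simp
      qed
      with k show ?thesis by simp
    qed
    then show "\<forall>\<^sub>F R in at_top. dist (L2norm (\<lambda>x. ball_cutoff R f x - f x)) 0 < e"
      by (intro eventually_at_top_linorderI[of "real k"]) simp
  qed
qed

lemma square_integrable_fourier_cutoff:
  "square_integrable f \<Longrightarrow> square_integrable (fourier_integral (ball_cutoff R f))"
  by (intro plancherel_L1 integrable_ball_cutoff square_integrable_ball_cutoff)

text \<open>The definition measures the error by a nonnegative extended integral; Plancherel's
  identity for the cutoffs shows that it is finite, which permits real-valued \<open>L2norm\<close>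
  estimates from here on.\<close>

lemma is_fourier_transform_iff:
  "is_fourier_transform f g \<longleftrightarrow> square_integrable f \<and> square_integrable g \<and>
    ((\<lambda>R. L2norm (\<lambda>\<xi>. fourier_integral (ball_cutoff R f) \<xi> - g \<xi>)) \<longlongrightarrow> 0) at_top"
proof -
  let ?L = "\<lambda>R. L2norm (\<lambda>\<xi>. fourier_integral (ball_cutoff R f) \<xi> - g \<xi>)"
  have "((\<lambda>R. ennreal ((?L R)\<^sup>2)) \<longlongrightarrow> 0) at_top \<longleftrightarrow> (?L \<longlongrightarrow> 0) at_top"
  proof
    assume "((\<lambda>R. ennreal ((?L R)\<^sup>2)) \<longlongrightarrow> 0) at_top"
    then have "((\<lambda>R. ennreal ((?L R)\<^sup>2)) \<longlongrightarrow> ennreal 0) at_top" by simp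
    then have "((\<lambda>R. (?L R)\<^sup>2) \<longlongrightarrow> 0) at_top"
      by (subst (asm) tendsto_ennreal_iff) auto
    then have "((\<lambda>R. sqrt ((?L R)\<^sup>2)) \<longlongrightarrow> sqrt 0) at_top" by (rule tendsto_real_sqrt)
    then show "(?L \<longlongrightarrow> 0) at_top" by simp
  next
    assume "(?L \<longlongrightarrow> 0) at_top"
    then have "((\<lambda>R. (?L R)\<^sup>2) \<longlongrightarrow> 0\<^sup>2) at_top" by (rule tendsto_power)
    then have "((\<lambda>R. ennreal ((?L R)\<^sup>2)) \<longlongrightarrow> ennreal (0\<^sup>2)) at_top" by (rule tendsto_ennrealI)
    then show "((\<lambda>R. ennreal ((?L R)\<^sup>2)) \<longlongrightarrow> 0) at_top" by simp
  qed
  moreover have "(\<integral>\<^sup>+ \<xi>. ennreal ((cmod (fourier_integral (ball_cutoff R f) \<xi> - g \<xi>))\<^sup>2) \<partial>lborel) = ennreal ((?L R)\<^sup>2)"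
    if "square_integrable f" "square_integrable g" for R
    by (rule nn_integral_square_integrable) (intro square_integrable_diff square_integrable_fourier_cutoff that)
  ultimately show ?thesis
    unfolding is_fourier_transform_def by auto
qed

lemma fourier_cutoff_diff:
  assumes "square_integrable f" "square_integrable g"
  shows "L2norm (\<lambda>\<xi>. fourier_integral (ball_cutoff R f) \<xi> - fourier_integral (ball_cutoff S g) \<xi>)
    = L2norm (\<lambda>x. ball_cutoff R f x - ball_cutoff S g x)"
proof -
  have eq: "fourier_integral (\<lambda>x. ball_cutoff R f x - ball_cutoff S g x)
      = (\<lambda>\<xi>. fourier_integral (ball_cutoff R f) \<xi> - fourier_integral (ball_cutoff S g) \<xi>)"
    by (rule ext) (intro fourier_integral_diff integrable_ball_cutoff assms)
  have "L2norm (fourier_integral (\<lambda>x. ball_cutoff R f x - ball_cutoff S g x))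
      = L2norm (\<lambda>x. ball_cutoff R f x - ball_cutoff S g x)"
    by (intro plancherel_L1 Bochner_Integration.integrable_diff integrable_ball_cutoff
        square_integrable_diff square_integrable_ball_cutoff assms)
  then show ?thesis by (simp only: eq)
qed

text \<open>By Plancherel the transforms of the cutoffs are as close to each other as the cutoffs
  themselves, so completeness yields a limit along integer radii.\<close>

lemma is_fourier_transform_exists:
  fixes f :: "'a::euclidean_space \<Rightarrow> complex"
  assumes f: "square_integrable f" shows "\<exists>g. is_fourier_transform f g"
proof -
  let ?d = "\<lambda>R. L2norm (\<lambda>x. ball_cutoff R f x - f x)"
  have d: "L2norm (\<lambda>\<xi>. fourier_integral (ball_cutoff R f) \<xi> - fourier_integral (ball_cutoff S f) \<xi>) \<le> ?d R + ?d S" for R S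
    using L2norm_triangle_diff3[OF square_integrable_ball_cutoff[OF f] f square_integrable_ball_cutoff[OF f], of R S]
    by (simp only: fourier_cutoff_diff[OF f f] L2norm_diff_commute[of f])
  have dlim: "(\<lambda>k. ?d (real k)) \<longlonglongrightarrow> 0"
    using filterlim_compose[OF ball_cutoff_tendsto[OF f] filterlim_real_sequentially] .
  obtain g where g: "square_integrable g"
    "(\<lambda>k. L2norm (\<lambda>\<xi>. fourier_integral (ball_cutoff (real k) f) \<xi> - g \<xi>)) \<longlonglongrightarrow> 0"
  proof (rule L2_complete[of "\<lambda>k. fourier_integral (ball_cutoff (real k) f)"])
    fix e :: real assume "0 < e"
    then obtain N where N: "\<And>k. k \<ge> N \<Longrightarrow> ?d (real k) < e / 2"
      using order_tendstoD(2)[OF dlim, of "e / 2"] by (auto simp: eventually_sequentially)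
    show "\<exists>N. \<forall>m\<ge>N. \<forall>n\<ge>N. L2norm (\<lambda>x. fourier_integral (ball_cutoff (real m) f) x - fourier_integral (ball_cutoff (real n) f) x) \<le> e"
    proof (intro exI allI impI)
      fix m n assume "N \<le> m" "N \<le> n"
      then show "L2norm (\<lambda>x. fourier_integral (ball_cutoff (real m) f) x - fourier_integral (ball_cutoff (real n) f) x) \<le> e"
        using d[of "real m" "real n"] N[of m] N[of n] by linarith
    qed
  qed (rule square_integrable_fourier_cutoff[OF f])
  \<comment> \<open>Letting k tend to infinity in the triangle inequality leaves a bound in terms of
    R alone, which gives the limit over real radii that the definition asks for.\<close>
  have le: "L2norm (\<lambda>\<xi>. fourier_integral (ball_cutoff R f) \<xi> - g \<xi>) \<le> ?d R" for R
  proof (rule LIMSEQ_le_const)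
    show "(\<lambda>k. ?d R + ?d (real k) + L2norm (\<lambda>\<xi>. fourier_integral (ball_cutoff (real k) f) \<xi> - g \<xi>)) \<longlonglongrightarrow> ?d R"
      using tendsto_add[OF tendsto_add[OF tendsto_const dlim] g(2), of "?d R"] by simp
    have "L2norm (\<lambda>\<xi>. fourier_integral (ball_cutoff R f) \<xi> - g \<xi>)
        \<le> ?d R + ?d (real k) + L2norm (\<lambda>\<xi>. fourier_integral (ball_cutoff (real k) f) \<xi> - g \<xi>)" for k
      using L2norm_triangle_diff3[OF square_integrable_fourier_cutoff[OF f] square_integrable_fourier_cutoff[OF f] g(1), of R "real k"]
        d[of R "real k"] by linarith
    then show "\<exists>N. \<forall>k\<ge>N. L2norm (\<lambda>\<xi>. fourier_integral (ball_cutoff R f) \<xi> - g \<xi>)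
        \<le> ?d R + ?d (real k) + L2norm (\<lambda>\<xi>. fourier_integral (ball_cutoff (real k) f) \<xi> - g \<xi>)"
      by blast
  qed
  have "((\<lambda>R. L2norm (\<lambda>\<xi>. fourier_integral (ball_cutoff R f) \<xi> - g \<xi>)) \<longlongrightarrow> 0) at_top"
    by (rule Lim_null_comparison[OF always_eventually ball_cutoff_tendsto[OF f]]) (use le in simp)
  then show ?thesis
    using f g(1) by (auto simp: is_fourier_transform_iff)
qed

lemma is_fourier_transform_unique:
  assumes "is_fourier_transform f g" "is_fourier_transform f h"
  shows "AE \<xi> in lborel. g \<xi> = h \<xi>"
proof -
  have sq: "square_integrable f" "square_integrable g" "square_integrable h"
    using assms by (auto simp: is_fourier_transform_iff)
  have lim: "((\<lambda>R. L2norm (\<lambda>\<xi>. fourier_integral (ball_cutoff R f) \<xi> - g \<xi>)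
      + L2norm (\<lambda>\<xi>. fourier_integral (ball_cutoff R f) \<xi> - h \<xi>)) \<longlongrightarrow> 0 + 0) at_top"
    using assms by (intro tendsto_add) (auto simp: is_fourier_transform_iff)
  have "L2norm (\<lambda>\<xi>. g \<xi> - h \<xi>) \<le> 0 + 0"
  proof (rule tendsto_lowerbound[OF lim])
    show "\<forall>\<^sub>F R in at_top. L2norm (\<lambda>\<xi>. g \<xi> - h \<xi>)
        \<le> L2norm (\<lambda>\<xi>. fourier_integral (ball_cutoff R f) \<xi> - g \<xi>)
          + L2norm (\<lambda>\<xi>. fourier_integral (ball_cutoff R f) \<xi> - h \<xi>)"
    proof (rule always_eventually, rule allI)
      fix R
      show "L2norm (\<lambda>\<xi>. g \<xi> - h \<xi>)
        \<le> L2norm (\<lambda>\<xi>. fourier_integral (ball_cutoff R f) \<xi> - g \<xi>)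
          + L2norm (\<lambda>\<xi>. fourier_integral (ball_cutoff R f) \<xi> - h \<xi>)"
        using L2norm_triangle_diff3[OF sq(2) square_integrable_fourier_cutoff[OF sq(1)] sq(3), of R]
        by (simp add: L2norm_diff_commute[of g])
    qed
  qed simp
  then have "L2norm (\<lambda>\<xi>. g \<xi> - h \<xi>) = 0"
    using L2norm_nonneg[of "\<lambda>\<xi>. g \<xi> - h \<xi>"] by linarith
  from L2norm_eq_0D[OF square_integrable_diff[OF sq(2,3)] this] show ?thesis by simp
qed

lemma is_fourier_transform_fourier: "square_integrable f \<Longrightarrow> is_fourier_transform f (fourier f)"
  using someI_ex[OF is_fourier_transform_exists] by (simp add: fourier_def)

lemma square_integrable_fourier: "square_integrable f \<Longrightarrow> square_integrable (fourier f)"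
  using is_fourier_transform_fourier by (auto simp: is_fourier_transform_iff)

lemma fourier_AE_eqI:
  "is_fourier_transform f g \<Longrightarrow> AE \<xi> in lborel. fourier f \<xi> = g \<xi>"
  by (rule is_fourier_transform_unique[OF is_fourier_transform_fourier])
    (auto simp: is_fourier_transform_iff)

lemma fourier_cutoff_tendsto:
  "square_integrable f \<Longrightarrow>
    ((\<lambda>R. L2norm (\<lambda>\<xi>. fourier_integral (ball_cutoff R f) \<xi> - fourier f \<xi>)) \<longlongrightarrow> 0) at_top"
  using is_fourier_transform_fourier by (auto simp: is_fourier_transform_iff)

lemma L2norm_fourier:
  assumes f: "square_integrable f" shows "L2norm (fourier f) = L2norm f"
proof -
  have "((\<lambda>R. L2norm (fourier_integral (ball_cutoff R f))) \<longlongrightarrow> L2norm (fourier f)) at_top"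
    by (intro L2norm_tendsto square_integrable_fourier square_integrable_fourier_cutoff fourier_cutoff_tendsto f)
  moreover have "((\<lambda>R. L2norm (ball_cutoff R f)) \<longlongrightarrow> L2norm f) at_top"
    by (intro L2norm_tendsto square_integrable_ball_cutoff ball_cutoff_tendsto f)
  ultimately show ?thesis
    unfolding plancherel_L1(2)[OF integrable_ball_cutoff[OF f] square_integrable_ball_cutoff[OF f]]
    by (rule tendsto_unique[rotated]) simp
qed

text \<open>The conclusion is equality of functions, not only almost everywhere: arguments equal
  almost everywhere have identical Fourier integrals, hence the same predicate
  \<open>is_fourier_transform\<close>, and \<open>SOME\<close> returns the same
  representative.\<close>

lemma fourier_cong_AE:
  assumes "f \<in> borel_measurable borel" "g \<in> borel_measurable borel" "AE x in lborel. f x = g x"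
  shows "fourier f = fourier g"
proof -
  have [measurable]: "f \<in> borel_measurable borel" "g \<in> borel_measurable borel"
    using assms by auto
  have sq: "square_integrable f \<longleftrightarrow> square_integrable g"
  proof
    show "square_integrable g" if "square_integrable f"
      by (rule square_integrable_AE_cong[OF that assms(2,3)])
    have "AE x in lborel. g x = f x" using assms(3) by eventually_elim simp
    then show "square_integrable f" if "square_integrable g"
      by (rule square_integrable_AE_cong[OF that assms(1)])
  qed
  have "fourier_integral (ball_cutoff R f) = fourier_integral (ball_cutoff R g)" for R
  proof
    fix \<xi>
    have "(LINT x|lborel. cis (- (x \<bullet> \<xi>)) * ball_cutoff R f x) = (LINT x|lborel. cis (- (x \<bullet> \<xi>)) * ball_cutoff R g x)"
      by (rule integral_cong_AE) (use assms(3) in auto)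
    then show "fourier_integral (ball_cutoff R f) \<xi> = fourier_integral (ball_cutoff R g) \<xi>"
      by (simp add: fourier_integral_def)
  qed
  then have "is_fourier_transform f = is_fourier_transform g"
    by (intro ext) (simp only: is_fourier_transform_iff sq)
  then show ?thesis by (simp add: fourier_def)
qed

lemma fourier_integrable:
  assumes f: "integrable lborel f" "square_integrable f"
  shows "AE \<xi> in lborel. fourier f \<xi> = fourier_integral f \<xi>"
proof (rule fourier_AE_eqI, unfold is_fourier_transform_iff, intro conjI f plancherel_L1)
  have "L2norm (\<lambda>\<xi>. fourier_integral (ball_cutoff R f) \<xi> - fourier_integral f \<xi>) = L2norm (\<lambda>x. ball_cutoff R f x - f x)" for R
  proof -
    have eq: "fourier_integral (\<lambda>x. ball_cutoff R f x - f x)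
        = (\<lambda>\<xi>. fourier_integral (ball_cutoff R f) \<xi> - fourier_integral f \<xi>)"
      by (rule ext) (intro fourier_integral_diff integrable_ball_cutoff f)
    have "L2norm (fourier_integral (\<lambda>x. ball_cutoff R f x - f x)) = L2norm (\<lambda>x. ball_cutoff R f x - f x)"
      by (intro plancherel_L1 Bochner_Integration.integrable_diff integrable_ball_cutoff
          square_integrable_diff square_integrable_ball_cutoff f)
    then show ?thesis by (simp only: eq)
  qed
  then show "((\<lambda>R. L2norm (\<lambda>\<xi>. fourier_integral (ball_cutoff R f) \<xi> - fourier_integral f \<xi>)) \<longlongrightarrow> 0) at_top"
    using ball_cutoff_tendsto[OF f(2)] by simp
qed

text \<open>Only equality almost everywhere can be asserted, because the representatives of the
  three transforms are chosen independently. The same holds for the other linear rules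
  below.\<close>

lemma fourier_add:
  assumes f: "square_integrable f" and g: "square_integrable g"
  shows "AE \<xi> in lborel. fourier (\<lambda>x. f x + g x) \<xi> = fourier f \<xi> + fourier g \<xi>"
proof (rule fourier_AE_eqI, unfold is_fourier_transform_iff, intro conjI)
  show "square_integrable (\<lambda>x. f x + g x)" "square_integrable (\<lambda>\<xi>. fourier f \<xi> + fourier g \<xi>)"
    by (intro square_integrable_add square_integrable_fourier f g)+
  have eq: "fourier_integral (ball_cutoff R (\<lambda>x. f x + g x)) \<xi>
      = fourier_integral (ball_cutoff R f) \<xi> + fourier_integral (ball_cutoff R g) \<xi>" for R \<xi>
  proof -
    have "ball_cutoff R (\<lambda>x. f x + g x) = (\<lambda>x. ball_cutoff R f x + ball_cutoff R g x)" by auto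
    then show ?thesis
      by (simp only: fourier_integral_add[OF integrable_ball_cutoff[OF f] integrable_ball_cutoff[OF g]])
  qed
  show "((\<lambda>R. L2norm (\<lambda>\<xi>. fourier_integral (ball_cutoff R (\<lambda>x. f x + g x)) \<xi> - (fourier f \<xi> + fourier g \<xi>))) \<longlongrightarrow> 0) at_top"
  proof (rule Lim_null_comparison[OF always_eventually, OF allI])
    show "((\<lambda>R. L2norm (\<lambda>\<xi>. fourier_integral (ball_cutoff R f) \<xi> - fourier f \<xi>)
        + L2norm (\<lambda>\<xi>. fourier_integral (ball_cutoff R g) \<xi> - fourier g \<xi>)) \<longlongrightarrow> 0) at_top"
      using tendsto_add[OF fourier_cutoff_tendsto[OF f] fourier_cutoff_tendsto[OF g]] by simp
    fix R
    show "norm (L2norm (\<lambda>\<xi>. fourier_integral (ball_cutoff R (\<lambda>x. f x + g x)) \<xi> - (fourier f \<xi> + fourier g \<xi>)))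
      \<le> L2norm (\<lambda>\<xi>. fourier_integral (ball_cutoff R f) \<xi> - fourier f \<xi>)
        + L2norm (\<lambda>\<xi>. fourier_integral (ball_cutoff R g) \<xi> - fourier g \<xi>)"
      using L2norm_triangle[OF square_integrable_diff[OF square_integrable_fourier_cutoff square_integrable_fourier]
          square_integrable_diff[OF square_integrable_fourier_cutoff square_integrable_fourier], OF f f g g, of R R]
      by (simp only: eq add_diff_add real_norm_def abs_of_nonneg L2norm_nonneg)
  qed
qed

lemma fourier_cmult:
  assumes f: "square_integrable f"
  shows "AE \<xi> in lborel. fourier (\<lambda>x. c * f x) \<xi> = c * fourier f \<xi>"
proof (rule fourier_AE_eqI, unfold is_fourier_transform_iff, intro conjI)
  show "square_integrable (\<lambda>x. c * f x)" "square_integrable (\<lambda>\<xi>. c * fourier f \<xi>)"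
    by (intro square_integrable_cmult square_integrable_fourier f)+
  have "fourier_integral (ball_cutoff R (\<lambda>x. c * f x)) \<xi> = c * fourier_integral (ball_cutoff R f) \<xi>" for R \<xi>
  proof -
    have "ball_cutoff R (\<lambda>x. c * f x) = (\<lambda>x. c * ball_cutoff R f x)" by auto
    then show ?thesis by (simp only: fourier_integral_cmult)
  qed
  then have "L2norm (\<lambda>\<xi>. fourier_integral (ball_cutoff R (\<lambda>x. c * f x)) \<xi> - c * fourier f \<xi>)
      = cmod c * L2norm (\<lambda>\<xi>. fourier_integral (ball_cutoff R f) \<xi> - fourier f \<xi>)" for R
    by (simp only: right_diff_distrib[symmetric] L2norm_cmult)
  then show "((\<lambda>R. L2norm (\<lambda>\<xi>. fourier_integral (ball_cutoff R (\<lambda>x. c * f x)) \<xi> - c * fourier f \<xi>)) \<longlongrightarrow> 0) at_top"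
    using tendsto_mult_right_zero[OF fourier_cutoff_tendsto[OF f]] by simp
qed

lemma fourier_diff:
  assumes f: "square_integrable f" and g: "square_integrable g"
  shows "AE \<xi> in lborel. fourier (\<lambda>x. f x - g x) \<xi> = fourier f \<xi> - fourier g \<xi>"
  using fourier_add[OF f square_integrable_cmult[OF g], of "- 1"] fourier_cmult[OF g, of "- 1"]
  by eventually_elim simp

lemma fourier_cnj:
  assumes f: "square_integrable f"
  shows "AE \<xi> in lborel. fourier (\<lambda>x. cnj (f x)) \<xi> = cnj (fourier f (- \<xi>))"
proof (rule fourier_AE_eqI, unfold is_fourier_transform_iff, intro conjI)
  show "square_integrable (\<lambda>x. cnj (f x))" "square_integrable (\<lambda>\<xi>. cnj (fourier f (- \<xi>)))"
    by (intro square_integrable_cnj square_integrable_reflect square_integrable_fourier f)+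
  have "fourier_integral (ball_cutoff R (\<lambda>x. cnj (f x))) \<xi> = cnj (fourier_integral (ball_cutoff R f) (- \<xi>))" for R \<xi>
  proof -
    have "ball_cutoff R (\<lambda>x. cnj (f x)) = (\<lambda>x. cnj (ball_cutoff R f x))" by auto
    then show ?thesis by (simp only: fourier_integral_cnj)
  qed
  then have "L2norm (\<lambda>\<xi>. fourier_integral (ball_cutoff R (\<lambda>x. cnj (f x))) \<xi> - cnj (fourier f (- \<xi>)))
      = L2norm (\<lambda>\<xi>. fourier_integral (ball_cutoff R f) \<xi> - fourier f \<xi>)" for R
    using L2norm_reflect[OF square_integrable_measurable[OF square_integrable_diff[OF square_integrable_fourier_cutoff[OF f] square_integrable_fourier[OF f]]], of R]
      L2norm_cnj[of "\<lambda>\<xi>. fourier_integral (ball_cutoff R f) (- \<xi>) - fourier f (- \<xi>)"]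
    by (simp only: complex_cnj_diff)
  then show "((\<lambda>R. L2norm (\<lambda>\<xi>. fourier_integral (ball_cutoff R (\<lambda>x. cnj (f x))) \<xi> - cnj (fourier f (- \<xi>)))) \<longlongrightarrow> 0) at_top"
    using fourier_cutoff_tendsto[OF f] by simp
qed

text \<open>The formula for integrable functions, applied to cutoffs of both factors at the same
  radius; both sides converge because the pairing is continuous in L2.\<close>

lemma fourier_multiplication:
  assumes f: "square_integrable f" and g: "square_integrable g"
  shows "(LINT x|lborel. fourier f x * g x) = (LINT x|lborel. f x * fourier g x)"
proof -
  have "((\<lambda>R. LINT x|lborel. fourier_integral (ball_cutoff R f) x * ball_cutoff R g x)
      \<longlongrightarrow> (LINT x|lborel. fourier f x * g x)) at_top"
    by (intro L2_pairing_tendsto square_integrable_fourier_cutoff square_integrable_fourier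
        fourier_cutoff_tendsto square_integrable_ball_cutoff ball_cutoff_tendsto f g)
  moreover have "((\<lambda>R. LINT x|lborel. ball_cutoff R f x * fourier_integral (ball_cutoff R g) x)
      \<longlongrightarrow> (LINT x|lborel. f x * fourier g x)) at_top"
    by (intro L2_pairing_tendsto square_integrable_fourier_cutoff square_integrable_fourier
        fourier_cutoff_tendsto square_integrable_ball_cutoff ball_cutoff_tendsto f g)
  ultimately show ?thesis
    unfolding fourier_integral_multiplication[OF integrable_ball_cutoff[OF f] integrable_ball_cutoff[OF g]]
    by (rule tendsto_unique[rotated]) simp
qed

lemma L2norm_diff_power2:
  assumes f: "square_integrable f" and g: "square_integrable g"
  shows "(L2norm (\<lambda>x. f x - g x))\<^sup>2
    = (L2norm f)\<^sup>2 + (L2norm g)\<^sup>2 - 2 * Re (LINT x|lborel. f x * cnj (g x))"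
proof -
  have I: "integrable lborel (\<lambda>x. f x * cnj (g x))"
    by (rule integrable_mult_square_integrable[OF f square_integrable_cnj[OF g]])
  define r where "r x = Re (f x * cnj (g x))" for x
  have r: "integrable lborel r" "integral\<^sup>L lborel r = Re (LINT x|lborel. f x * cnj (g x))"
    unfolding r_def[abs_def] using I by (rule integrable_Re, rule integral_Re)
  have "(cmod (f x - g x))\<^sup>2 = (cmod (f x))\<^sup>2 + (cmod (g x))\<^sup>2 - 2 * r x" for x
    unfolding cmod_power2 r_def by (simp add: power2_eq_square algebra_simps)
  then have "(L2norm (\<lambda>x. f x - g x))\<^sup>2
      = (LINT x|lborel. (cmod (f x))\<^sup>2 + (cmod (g x))\<^sup>2 - 2 * r x)"
    by (simp only: L2norm_power2)
  also have "\<dots> = (L2norm f)\<^sup>2 + (L2norm g)\<^sup>2 - 2 * integral\<^sup>L lborel r"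
    using f g r(1) by (simp add: L2norm_power2 square_integrable_def)
  finally show ?thesis by (simp only: r(2))
qed

lemma square_integrable_inverse_fourier:
  "square_integrable g \<Longrightarrow> square_integrable (inverse_fourier g)"
  unfolding inverse_fourier_def[abs_def] by (intro square_integrable_reflect square_integrable_fourier)

text \<open>Expanding the square, the cross term is turned into \<open>\<parallel>fourier g\<parallel>\<^sup>2\<close> by the multiplication
  formula, so that everything cancels by Plancherel's identity.\<close>

lemma fourier_inverse_fourier:
  assumes g: "square_integrable g"
  shows "AE x in lborel. fourier (inverse_fourier g) x = g x"
proof -
  define k where "k = inverse_fourier g"
  have k: "square_integrable k"
    unfolding k_def by (rule square_integrable_inverse_fourier[OF g])
  have Fg [measurable]: "fourier g \<in> borel_measurable borel"
    using square_integrable_measurable[OF square_integrable_fourier[OF g]] .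
  have nk: "L2norm k = L2norm g"
    unfolding k_def inverse_fourier_def[abs_def] using L2norm_reflect[OF Fg] L2norm_fourier[OF g] by (simp only:)
  have [measurable]: "g \<in> borel_measurable borel" "k \<in> borel_measurable borel" "fourier (\<lambda>x. cnj (g x)) \<in> borel_measurable borel"
    using square_integrable_measurable[OF g] square_integrable_measurable[OF k]
      square_integrable_measurable[OF square_integrable_fourier[OF square_integrable_cnj[OF g]]] by auto
  have "(LINT x|lborel. fourier k x * cnj (g x)) = (LINT x|lborel. k x * fourier (\<lambda>x. cnj (g x)) x)"
    by (rule fourier_multiplication[OF k square_integrable_cnj[OF g]])
  also have "\<dots> = (LINT x|lborel. fourier g (- x) * cnj (fourier g (- x)))"
  proof (rule integral_cong_AE)
    show "AE x in lborel. k x * fourier (\<lambda>x. cnj (g x)) x = fourier g (- x) * cnj (fourier g (- x))"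
      using fourier_cnj[OF g] by eventually_elim (simp only: k_def inverse_fourier_def)
  qed measurable
  also have "\<dots> = (LINT x|lborel. fourier g x * cnj (fourier g x))"
    by (rule lborel_integral_reflect(1)[of "\<lambda>x. fourier g x * cnj (fourier g x)"]) measurable
  also have "\<dots> = of_real ((L2norm (fourier g))\<^sup>2)"
    unfolding complex_norm_square[symmetric] L2norm_power2 by (rule integral_complex_of_real)
  also have "L2norm (fourier g) = L2norm g"
    by (rule L2norm_fourier[OF g])
  finally have "Re (LINT x|lborel. fourier k x * cnj (g x)) = (L2norm g)\<^sup>2"
    by (simp only: Re_complex_of_real)
  then have "(L2norm (\<lambda>x. fourier k x - g x))\<^sup>2 = 0"
    by (simp only: L2norm_diff_power2[OF square_integrable_fourier[OF k] g] L2norm_fourier[OF k] nk)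
  then have "L2norm (\<lambda>x. fourier k x - g x) = 0" by simp
  from L2norm_eq_0D[OF square_integrable_diff[OF square_integrable_fourier[OF k] g] this]
  show ?thesis by (simp add: k_def)
qed

lemma fourier_injective:
  fixes f g :: "'a::euclidean_space \<Rightarrow> complex"
  assumes f: "square_integrable f" and g: "square_integrable g"
    and eq: "AE x in lborel. fourier f x = fourier g x"
  shows "AE x in lborel. f x = g x"
proof -
  have "L2norm (\<lambda>x. f x - g x) = L2norm (fourier (\<lambda>x. f x - g x))"
    by (simp add: L2norm_fourier square_integrable_diff f g)
  also have "\<dots> = L2norm (\<lambda>x::'a. 0)"
  proof (rule L2norm_AE_cong)
    show "AE x in lborel. fourier (\<lambda>x. f x - g x) x = 0"
      using fourier_diff[OF f g] eq by eventually_elim simp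
  qed (use square_integrable_measurable[OF square_integrable_fourier[OF square_integrable_diff[OF f g]]] in auto)
  finally have "L2norm (\<lambda>x. f x - g x) = 0" by simp
  from L2norm_eq_0D[OF square_integrable_diff[OF f g] this] show ?thesis by simp
qed

text \<open>Inversion in the other order follows from \<open>fourier_inverse_fourier\<close> at
  \<open>fourier f\<close>: both sides have the same transform, and the transform is
  injective.\<close>

lemma inverse_fourier_fourier:
  assumes f: "square_integrable f"
  shows "AE x in lborel. inverse_fourier (fourier f) x = f x"
  by (rule fourier_injective[OF _ f fourier_inverse_fourier])
    (intro square_integrable_inverse_fourier square_integrable_fourier f)+


subsection \<open>Sobolev weights and convolutions\<close>

text \<open>The exponent \<open>s / 2\<close> makes this the square root of the weight in
  \<open>sobolev_norm\<close>, so that the Sobolev norm is the L2 norm of the weighted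
  transform.\<close>

definition sobolev_weight :: "real \<Rightarrow> 'a::euclidean_space \<Rightarrow> real" where
  "sobolev_weight s \<xi> = (1 + (norm \<xi>)\<^sup>2) powr (s / 2)"

lemma borel_measurable_sobolev_weight [measurable]: "sobolev_weight s \<in> borel_measurable borel"
  unfolding sobolev_weight_def[abs_def] by measurable

lemma sobolev_weight_pos: "0 < sobolev_weight s \<xi>"
proof -
  have "1 + (norm \<xi>)\<^sup>2 \<noteq> 0" using zero_le_power2[of "norm \<xi>"] by linarith
  then show ?thesis by (simp add: sobolev_weight_def)
qed

lemma sobolev_weight_ge_1: "0 \<le> s \<Longrightarrow> 1 \<le> sobolev_weight s \<xi>"
  by (simp add: sobolev_weight_def ge_one_powr_ge_zero)

lemma sobolev_weight_power2: "(sobolev_weight s \<xi>)\<^sup>2 = (1 + (norm \<xi>)\<^sup>2) powr s"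
  unfolding sobolev_weight_def power2_eq_square[of "_ powr _"] powr_add[symmetric] by simp

text \<open>Since \<xi> is the sum of \<open>\<xi> - \<eta>\<close> and \<eta>, one of them has at
  least half its norm. Doubling the argument costs at most a factor 4 in
  \<open>1 + |\<xi>|\<^sup>2\<close>, whose power \<open>s / 2\<close> is
  \<open>2 powr s\<close>.\<close>

lemma sobolev_weight_subadditive:
  fixes \<xi> \<eta> :: "'a::euclidean_space"
  assumes "0 \<le> s"
  shows "sobolev_weight s \<xi> \<le> 2 powr s * (sobolev_weight s (\<xi> - \<eta>) + sobolev_weight s \<eta>)"
proof -
  have *: "sobolev_weight s \<xi> \<le> 2 powr s * sobolev_weight s \<zeta>" if "norm \<xi> \<le> 2 * norm \<zeta>" for \<zeta> :: 'a
  proof -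
    have "(norm \<xi>)\<^sup>2 \<le> (2 * norm \<zeta>)\<^sup>2" using that by (intro power_mono) auto
    then have "1 + (norm \<xi>)\<^sup>2 \<le> 4 * (1 + (norm \<zeta>)\<^sup>2)" by (simp add: power_mult_distrib)
    then have "(1 + (norm \<xi>)\<^sup>2) powr (s / 2) \<le> (4 * (1 + (norm \<zeta>)\<^sup>2)) powr (s / 2)"
      using assms by (intro powr_mono2) auto
    also have "\<dots> = 4 powr (s / 2) * (1 + (norm \<zeta>)\<^sup>2) powr (s / 2)"
      by (rule powr_mult)
    also have "(4::real) powr (s / 2) = 2 powr s"
    proof -
      have "(4::real) = 2 powr 2" by simp
      then show ?thesis by (simp only: powr_powr) simp
    qed
    finally show ?thesis by (simp add: sobolev_weight_def)
  qed
  have "norm \<xi> \<le> norm (\<xi> - \<eta>) + norm \<eta>"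
    using norm_triangle_ineq[of "\<xi> - \<eta>" \<eta>] by simp
  then consider "norm \<xi> \<le> 2 * norm (\<xi> - \<eta>)" | "norm \<xi> \<le> 2 * norm \<eta>" by linarith
  then show ?thesis
  proof cases
    case 1
    from *[OF 1] show ?thesis
      using sobolev_weight_pos[of s \<eta>] by (simp add: distrib_left add_increasing2 less_imp_le)
  next
    case 2
    from *[OF 2] show ?thesis
      using sobolev_weight_pos[of s "\<xi> - \<eta>"] by (simp add: distrib_left add_increasing less_imp_le)
  qed
qed

text \<open>Dyadic decomposition: beyond radius \<open>2 ^ (k - 1)\<close> the integrand is at most
  a constant times \<open>4 powr (- s * k)\<close>, while the ball of radius \<open>2 ^ k\<close>
  has volume proportional to \<open>2 ^ (n k)\<close>. The factor \<open>4 powr s\<close> in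
  \<open>?c\<close> pays for using the inner radius of the shell.\<close>

lemma nn_integral_inverse_sobolev_weight_finite:
  assumes s: "real DIM('a::euclidean_space) / 2 < s"
  shows "(\<integral>\<^sup>+ \<xi>. ennreal ((1 + (norm (\<xi>::'a))\<^sup>2) powr (- s)) \<partial>lborel) < \<infinity>"
proof -
  let ?n = "DIM('a)"
  let ?c = "\<lambda>k::nat. 4 powr s * (4 powr (- s)) ^ k"
  let ?q = "4 powr (- s) * 2 ^ ?n :: real"
  have s0: "0 < s" using s by (rule order.strict_trans1[rotated]) simp
  have pt: "ennreal ((1 + (norm \<xi>)\<^sup>2) powr (- s)) \<le> (\<Sum>k. ennreal (?c k) * indicator (cball 0 (2 ^ k)) \<xi>)" for \<xi> :: 'a
  proof -
    have "\<exists>k. norm \<xi> \<le> 2 ^ k" 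
      using real_arch_pow[of 2 "norm \<xi>"] less_imp_le by fastforce
    then obtain k where k: "norm \<xi> \<le> 2 ^ k" "\<And>j. j < k \<Longrightarrow> \<not> norm \<xi> \<le> 2 ^ j"
      using exists_least_iff[of "\<lambda>k. norm \<xi> \<le> 2 ^ k"] by blast
    have "(1 + (norm \<xi>)\<^sup>2) powr (- s) \<le> ?c k"
    proof (cases k)
      case 0
      have "(1 + (norm \<xi>)\<^sup>2) powr (- s) \<le> 1 powr (- s)"
        using s0 by (intro powr_mono2') auto
      also have "1 powr (- s) \<le> ?c k"
        using s0 by (simp add: 0 ge_one_powr_ge_zero)
      finally show ?thesis .
    next
      case (Suc j)
      then have "2 ^ j < norm \<xi>" using k(2)[of j] by simp
      then have "(2 ^ j)\<^sup>2 \<le> (norm \<xi>)\<^sup>2" by (intro power_mono) auto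
      then have "4 ^ j \<le> 1 + (norm \<xi>)\<^sup>2"
        by (simp add: power2_eq_square power_mult_distrib[symmetric])
      then have "(1 + (norm \<xi>)\<^sup>2) powr (- s) \<le> (4 ^ j) powr (- s)"
        using s0 by (intro powr_mono2') auto
      also have "((4::real) ^ j) powr (- s) = (4 powr (- s)) ^ j"
      proof -
        have "((4::real) ^ j) powr (- s) = (4 powr real j) powr (- s)"
          by (simp only: powr_realpow[of "4::real"] zero_less_numeral)
        also have "\<dots> = 4 powr (- s * real j)"
          by (simp only: powr_powr mult.commute)
        also have "\<dots> = (4 powr (- s)) ^ j"
          by (subst powr_powr[symmetric]) (rule powr_realpow, simp)
        finally show ?thesis .
      qed
      also have "\<dots> = ?c k"
      proof -
        have "(4::real) powr s * 4 powr (- s) = 1" by (simp add: powr_minus)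
        then show ?thesis by (simp only: Suc power_Suc mult.assoc[symmetric] mult_1)
      qed
      finally show ?thesis .
    qed
    then have "ennreal ((1 + (norm \<xi>)\<^sup>2) powr (- s)) \<le> (\<Sum>i\<in>{k}. ennreal (?c i) * indicator (cball 0 (2 ^ i)) \<xi>)"
      using k(1) by (simp add: ennreal_leI)
    also have "\<dots> \<le> (\<Sum>i. ennreal (?c i) * indicator (cball 0 (2 ^ i)) \<xi>)"
      by (rule sum_le_suminf) (auto intro: summableI)
    finally show ?thesis .
  qed
  \<comment> \<open>The ratio of the geometric series is \<open>2 powr (n - 2 s)\<close>; this is
    where s exceeding half the dimension is decisive.\<close>
  have "?q < 1"
  proof -
    have "?q = 2 powr (real ?n - 2 * s)"
    proof -
      have "(4::real) = 2 powr 2" by simp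
      then have "(4::real) powr (- s) = 2 powr (- 2 * s)" by (simp only: powr_powr) simp
      moreover have "(2::real) ^ ?n = 2 powr real ?n"
        by (simp only: powr_realpow[of "2::real"] zero_less_numeral)
      ultimately have "?q = 2 powr (- 2 * s + real ?n)"
        by (simp only: powr_add)
      then show ?thesis by (simp only: mult_minus_left add.commute[of "- _"] diff_conv_add_uminus)
    qed
    also have "\<dots> < 2 powr 0" using s by (intro powr_less_mono) auto
    finally show ?thesis by simp
  qed
  then have sm: "summable (\<lambda>k. ?q ^ k)"
    by (intro summable_geometric) simp
  have "(\<integral>\<^sup>+ \<xi>. ennreal ((1 + (norm (\<xi>::'a))\<^sup>2) powr (- s)) \<partial>lborel)
      \<le> (\<integral>\<^sup>+ \<xi>. (\<Sum>k. ennreal (?c k) * indicator (cball (0::'a) (2 ^ k)) \<xi>) \<partial>lborel)"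
    by (intro nn_integral_mono pt)
  also have "\<dots> = (\<Sum>k. \<integral>\<^sup>+ \<xi>. ennreal (?c k) * indicator (cball (0::'a) (2 ^ k)) \<xi> \<partial>lborel)"
  proof (rule nn_integral_suminf)
    fix k
    have "(\<lambda>\<xi>. indicator (cball (0::'a) (2 ^ k)) \<xi> :: ennreal) \<in> borel_measurable lborel"
      by (rule borel_measurable_indicator) simp
    then show "(\<lambda>\<xi>. ennreal (?c k) * indicator (cball (0::'a) (2 ^ k)) \<xi>) \<in> borel_measurable lborel"
      by (rule borel_measurable_times_ennreal[OF borel_measurable_const])
  qed
  also have "\<dots> = (\<Sum>k. ennreal (4 powr s * unit_ball_vol (real ?n) * ?q ^ k))"
  proof (rule suminf_cong)
    fix k
    have "(\<integral>\<^sup>+ \<xi>. ennreal (?c k) * indicator (cball (0::'a) (2 ^ k)) \<xi> \<partial>lborel)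
        = ennreal (?c k) * emeasure lborel (cball (0::'a) (2 ^ k))"
      by (rule nn_integral_cmult_indicator) auto
    also have "\<dots> = ennreal (?c k) * ennreal (unit_ball_vol (real ?n) * (2 ^ k) ^ ?n)"
      by (simp add: emeasure_cball)
    also have "\<dots> = ennreal (?c k * (unit_ball_vol (real ?n) * (2 ^ k) ^ ?n))"
      by (rule ennreal_mult[symmetric]) auto
    also have "?c k * (unit_ball_vol (real ?n) * (2 ^ k) ^ ?n) = 4 powr s * unit_ball_vol (real ?n) * ?q ^ k"
    proof -
      have "((2::real) ^ k) ^ ?n = (2 ^ ?n) ^ k"
        by (simp only: power_mult[symmetric] mult.commute[of k])
      then show ?thesis by (simp only: power_mult_distrib mult_ac)
    qed
    finally show "(\<integral>\<^sup>+ \<xi>. ennreal (?c k) * indicator (cball (0::'a) (2 ^ k)) \<xi> \<partial>lborel)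
        = ennreal (4 powr s * unit_ball_vol (real ?n) * ?q ^ k)" .
  qed
  also have "\<dots> = ennreal (\<Sum>k. 4 powr s * unit_ball_vol (real ?n) * ?q ^ k)"
    by (rule suminf_ennreal2) (use sm in \<open>auto intro!: summable_mult\<close>)
  also have "\<dots> < \<infinity>" by (simp only: ennreal_less_top infinity_ennreal_def)
  finally show ?thesis .
qed

text \<open>Young's inequality for an L2 factor and an L1 factor: Cauchy-Schwarz with respect to the
  measure of density \<open>B\<close>, followed by Fubini and translation invariance.\<close>

lemma nn_integral_young:
  fixes A B :: "'a::euclidean_space \<Rightarrow> ennreal"
  assumes [measurable]: "A \<in> borel_measurable borel" "B \<in> borel_measurable borel"
  shows "(\<integral>\<^sup>+ \<xi>. (\<integral>\<^sup>+ \<eta>. A (\<xi> - \<eta>) * B \<eta> \<partial>lborel)\<^sup>2 \<partial>lborel)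
    \<le> (\<integral>\<^sup>+ \<xi>. (A \<xi>)\<^sup>2 \<partial>lborel) * (\<integral>\<^sup>+ \<eta>. B \<eta> \<partial>lborel)\<^sup>2"
proof -
  let ?b = "\<integral>\<^sup>+ \<eta>. B \<eta> \<partial>lborel"
  have CS: "(\<integral>\<^sup>+ \<eta>. A (\<xi> - \<eta>) * B \<eta> \<partial>lborel)\<^sup>2 \<le> (\<integral>\<^sup>+ \<eta>. (A (\<xi> - \<eta>))\<^sup>2 * B \<eta> \<partial>lborel) * ?b" for \<xi>
  proof -
    have "(\<integral>\<^sup>+ \<eta>. A (\<xi> - \<eta>) * 1 \<partial>density lborel B)\<^sup>2
        \<le> (\<integral>\<^sup>+ \<eta>. (A (\<xi> - \<eta>))\<^sup>2 \<partial>density lborel B) * (\<integral>\<^sup>+ \<eta>. 1\<^sup>2 \<partial>density lborel B)"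
      by (rule Cauchy_Schwarz_nn_integral) auto
    also have "(\<integral>\<^sup>+ \<eta>. A (\<xi> - \<eta>) * 1 \<partial>density lborel B) = (\<integral>\<^sup>+ \<eta>. B \<eta> * (A (\<xi> - \<eta>) * 1) \<partial>lborel)"
      by (rule nn_integral_density) auto
    also have "(\<integral>\<^sup>+ \<eta>. (A (\<xi> - \<eta>))\<^sup>2 \<partial>density lborel B) = (\<integral>\<^sup>+ \<eta>. B \<eta> * (A (\<xi> - \<eta>))\<^sup>2 \<partial>lborel)"
      by (rule nn_integral_density) auto
    also have "(\<integral>\<^sup>+ \<eta>. 1\<^sup>2 \<partial>density lborel B) = (\<integral>\<^sup>+ \<eta>. B \<eta> * 1\<^sup>2 \<partial>lborel)"
      by (rule nn_integral_density) auto
    finally show ?thesis by (simp add: mult.commute)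
  qed
  have "(\<integral>\<^sup>+ \<xi>. (\<integral>\<^sup>+ \<eta>. A (\<xi> - \<eta>) * B \<eta> \<partial>lborel)\<^sup>2 \<partial>lborel)
      \<le> (\<integral>\<^sup>+ \<xi>. (\<integral>\<^sup>+ \<eta>. (A (\<xi> - \<eta>))\<^sup>2 * B \<eta> \<partial>lborel) * ?b \<partial>lborel)"
    by (intro nn_integral_mono CS)
  also have "\<dots> = (\<integral>\<^sup>+ \<xi>. (\<integral>\<^sup>+ \<eta>. (A (\<xi> - \<eta>))\<^sup>2 * B \<eta> \<partial>lborel) \<partial>lborel) * ?b"
    by (rule nn_integral_multc) measurable
  also have "(\<integral>\<^sup>+ \<xi>. (\<integral>\<^sup>+ \<eta>. (A (\<xi> - \<eta>))\<^sup>2 * B \<eta> \<partial>lborel) \<partial>lborel)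
      = (\<integral>\<^sup>+ \<eta>. (\<integral>\<^sup>+ \<xi>. (A (\<xi> - \<eta>))\<^sup>2 * B \<eta> \<partial>lborel) \<partial>lborel)"
    by (rule lborel_pair.Fubini') measurable
  also have "\<dots> = (\<integral>\<^sup>+ \<eta>. (\<integral>\<^sup>+ \<xi>. (A \<xi>)\<^sup>2 \<partial>lborel) * B \<eta> \<partial>lborel)"
  proof (rule nn_integral_cong)
    fix \<eta>
    have "(\<integral>\<^sup>+ \<xi>. (A (\<xi> - \<eta>))\<^sup>2 * B \<eta> \<partial>lborel) = (\<integral>\<^sup>+ \<xi>. (A (\<xi> - \<eta>))\<^sup>2 \<partial>lborel) * B \<eta>"
      by (rule nn_integral_multc) measurable
    also have "(\<integral>\<^sup>+ \<xi>. (A (\<xi> - \<eta>))\<^sup>2 \<partial>lborel) = (\<integral>\<^sup>+ \<xi>. (A \<xi>)\<^sup>2 \<partial>lborel)"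
      using nn_integral_lborel_translate[of "\<lambda>\<xi>. (A \<xi>)\<^sup>2" "- \<eta>"] by simp
    finally show "(\<integral>\<^sup>+ \<xi>. (A (\<xi> - \<eta>))\<^sup>2 * B \<eta> \<partial>lborel) = (\<integral>\<^sup>+ \<xi>. (A \<xi>)\<^sup>2 \<partial>lborel) * B \<eta>" .
  qed
  also have "\<dots> = (\<integral>\<^sup>+ \<xi>. (A \<xi>)\<^sup>2 \<partial>lborel) * ?b"
    by (rule nn_integral_cmult) measurable
  finally show ?thesis
    by (simp only: power2_eq_square mult.assoc)
qed

section \<open>Convolutions and their transforms\<close>

definition convolution :: "('a::euclidean_space \<Rightarrow> complex) \<Rightarrow> ('a \<Rightarrow> complex) \<Rightarrow> 'a \<Rightarrow> complex" where
  "convolution f g x = (LINT y|lborel. f (x - y) * g y)"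

lemma borel_measurable_convolution [measurable]:
  assumes [measurable]: "f \<in> borel_measurable borel" "g \<in> borel_measurable borel"
  shows "convolution f g \<in> borel_measurable borel"
  unfolding convolution_def[abs_def] by measurable

text \<open>With y as the outer variable, translation invariance reduces the inner integral of
  absolute values to the L1 norm of \<open>f\<close> times \<open>|g y|\<close>.\<close>

lemma integrable_convolution_pair:
  fixes f g :: "'a::euclidean_space \<Rightarrow> complex"
  assumes f: "integrable lborel f" and g: "integrable lborel g"
  shows "integrable (lborel \<Otimes>\<^sub>M lborel) (\<lambda>(y, x). cis (- (x \<bullet> \<xi>)) * (f (x - y) * g y))"
proof (rule lborel_pair.Fubini_integrable)
  have [measurable]: "f \<in> borel_measurable borel" "g \<in> borel_measurable borel"
    using borel_measurable_integrable[OF f] borel_measurable_integrable[OF g] by auto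
  have tr: "integrable lborel (\<lambda>x. f (x - y))" "(LINT x|lborel. cmod (f (x - y))) = (LINT x|lborel. cmod (f x))" for y
    using lborel_integral_translate(2)[of f "- y"] lborel_integral_translate(1)[of "\<lambda>x. cmod (f x)" "- y"] f by simp_all
  show "(\<lambda>(y, x). cis (- (x \<bullet> \<xi>)) * (f (x - y) * g y)) \<in> borel_measurable (lborel \<Otimes>\<^sub>M lborel)"
    by measurable
  have "integrable lborel (\<lambda>y. (LINT x|lborel. cmod (f x)) * cmod (g y))"
    using g by simp
  then show "integrable lborel (\<lambda>y. LINT x|lborel. norm (case (y, x) of (y, x) \<Rightarrow> cis (- (x \<bullet> \<xi>)) * (f (x - y) * g y)))"
    by (simp add: norm_mult tr)
  show "AE y in lborel. integrable lborel (\<lambda>x. case (y, x) of (y, x) \<Rightarrow> cis (- (x \<bullet> \<xi>)) * (f (x - y) * g y))"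
  proof (rule AE_I2)
    fix y
    have "integrable lborel (\<lambda>x. cis (- (x \<bullet> \<xi>)) * f (x - y) * g y)"
      by (intro integrable_mult_left integrable_cis_mult tr)
    then show "integrable lborel (\<lambda>x. case (y, x) of (y, x) \<Rightarrow> cis (- (x \<bullet> \<xi>)) * (f (x - y) * g y))"
      by (simp add: mult.assoc)
  qed
qed

text \<open>Fubini and a translation by y separate the variables. The unitary normalisation puts a
  constant into each of the two transforms on the right but only one into the transform on the left,
  which explains the extra factor.\<close>

lemma fourier_integral_convolution:
  fixes f g :: "'a::euclidean_space \<Rightarrow> complex"
  assumes f: "integrable lborel f" and g: "integrable lborel g"
  shows "of_real (fourier_const TYPE('a)) * fourier_integral (convolution f g) \<xi>
    = fourier_integral f \<xi> * fourier_integral g \<xi>"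
proof -
  let ?C = "complex_of_real (fourier_const TYPE('a))"
  have [measurable]: "f \<in> borel_measurable borel" "g \<in> borel_measurable borel"
    using borel_measurable_integrable[OF f] borel_measurable_integrable[OF g] by auto
  have tr: "(LINT x|lborel. cis (- (x \<bullet> \<xi>)) * (f (x - y) * g y))
      = (LINT x|lborel. cis (- (x \<bullet> \<xi>)) * f x) * (cis (- (y \<bullet> \<xi>)) * g y)" for y
  proof -
    have "(LINT x|lborel. cis (- (x \<bullet> \<xi>)) * (f (x - y) * g y))
        = (LINT x|lborel. cis (- ((y + x) \<bullet> \<xi>)) * (f ((y + x) - y) * g y))"
      by (rule lborel_integral_translate(1)[symmetric]) measurable
    also have "\<dots> = (LINT x|lborel. (cis (- (x \<bullet> \<xi>)) * f x) * (cis (- (y \<bullet> \<xi>)) * g y))"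
    proof (rule Bochner_Integration.integral_cong)
      fix x
      have "cis (- ((y + x) \<bullet> \<xi>)) = cis (- (x \<bullet> \<xi>)) * cis (- (y \<bullet> \<xi>))"
      proof -
        have "- ((y + x) \<bullet> \<xi>) = - (x \<bullet> \<xi>) + - (y \<bullet> \<xi>)" by (simp add: inner_add_left)
        then show ?thesis by (simp only: cis_mult)
      qed
      then show "cis (- ((y + x) \<bullet> \<xi>)) * (f ((y + x) - y) * g y) = (cis (- (x \<bullet> \<xi>)) * f x) * (cis (- (y \<bullet> \<xi>)) * g y)"
        by (simp only: add_diff_cancel_left') (simp only: mult_ac)
    qed simp
    also have "\<dots> = (LINT x|lborel. cis (- (x \<bullet> \<xi>)) * f x) * (cis (- (y \<bullet> \<xi>)) * g y)"
      by (rule integral_mult_left_zero)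
    finally show ?thesis .
  qed
  have cv: "(LINT y|lborel. cis (- (x \<bullet> \<xi>)) * (f (x - y) * g y)) = cis (- (x \<bullet> \<xi>)) * convolution f g x" for x
    unfolding convolution_def by (rule integral_mult_right_zero)
  have "(LINT x|lborel. LINT y|lborel. cis (- (x \<bullet> \<xi>)) * (f (x - y) * g y))
      = (LINT y|lborel. LINT x|lborel. cis (- (x \<bullet> \<xi>)) * (f (x - y) * g y))"
    by (rule lborel_pair.Fubini_integral[OF integrable_convolution_pair[OF f g]])
  then have "(LINT x|lborel. cis (- (x \<bullet> \<xi>)) * convolution f g x)
      = (LINT x|lborel. cis (- (x \<bullet> \<xi>)) * f x) * (LINT y|lborel. cis (- (y \<bullet> \<xi>)) * g y)"
    unfolding tr cv by (simp only: integral_mult_right_zero)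
  then show ?thesis
    by (simp only: fourier_integral_def mult_ac)
qed

text \<open>Where the integrand is not integrable the Bochner integral takes the default value 0, so
  the estimate is trivial there.\<close>

lemma norm_convolution_le:
  fixes f g :: "'a::euclidean_space \<Rightarrow> complex"
  shows "ennreal (cmod (convolution f g x)) \<le> (\<integral>\<^sup>+ y. ennreal (cmod (f (x - y))) * ennreal (cmod (g y)) \<partial>lborel)"
proof (cases "integrable lborel (\<lambda>y. f (x - y) * g y)")
  case True
  from integral_norm_bound_ennreal[OF this] show ?thesis
    by (simp only: convolution_def norm_mult ennreal_mult norm_ge_zero)
next
  case False
  then show ?thesis by (simp add: convolution_def not_integrable_integral_eq)
qed


subsection \<open>Sobolev spaces as algebras\<close>

abbreviation weighted :: "real \<Rightarrow> ('a::euclidean_space \<Rightarrow> complex) \<Rightarrow> 'a \<Rightarrow> complex" where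
  "weighted s F \<equiv> (\<lambda>\<xi>. complex_of_real (sobolev_weight s \<xi>) * F \<xi>)"

lemma cmod_weighted_power2: "(cmod (weighted s F \<xi>))\<^sup>2 = (1 + (norm \<xi>)\<^sup>2) powr s * (cmod (F \<xi>))\<^sup>2"
  by (simp only: norm_mult norm_of_real power_mult_distrib power2_abs sobolev_weight_power2)

lemma mem_sobolev_iff:
  "f \<in> sobolev s \<longleftrightarrow> square_integrable f \<and> square_integrable (weighted s (fourier f))"
proof -
  have "weighted s (fourier f) \<in> borel_measurable lborel" if "square_integrable f"
  proof -
    have [measurable]: "fourier f \<in> borel_measurable borel"
      using square_integrable_measurable[OF square_integrable_fourier[OF that]] .
    show ?thesis by measurable
  qed
  then show ?thesis
    unfolding sobolev_def square_integrable_def[of "weighted s (fourier f)"] cmod_weighted_power2 by auto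
qed

lemma sobolev_norm_eq: "sobolev_norm s f = L2norm (weighted s (fourier f))"
  unfolding sobolev_norm_def L2norm_def cmod_weighted_power2 ..

lemma sobolev_norm_nonneg [simp]: "0 \<le> sobolev_norm s f"
  by (simp add: sobolev_norm_eq)

lemma sobolev_square_integrable:
  assumes "f \<in> sobolev s"
  shows "square_integrable f" "square_integrable (fourier f)" "square_integrable (weighted s (fourier f))"
  using assms square_integrable_fourier by (auto simp: mem_sobolev_iff)

lemma sobolev_norm_AE_eq:
  assumes "square_integrable f" "F \<in> borel_measurable borel" "AE \<xi> in lborel. fourier f \<xi> = F \<xi>"
  shows "sobolev_norm s f = L2norm (weighted s F)"
proof -
  have [measurable]: "fourier f \<in> borel_measurable borel" "F \<in> borel_measurable borel"
    using assms square_integrable_measurable[OF square_integrable_fourier] by auto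
  show ?thesis
    unfolding sobolev_norm_eq by (rule L2norm_AE_cong) (use assms(3) in auto)
qed

lemma sobolevI:
  assumes "square_integrable f" "AE \<xi> in lborel. fourier f \<xi> = F \<xi>" "square_integrable (weighted s F)"
  shows "f \<in> sobolev s"
proof -
  have [measurable]: "fourier f \<in> borel_measurable borel"
    using assms square_integrable_measurable[OF square_integrable_fourier] by auto
  have "square_integrable (weighted s (fourier f))"
  proof (rule square_integrable_AE_cong[OF assms(3)])
    show "AE \<xi> in lborel. weighted s F \<xi> = weighted s (fourier f) \<xi>"
      using assms(2) by eventually_elim simp
  qed measurable
  with assms(1) show ?thesis by (simp add: mem_sobolev_iff)
qed

lemma sobolev_cong_AE:
  assumes "f \<in> sobolev s" "g \<in> borel_measurable borel" "AE x in lborel. f x = g x"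
  shows "g \<in> sobolev s" "sobolev_norm s g = sobolev_norm s f"
proof -
  have f: "square_integrable f" using assms(1) by (rule sobolev_square_integrable)
  have eq: "fourier f = fourier g"
    by (rule fourier_cong_AE[OF square_integrable_measurable[OF f] assms(2,3)])
  have "square_integrable g"
    by (rule square_integrable_AE_cong[OF f assms(2,3)])
  with assms(1) show "g \<in> sobolev s" "sobolev_norm s g = sobolev_norm s f"
    by (simp_all only: mem_sobolev_iff sobolev_norm_eq eq)
qed

lemma sobolev_add:
  assumes f: "f \<in> sobolev s" and g: "g \<in> sobolev s"
  shows "(\<lambda>x. f x + g x) \<in> sobolev s"
proof (rule sobolevI)
  show "square_integrable (\<lambda>x. f x + g x)"
    by (intro square_integrable_add sobolev_square_integrable(1)[OF f] sobolev_square_integrable(1)[OF g])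
  show "AE \<xi> in lborel. fourier (\<lambda>x. f x + g x) \<xi> = fourier f \<xi> + fourier g \<xi>"
    by (intro fourier_add sobolev_square_integrable(1)[OF f] sobolev_square_integrable(1)[OF g])
  show "square_integrable (weighted s (\<lambda>\<xi>. fourier f \<xi> + fourier g \<xi>))"
    unfolding distrib_left by (intro square_integrable_add sobolev_square_integrable(3)[OF f] sobolev_square_integrable(3)[OF g])
qed

lemma sobolev_norm_add_le:
  assumes f: "f \<in> sobolev s" and g: "g \<in> sobolev s"
  shows "sobolev_norm s (\<lambda>x. f x + g x) \<le> sobolev_norm s f + sobolev_norm s g"
proof -
  note F = sobolev_square_integrable[OF f] and G = sobolev_square_integrable[OF g]
  have "sobolev_norm s (\<lambda>x. f x + g x) = L2norm (weighted s (\<lambda>\<xi>. fourier f \<xi> + fourier g \<xi>))"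
    by (intro sobolev_norm_AE_eq fourier_add square_integrable_add F G square_integrable_measurable)
  also have "\<dots> \<le> L2norm (weighted s (fourier f)) + L2norm (weighted s (fourier g))"
    unfolding distrib_left by (intro L2norm_triangle F G)
  finally show ?thesis by (simp add: sobolev_norm_eq)
qed

lemma sobolev_cmult:
  assumes f: "f \<in> sobolev s"
  shows "(\<lambda>x. c * f x) \<in> sobolev s" "sobolev_norm s (\<lambda>x. c * f x) = cmod c * sobolev_norm s f"
proof -
  note F = sobolev_square_integrable[OF f]
  have eq: "weighted s (\<lambda>\<xi>. c * fourier f \<xi>) = (\<lambda>\<xi>. c * weighted s (fourier f) \<xi>)"
    by (simp only: mult.left_commute)
  show "(\<lambda>x. c * f x) \<in> sobolev s"
  proof (rule sobolevI)
    show "AE \<xi> in lborel. fourier (\<lambda>x. c * f x) \<xi> = c * fourier f \<xi>" by (rule fourier_cmult[OF F(1)])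
    show "square_integrable (weighted s (\<lambda>\<xi>. c * fourier f \<xi>))"
      unfolding eq by (rule square_integrable_cmult[OF F(3)])
  qed (rule square_integrable_cmult[OF F(1)])
  have "sobolev_norm s (\<lambda>x. c * f x) = L2norm (weighted s (\<lambda>\<xi>. c * fourier f \<xi>))"
    by (intro sobolev_norm_AE_eq fourier_cmult square_integrable_cmult F square_integrable_measurable)
  then show "sobolev_norm s (\<lambda>x. c * f x) = cmod c * sobolev_norm s f"
    unfolding eq by (simp only: L2norm_cmult sobolev_norm_eq)
qed

lemma sobolev_minus:
  assumes "f \<in> sobolev s"
  shows "(\<lambda>x. - f x) \<in> sobolev s" "sobolev_norm s (\<lambda>x. - f x) = sobolev_norm s f"
  using sobolev_cmult[OF assms, of "- 1"] by simp_all

lemma sobolev_diff: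
  assumes "f \<in> sobolev s" "g \<in> sobolev s"
  shows "(\<lambda>x. f x - g x) \<in> sobolev s"
  using sobolev_add[OF assms(1) sobolev_minus(1)[OF assms(2)]] by simp

lemma sobolev_norm_diff_eq:
  assumes f: "f \<in> sobolev s" and g: "g \<in> sobolev s"
  shows "sobolev_norm s (\<lambda>x. f x - g x) = L2norm (weighted s (\<lambda>\<xi>. fourier f \<xi> - fourier g \<xi>))"
  using sobolev_square_integrable[OF f] sobolev_square_integrable[OF g]
  by (intro sobolev_norm_AE_eq fourier_diff square_integrable_diff square_integrable_measurable)

lemma sobolev_norm_diff_commute:
  assumes "f \<in> sobolev s" "g \<in> sobolev s"
  shows "sobolev_norm s (\<lambda>x. f x - g x) = sobolev_norm s (\<lambda>x. g x - f x)"
  using sobolev_minus(2)[OF sobolev_diff[OF assms]] by simp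

lemma sobolev_norm_triangle3:
  assumes "f \<in> sobolev s" "g \<in> sobolev s" "h \<in> sobolev s"
  shows "sobolev_norm s (\<lambda>x. f x - h x) \<le> sobolev_norm s (\<lambda>x. f x - g x) + sobolev_norm s (\<lambda>x. g x - h x)"
  using sobolev_norm_add_le[OF sobolev_diff[OF assms(1,2)] sobolev_diff[OF assms(2,3)]] by simp

lemma sobolev_norm_le_diff:
  assumes "f \<in> sobolev s" "g \<in> sobolev s"
  shows "sobolev_norm s f \<le> sobolev_norm s (\<lambda>x. f x - g x) + sobolev_norm s g"
  using sobolev_norm_add_le[OF sobolev_diff[OF assms(1,2)] assms(2)] by simp

lemma zero_in_sobolev:
  "(\<lambda>x::'a::euclidean_space. 0) \<in> sobolev s" "sobolev_norm s (\<lambda>x::'a::euclidean_space. 0) = 0"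
proof -
  have F0: "AE \<xi> in lborel. fourier (\<lambda>x::'a. 0) \<xi> = 0"
    using fourier_cmult[OF square_integrable_zero, of 0] by simp
  have w0: "weighted s (\<lambda>\<xi>::'a. 0) = (\<lambda>\<xi>. 0)" by simp
  show "(\<lambda>x::'a. 0) \<in> sobolev s"
    by (rule sobolevI[OF square_integrable_zero F0]) (simp add: w0)
  show "sobolev_norm s (\<lambda>x::'a. 0) = 0"
    using sobolev_norm_AE_eq[OF square_integrable_zero _ F0] by (simp add: w0)
qed

lemma sobolev_sum:
  assumes "finite A" "\<And>i. i \<in> A \<Longrightarrow> f i \<in> sobolev s"
  shows "(\<lambda>x. \<Sum>i\<in>A. f i x) \<in> sobolev s \<and>
    sobolev_norm s (\<lambda>x. \<Sum>i\<in>A. f i x) \<le> (\<Sum>i\<in>A. sobolev_norm s (f i))"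
  using assms
proof (induction A rule: finite_induct)
  case empty
  show ?case by (simp add: zero_in_sobolev)
next
  case (insert a A)
  then have IH: "(\<lambda>x. \<Sum>i\<in>A. f i x) \<in> sobolev s" "f a \<in> sobolev s"
    "sobolev_norm s (\<lambda>x. \<Sum>i\<in>A. f i x) \<le> (\<Sum>i\<in>A. sobolev_norm s (f i))"
    by auto
  show ?case
    using sobolev_add[OF IH(2,1)] sobolev_norm_add_le[OF IH(2,1)] IH(3) insert.hyps by simp
qed

text \<open>Conjugation reflects and conjugates the transform, and the weight is even.\<close>

lemma sobolev_cnj:
  fixes f :: "'a::euclidean_space \<Rightarrow> complex"
  assumes f: "f \<in> sobolev s"
  shows "(\<lambda>x. cnj (f x)) \<in> sobolev s" "sobolev_norm s (\<lambda>x. cnj (f x)) = sobolev_norm s f"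
proof -
  note F = sobolev_square_integrable[OF f]
  have eq: "weighted s (\<lambda>\<xi>. cnj (fourier f (- \<xi>))) = (\<lambda>\<xi>. cnj (weighted s (fourier f) (- \<xi>)))"
    by (simp add: sobolev_weight_def)
  show "(\<lambda>x. cnj (f x)) \<in> sobolev s"
  proof (rule sobolevI)
    show "AE \<xi> in lborel. fourier (\<lambda>x. cnj (f x)) \<xi> = cnj (fourier f (- \<xi>))" by (rule fourier_cnj[OF F(1)])
    show "square_integrable (weighted s (\<lambda>\<xi>. cnj (fourier f (- \<xi>))))"
      unfolding eq by (rule square_integrable_cnj[OF square_integrable_reflect[OF F(3)]])
  qed (rule square_integrable_cnj[OF F(1)])
  have "sobolev_norm s (\<lambda>x. cnj (f x)) = L2norm (weighted s (\<lambda>\<xi>. cnj (fourier f (- \<xi>))))"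
    by (rule sobolev_norm_AE_eq[OF square_integrable_cnj[OF F(1)] _ fourier_cnj[OF F(1)]])
      (rule square_integrable_measurable[OF square_integrable_cnj[OF square_integrable_reflect[OF F(2)]]])
  also have "\<dots> = L2norm (\<lambda>\<xi>. weighted s (fourier f) (- \<xi>))"
    unfolding eq by (rule L2norm_cnj)
  also have "\<dots> = sobolev_norm s f"
    unfolding sobolev_norm_eq by (rule L2norm_reflect[OF square_integrable_measurable[OF F(3)]])
  finally show "sobolev_norm s (\<lambda>x. cnj (f x)) = sobolev_norm s f" .
qed

lemma sobolev_multiplier:
  fixes f :: "'a::euclidean_space \<Rightarrow> complex"
  assumes f: "f \<in> sobolev s" and m: "m \<in> borel_measurable borel" "\<And>\<xi>. cmod (m \<xi>) \<le> 1"
  defines "g \<equiv> inverse_fourier (\<lambda>\<xi>. m \<xi> * fourier f \<xi>)"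
  shows "g \<in> sobolev s" "AE \<xi> in lborel. fourier g \<xi> = m \<xi> * fourier f \<xi>"
proof -
  note F = sobolev_square_integrable[OF f]
  have [measurable]: "fourier f \<in> borel_measurable borel" "m \<in> borel_measurable borel"
    using m square_integrable_measurable[OF F(2)] by auto
  have mF: "square_integrable (\<lambda>\<xi>. m \<xi> * fourier f \<xi>)"
    by (rule square_integrable_bound(1)[OF F(2)]) (use m(2) in \<open>auto simp: norm_mult intro!: mult_left_le_one_le\<close>)
  show *: "AE \<xi> in lborel. fourier g \<xi> = m \<xi> * fourier f \<xi>"
    unfolding g_def by (rule fourier_inverse_fourier[OF mF])
  show "g \<in> sobolev s"
  proof (rule sobolevI[OF _ *])
    show "square_integrable g"
      unfolding g_def by (rule square_integrable_inverse_fourier[OF mF])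
    show "square_integrable (weighted s (\<lambda>\<xi>. m \<xi> * fourier f \<xi>))"
      by (rule square_integrable_bound(1)[OF F(3)])
        (use m(2) in \<open>auto simp: norm_mult intro!: mult_left_mono mult_left_le_one_le\<close>)
  qed
qed

lemma ennreal_add_power2_le: "(x + y)\<^sup>2 \<le> 2 * x\<^sup>2 + 2 * (y::ennreal)\<^sup>2"
proof (cases "x = top \<or> y = top")
  case True
  then show ?thesis by (auto simp: power2_eq_square ennreal_mult_top ennreal_top_mult)
next
  case False
  then obtain a b where ab: "x = ennreal a" "0 \<le> a" "y = ennreal b" "0 \<le> b"
    by (metis ennreal_cases)
  have "(a + b)\<^sup>2 \<le> 2 * a\<^sup>2 + 2 * b\<^sup>2"
    using sum_squares_bound[of a b] by (simp add: power2_sum)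
  then have "ennreal ((a + b)\<^sup>2) \<le> ennreal (2 * a\<^sup>2 + 2 * b\<^sup>2)" by (rule ennreal_leI)
  also have "\<dots> = ennreal (2 * a\<^sup>2) + ennreal (2 * b\<^sup>2)" by (rule ennreal_plus) auto
  also have "\<dots> = 2 * (ennreal a)\<^sup>2 + 2 * (ennreal b)\<^sup>2"
  proof -
    have "ennreal (2 * c\<^sup>2) = 2 * (ennreal c)\<^sup>2" if "0 \<le> c" for c
      using that by (subst ennreal_mult) (simp_all add: ennreal_power)
    then show ?thesis using ab by (simp only:)
  qed
  finally show ?thesis
    using ab by (simp only: ennreal_power[symmetric] add_nonneg_nonneg ennreal_plus)
qed

lemma nn_integral_weighted:
  assumes "square_integrable (weighted s F)"
  shows "(\<integral>\<^sup>+ \<xi>. (ennreal (sobolev_weight s \<xi> * cmod (F \<xi>)))\<^sup>2 \<partial>lborel) = ennreal ((L2norm (weighted s F))\<^sup>2)"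
proof -
  have "(ennreal (sobolev_weight s \<xi> * cmod (F \<xi>)))\<^sup>2 = ennreal ((cmod (weighted s F \<xi>))\<^sup>2)" for \<xi>
    using sobolev_weight_pos[of s \<xi>] by (simp add: norm_mult ennreal_power)
  then show ?thesis by (simp only: nn_integral_square_integrable[OF assms])
qed

text \<open>Cauchy-Schwarz after inserting the weight times its inverse. This is the Sobolev
  embedding on the Fourier side: when the first factor is finite, transforms of functions in
  \<open>sobolev s\<close> are integrable.\<close>

lemma sobolev_fourier_L1_bound:
  fixes F :: "'a::euclidean_space \<Rightarrow> complex"
  assumes F [measurable]: "F \<in> borel_measurable borel" and wF: "square_integrable (weighted s F)"
  shows "(\<integral>\<^sup>+ \<xi>. ennreal (cmod (F \<xi>)) \<partial>lborel)\<^sup>2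
    \<le> (\<integral>\<^sup>+ \<xi>. ennreal ((1 + (norm (\<xi>::'a))\<^sup>2) powr (- s)) \<partial>lborel) * ennreal ((L2norm (weighted s F))\<^sup>2)"
proof -
  let ?w = "sobolev_weight s :: 'a \<Rightarrow> real"
  have "ennreal (cmod (F \<xi>)) = ennreal (inverse (?w \<xi>)) * ennreal (?w \<xi> * cmod (F \<xi>))" for \<xi>
    using sobolev_weight_pos[of s \<xi>] by (subst ennreal_mult[symmetric]) auto
  then have "(\<integral>\<^sup>+ \<xi>. ennreal (cmod (F \<xi>)) \<partial>lborel)\<^sup>2
      = (\<integral>\<^sup>+ \<xi>. ennreal (inverse (?w \<xi>)) * ennreal (?w \<xi> * cmod (F \<xi>)) \<partial>lborel)\<^sup>2"
    by (simp only:)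
  also have "\<dots> \<le> (\<integral>\<^sup>+ \<xi>. (ennreal (inverse (?w \<xi>)))\<^sup>2 \<partial>lborel) * (\<integral>\<^sup>+ \<xi>. (ennreal (?w \<xi> * cmod (F \<xi>)))\<^sup>2 \<partial>lborel)"
    by (rule Cauchy_Schwarz_nn_integral) measurable
  also have "(\<integral>\<^sup>+ \<xi>. (ennreal (?w \<xi> * cmod (F \<xi>)))\<^sup>2 \<partial>lborel) = ennreal ((L2norm (weighted s F))\<^sup>2)"
    by (rule nn_integral_weighted[OF wF])
  also have "(\<integral>\<^sup>+ \<xi>. (ennreal (inverse (?w \<xi>)))\<^sup>2 \<partial>lborel) = (\<integral>\<^sup>+ \<xi>. ennreal ((1 + (norm (\<xi>::'a))\<^sup>2) powr (- s)) \<partial>lborel)"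
  proof (rule nn_integral_cong)
    fix \<xi> :: 'a
    have "(inverse (?w \<xi>))\<^sup>2 = (1 + (norm \<xi>)\<^sup>2) powr (- s)"
      by (simp only: power_inverse sobolev_weight_power2 powr_minus)
    then show "(ennreal (inverse (?w \<xi>)))\<^sup>2 = ennreal ((1 + (norm \<xi>)\<^sup>2) powr (- s))"
      using sobolev_weight_pos[of s \<xi>] by (simp add: ennreal_power)
  qed
  finally show ?thesis .
qed

text \<open>Subadditivity transfers the weight to one of the two factors; Young's inequality then
  takes the weighted factor in L2 and the other in L1. In the constant, \<open>2 powr s\<close>
  comes from subadditivity, \<open>sqrt K\<close> from the L1 bound, and the leading 2 from squaring
  the sum of the two symmetric contributions \<open>P\<close> and \<open>Q\<close>.\<close>

lemma weighted_convolution_bound: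
  fixes F G :: "'a::euclidean_space \<Rightarrow> complex"
  assumes s: "0 \<le> s" and K: "(\<integral>\<^sup>+ \<xi>. ennreal ((1 + (norm (\<xi>::'a))\<^sup>2) powr (- s)) \<partial>lborel) = ennreal K" "0 \<le> K"
    and F [measurable]: "F \<in> borel_measurable borel" and wF: "square_integrable (weighted s F)"
    and G [measurable]: "G \<in> borel_measurable borel" and wG: "square_integrable (weighted s G)"
  shows "square_integrable (weighted s (convolution F G))"
    "L2norm (weighted s (convolution F G))
      \<le> 2 * 2 powr s * sqrt K * L2norm (weighted s F) * L2norm (weighted s G)"
proof -
  let ?w = "sobolev_weight s :: 'a \<Rightarrow> real"
  define a b where "a = L2norm (weighted s F)" and "b = L2norm (weighted s G)"
  define P where "P \<xi> = (\<integral>\<^sup>+ \<eta>. ennreal (?w (\<xi> - \<eta>) * cmod (F (\<xi> - \<eta>))) * ennreal (cmod (G \<eta>)) \<partial>lborel)" for \<xi>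
  define Q where "Q \<xi> = (\<integral>\<^sup>+ \<eta>. ennreal (?w (\<xi> - \<eta>) * cmod (G (\<xi> - \<eta>))) * ennreal (cmod (F \<eta>)) \<partial>lborel)" for \<xi>
  have [measurable]: "P \<in> borel_measurable borel" "Q \<in> borel_measurable borel"
    unfolding P_def[abs_def] Q_def[abs_def] by measurable
  \<comment> \<open>The substitution of \<open>\<xi> - \<eta>\<close> for \<eta>, performed as a
    reflection followed by a translation, brings the weighted factor into the position that
    \<open>nn_integral_young\<close> expects.\<close>
  have Q_eq: "Q \<xi> = (\<integral>\<^sup>+ \<eta>. ennreal (cmod (F (\<xi> - \<eta>))) * ennreal (?w \<eta> * cmod (G \<eta>)) \<partial>lborel)" for \<xi>
  proof -
    have "(\<integral>\<^sup>+ \<eta>. ennreal (cmod (F (\<xi> - \<eta>))) * ennreal (?w \<eta> * cmod (G \<eta>)) \<partial>lborel)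
        = (\<integral>\<^sup>+ \<eta>. ennreal (cmod (F (\<xi> - - \<eta>))) * ennreal (?w (- \<eta>) * cmod (G (- \<eta>))) \<partial>lborel)"
      by (rule nn_integral_lborel_reflect[symmetric]) measurable
    also have "\<dots> = (\<integral>\<^sup>+ \<eta>. ennreal (cmod (F (\<xi> - - (- \<xi> + \<eta>)))) * ennreal (?w (- (- \<xi> + \<eta>)) * cmod (G (- (- \<xi> + \<eta>)))) \<partial>lborel)"
      by (rule nn_integral_lborel_translate[symmetric]) measurable
    also have "\<dots> = Q \<xi>"
      unfolding Q_def by (simp add: mult.commute)
    finally show ?thesis ..
  qed
  have le: "ennreal (?w \<xi> * cmod (convolution F G \<xi>)) \<le> ennreal (2 powr s) * (P \<xi> + Q \<xi>)" for \<xi>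
  proof -
    have "ennreal (?w \<xi> * cmod (convolution F G \<xi>)) = ennreal (?w \<xi>) * ennreal (cmod (convolution F G \<xi>))"
      using sobolev_weight_pos[of s \<xi>] by (intro ennreal_mult) auto
    also have "\<dots> \<le> ennreal (?w \<xi>) * (\<integral>\<^sup>+ \<eta>. ennreal (cmod (F (\<xi> - \<eta>))) * ennreal (cmod (G \<eta>)) \<partial>lborel)"
      by (intro mult_left_mono norm_convolution_le) simp
    also have "\<dots> = (\<integral>\<^sup>+ \<eta>. ennreal (?w \<xi>) * (ennreal (cmod (F (\<xi> - \<eta>))) * ennreal (cmod (G \<eta>))) \<partial>lborel)"
      by (rule nn_integral_cmult[symmetric]) measurable
    also have "\<dots> \<le> (\<integral>\<^sup>+ \<eta>. ennreal (2 powr s) *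
        (ennreal (?w (\<xi> - \<eta>) * cmod (F (\<xi> - \<eta>))) * ennreal (cmod (G \<eta>))
          + ennreal (cmod (F (\<xi> - \<eta>))) * ennreal (?w \<eta> * cmod (G \<eta>))) \<partial>lborel)"
    proof (rule nn_integral_mono)
      fix \<eta>
      let ?f = "cmod (F (\<xi> - \<eta>))" and ?g = "cmod (G \<eta>)"
      have wp: "0 \<le> ?w (\<xi> - \<eta>)" "0 \<le> ?w \<eta>" "0 \<le> ?w \<xi>"
        using sobolev_weight_pos less_imp_le by blast+
      have "?w \<xi> * (?f * ?g) \<le> (2 powr s * (?w (\<xi> - \<eta>) + ?w \<eta>)) * (?f * ?g)"
        by (intro mult_right_mono sobolev_weight_subadditive s) auto
      also have "\<dots> = 2 powr s * ((?w (\<xi> - \<eta>) * ?f) * ?g + ?f * (?w \<eta> * ?g))"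
        by (simp add: algebra_simps)
      finally have "ennreal (?w \<xi> * (?f * ?g)) \<le> ennreal (2 powr s * ((?w (\<xi> - \<eta>) * ?f) * ?g + ?f * (?w \<eta> * ?g)))"
        by (rule ennreal_leI)
      then show "ennreal (?w \<xi>) * (ennreal ?f * ennreal ?g)
          \<le> ennreal (2 powr s) * (ennreal (?w (\<xi> - \<eta>) * ?f) * ennreal ?g + ennreal ?f * ennreal (?w \<eta> * ?g))"
        by (simp only: ennreal_mult ennreal_plus mult_nonneg_nonneg add_nonneg_nonneg norm_ge_zero powr_ge_zero wp)
    qed
    also have "\<dots> = ennreal (2 powr s) * (P \<xi> + Q \<xi>)"
      unfolding Q_eq P_def by (subst nn_integral_cmult, measurable, subst nn_integral_add, measurable)
    finally show ?thesis .
  qed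
  have P2: "(\<integral>\<^sup>+ \<xi>. (P \<xi>)\<^sup>2 \<partial>lborel) \<le> ennreal (K * a\<^sup>2 * b\<^sup>2)"
  proof -
    have "(\<integral>\<^sup>+ \<xi>. (P \<xi>)\<^sup>2 \<partial>lborel)
        \<le> (\<integral>\<^sup>+ \<xi>. (ennreal (?w \<xi> * cmod (F \<xi>)))\<^sup>2 \<partial>lborel) * (\<integral>\<^sup>+ \<eta>. ennreal (cmod (G \<eta>)) \<partial>lborel)\<^sup>2"
      unfolding P_def by (rule nn_integral_young) measurable
    also have "\<dots> \<le> ennreal (a\<^sup>2) * (ennreal K * ennreal (b\<^sup>2))"
      unfolding nn_integral_weighted[OF wF] a_def b_def K(1)[symmetric]
      by (intro mult_left_mono sobolev_fourier_L1_bound G wG) simp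
    also have "\<dots> = ennreal (K * a\<^sup>2 * b\<^sup>2)"
      using K(2) by (simp add: ennreal_mult[symmetric] mult_ac)
    finally show ?thesis .
  qed
  have Q2: "(\<integral>\<^sup>+ \<xi>. (Q \<xi>)\<^sup>2 \<partial>lborel) \<le> ennreal (K * a\<^sup>2 * b\<^sup>2)"
  proof -
    have "(\<integral>\<^sup>+ \<xi>. (Q \<xi>)\<^sup>2 \<partial>lborel)
        \<le> (\<integral>\<^sup>+ \<xi>. (ennreal (?w \<xi> * cmod (G \<xi>)))\<^sup>2 \<partial>lborel) * (\<integral>\<^sup>+ \<eta>. ennreal (cmod (F \<eta>)) \<partial>lborel)\<^sup>2"
      unfolding Q_def by (rule nn_integral_young) measurable
    also have "\<dots> \<le> ennreal (b\<^sup>2) * (ennreal K * ennreal (a\<^sup>2))"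
      unfolding nn_integral_weighted[OF wG] a_def b_def K(1)[symmetric]
      by (intro mult_left_mono sobolev_fourier_L1_bound F wF) simp
    also have "\<dots> = ennreal (K * a\<^sup>2 * b\<^sup>2)"
      using K(2) by (simp add: ennreal_mult[symmetric] mult_ac)
    finally show ?thesis .
  qed
  have "(\<integral>\<^sup>+ \<xi>. ennreal ((cmod (weighted s (convolution F G) \<xi>))\<^sup>2) \<partial>lborel)
      = (\<integral>\<^sup>+ \<xi>. (ennreal (?w \<xi> * cmod (convolution F G \<xi>)))\<^sup>2 \<partial>lborel)"
  proof (rule nn_integral_cong)
    fix \<xi> :: 'a
    show "ennreal ((cmod (weighted s (convolution F G) \<xi>))\<^sup>2) = (ennreal (?w \<xi> * cmod (convolution F G \<xi>)))\<^sup>2"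
      using sobolev_weight_pos[of s \<xi>] by (simp add: norm_mult ennreal_power)
  qed
  also have "\<dots> \<le> (\<integral>\<^sup>+ \<xi>. (ennreal (2 powr s))\<^sup>2 * (2 * (P \<xi>)\<^sup>2 + 2 * (Q \<xi>)\<^sup>2) \<partial>lborel)"
  proof (rule nn_integral_mono)
    fix \<xi>
    have "(ennreal (?w \<xi> * cmod (convolution F G \<xi>)))\<^sup>2 \<le> (ennreal (2 powr s) * (P \<xi> + Q \<xi>))\<^sup>2"
      by (rule power_mono[OF le]) simp
    also have "\<dots> \<le> (ennreal (2 powr s))\<^sup>2 * (2 * (P \<xi>)\<^sup>2 + 2 * (Q \<xi>)\<^sup>2)"
      unfolding power_mult_distrib by (intro mult_left_mono ennreal_add_power2_le) simp
    finally show "(ennreal (?w \<xi> * cmod (convolution F G \<xi>)))\<^sup>2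
        \<le> (ennreal (2 powr s))\<^sup>2 * (2 * (P \<xi>)\<^sup>2 + 2 * (Q \<xi>)\<^sup>2)" .
  qed
  also have "\<dots> = (ennreal (2 powr s))\<^sup>2 * (2 * (\<integral>\<^sup>+ \<xi>. (P \<xi>)\<^sup>2 \<partial>lborel) + 2 * (\<integral>\<^sup>+ \<xi>. (Q \<xi>)\<^sup>2 \<partial>lborel))"
    by (subst nn_integral_cmult, measurable, subst nn_integral_add, measurable)
      (subst nn_integral_cmult, measurable, subst nn_integral_cmult, measurable)
  also have "\<dots> \<le> (ennreal (2 powr s))\<^sup>2 * (2 * ennreal (K * a\<^sup>2 * b\<^sup>2) + 2 * ennreal (K * a\<^sup>2 * b\<^sup>2))"
    by (intro mult_left_mono add_mono P2 Q2) auto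
  also have "\<dots> = ennreal ((2 powr s)\<^sup>2 * (4 * (K * a\<^sup>2 * b\<^sup>2)))"
  proof -
    have "2 * ennreal x + 2 * ennreal x = ennreal (4 * x)" if "0 \<le> x" for x
    proof -
      have "2 * ennreal x = ennreal (2 * x)" using that by (subst ennreal_mult) simp_all
      moreover have "ennreal (4 * x) = ennreal (2 * x) + ennreal (2 * x)"
        using that by (subst ennreal_plus[symmetric]) simp_all
      ultimately show ?thesis by (simp only:)
    qed
    from this[of "K * a\<^sup>2 * b\<^sup>2"] show ?thesis
      using K(2) by (simp only: ennreal_power powr_ge_zero mult_nonneg_nonneg zero_le_power2)
        (rule ennreal_mult[symmetric], auto)
  qed
  also have "(2 powr s)\<^sup>2 * (4 * (K * a\<^sup>2 * b\<^sup>2)) = (2 * 2 powr s * sqrt K * a * b)\<^sup>2"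
    using K(2) by (simp add: power_mult_distrib)
  finally have *: "(\<integral>\<^sup>+ \<xi>. ennreal ((cmod (weighted s (convolution F G) \<xi>))\<^sup>2) \<partial>lborel)
      \<le> ennreal ((2 * 2 powr s * sqrt K * a * b)\<^sup>2)" .
  have nn: "0 \<le> 2 * 2 powr s * sqrt K * a * b"
    using K(2) by (simp add: a_def b_def)
  have [measurable]: "weighted s (convolution F G) \<in> borel_measurable borel" by measurable
  show "square_integrable (weighted s (convolution F G))"
    "L2norm (weighted s (convolution F G)) \<le> 2 * 2 powr s * sqrt K * L2norm (weighted s F) * L2norm (weighted s G)"
    using square_integrable_L2norm_leI[OF _ nn *] by (simp_all add: a_def b_def)
qed

lemma square_integrable_weightedD:
  assumes "0 \<le> s" "F \<in> borel_measurable borel" "square_integrable (weighted s F)"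
  shows "square_integrable F"
proof (rule square_integrable_bound(1)[OF assms(3,2)])
  fix x
  have "1 * cmod (F x) \<le> sobolev_weight s x * cmod (F x)"
    by (intro mult_right_mono sobolev_weight_ge_1 assms) simp
  then show "cmod (F x) \<le> cmod (weighted s F x)"
    using sobolev_weight_pos[of s x] by (simp add: norm_mult)
qed

text \<open>The argument starts on the Fourier side: \<open>H\<close> is the candidate transform of
  the product, lies in the weighted L2 space by \<open>weighted_convolution_bound\<close>, and its
  inverse transform is then recognised as the product. In this way membership of the product in L2
  is an outcome and not a prerequisite.\<close>

lemma sobolev_mult:
  assumes s: "real DIM('a::euclidean_space) / 2 < s"
  obtains C where "0 \<le> C"
    "\<And>f g :: 'a \<Rightarrow> complex. f \<in> sobolev s \<Longrightarrow> g \<in> sobolev s \<Longrightarrow>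
      (\<lambda>x. f x * g x) \<in> sobolev s \<and> sobolev_norm s (\<lambda>x. f x * g x) \<le> C * sobolev_norm s f * sobolev_norm s g"
proof -
  have s0: "0 \<le> s" using s by (intro order.trans[OF _ less_imp_le[OF s]]) simp
  obtain K where K: "(\<integral>\<^sup>+ \<xi>. ennreal ((1 + (norm (\<xi>::'a))\<^sup>2) powr (- s)) \<partial>lborel) = ennreal K" "0 \<le> K"
    using nn_integral_inverse_sobolev_weight_finite[OF s] by (cases rule: ennreal_cases) auto
  let ?c = "complex_of_real (fourier_const TYPE('a))"
  let ?C = "fourier_const TYPE('a) * (2 * 2 powr s * sqrt K)"
  have "(\<lambda>x. f x * g x) \<in> sobolev s \<and> sobolev_norm s (\<lambda>x. f x * g x) \<le> ?C * sobolev_norm s f * sobolev_norm s g"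
    if f: "f \<in> sobolev s" and g: "g \<in> sobolev s" for f g :: "'a \<Rightarrow> complex"
  proof -
    note F = sobolev_square_integrable[OF f] and G = sobolev_square_integrable[OF g]
    note Fm [measurable] = square_integrable_measurable[OF F(1)] square_integrable_measurable[OF F(2)]
    note Gm [measurable] = square_integrable_measurable[OF G(1)] square_integrable_measurable[OF G(2)]
    have L1: "integrable lborel H" if [measurable]: "H \<in> borel_measurable borel" and wH: "square_integrable (weighted s H)"
      for H :: "'a \<Rightarrow> complex"
    proof -
      have "(\<integral>\<^sup>+ \<xi>. ennreal (cmod (H \<xi>)) \<partial>lborel)\<^sup>2 \<le> ennreal K * ennreal ((L2norm (weighted s H))\<^sup>2)"
        using sobolev_fourier_L1_bound[OF that] by (simp only: K)
      also have "\<dots> < top" by (simp add: ennreal_mult[symmetric] K)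
      finally have "(\<integral>\<^sup>+ \<xi>. ennreal (cmod (H \<xi>)) \<partial>lborel) < \<infinity>"
        by (auto simp: power2_eq_square less_top[symmetric])
      then show ?thesis by (intro integrableI_bounded) auto
    qed
    \<comment> \<open>Because the transform of \<open>h\<close> is integrable, inversion can be
      written with an honest Fourier integral, to which the convolution theorem applies
      pointwise.\<close>
    have FI: "AE x in lborel. h x = fourier_integral (fourier h) (- x)" if h: "h \<in> sobolev s" for h :: "'a \<Rightarrow> complex"
    proof -
      note H = sobolev_square_integrable[OF h]
      have "AE x in lborel. fourier (fourier h) x = fourier_integral (fourier h) x"
        by (rule fourier_integrable[OF L1[OF square_integrable_measurable[OF H(2)] H(3)] H(2)])
      from AE_lborel_reflect[OF this] inverse_fourier_fourier[OF H(1)] show ?thesis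
        by eventually_elim (simp add: inverse_fourier_def)
    qed
    \<comment> \<open>The factor \<open>?c\<close> is the one demanded by
      \<open>fourier_integral_convolution\<close>, so that the transform of \<open>H\<close> is
      exactly the product of the two transforms.\<close>
    define H where "H \<xi> = ?c * convolution (fourier f) (fourier g) \<xi>" for \<xi>
    have [measurable]: "H \<in> borel_measurable borel" unfolding H_def[abs_def] by measurable
    have wH_eq: "weighted s H = (\<lambda>\<xi>. ?c * weighted s (convolution (fourier f) (fourier g)) \<xi>)"
      by (simp only: H_def mult.left_commute)
    note conv = weighted_convolution_bound[OF s0 K Fm(2) F(3) Gm(2) G(3)]
    have wH: "square_integrable (weighted s H)"
      unfolding wH_eq by (rule square_integrable_cmult[OF conv(1)])
    have sH: "square_integrable H" by (rule square_integrable_weightedD[OF s0 _ wH]) measurable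
    have FIH: "fourier_integral H \<zeta> = fourier_integral (fourier f) \<zeta> * fourier_integral (fourier g) \<zeta>" for \<zeta>
      unfolding H_def[abs_def] fourier_integral_cmult
      by (rule fourier_integral_convolution[OF L1[OF Fm(2) F(3)] L1[OF Gm(2) G(3)]])
    have "AE x in lborel. fourier H (- x) = fourier_integral H (- x)"
      by (rule AE_lborel_reflect) (rule fourier_integrable[OF L1[OF _ wH] sH], measurable)
    with FI[OF f] FI[OF g] have eq: "AE x in lborel. inverse_fourier H x = f x * g x"
      by eventually_elim (simp add: inverse_fourier_def FIH)
    have iH: "square_integrable (inverse_fourier H)" by (rule square_integrable_inverse_fourier[OF sH])
    have m: "(\<lambda>x. f x * g x) \<in> borel_measurable borel" by measurable
    have inS: "inverse_fourier H \<in> sobolev s"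
      by (rule sobolevI[OF iH fourier_inverse_fourier[OF sH] wH])
    have "sobolev_norm s (inverse_fourier H) = L2norm (weighted s H)"
      by (rule sobolev_norm_AE_eq[OF iH _ fourier_inverse_fourier[OF sH]]) measurable
    also have "\<dots> = fourier_const TYPE('a) * L2norm (weighted s (convolution (fourier f) (fourier g)))"
      unfolding wH_eq L2norm_cmult by simp
    also have "\<dots> \<le> fourier_const TYPE('a) * (2 * 2 powr s * sqrt K * L2norm (weighted s (fourier f)) * L2norm (weighted s (fourier g)))"
      by (intro mult_left_mono conv(2)) simp
    finally have "sobolev_norm s (inverse_fourier H) \<le> ?C * sobolev_norm s f * sobolev_norm s g"
      by (simp only: sobolev_norm_eq mult.assoc)
    then show ?thesis
      using sobolev_cong_AE[OF inS m eq] by simp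
  qed
  moreover have "0 \<le> ?C" using K(2) by simp
  ultimately show thesis using that by blast
qed

definition cubic :: "('a::euclidean_space \<Rightarrow> complex) \<Rightarrow> 'a \<Rightarrow> complex" where
  "cubic u = (\<lambda>x. complex_of_real ((cmod (u x))\<^sup>2) * u x)"

text \<open>Written as u times its conjugate times u, the nonlinearity is trilinear over the reals,
  and telescoping changes one factor at a time. With a and b the norms of u and v, this gives
  \<open>a\<^sup>2 + a b + b\<^sup>2\<close>, estimated by \<open>(a + b)\<^sup>2\<close>; the
  square of the constant arises from two uses of the algebra property.\<close>

lemma cubic_Lipschitz:
  assumes s: "real DIM('a::euclidean_space) / 2 < s"
  obtains C where "0 \<le> C"
    "\<And>u :: 'a \<Rightarrow> complex. u \<in> sobolev s \<Longrightarrow> cubic u \<in> sobolev s"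
    "\<And>u v :: 'a \<Rightarrow> complex. u \<in> sobolev s \<Longrightarrow> v \<in> sobolev s \<Longrightarrow>
      sobolev_norm s (\<lambda>x. cubic u x - cubic v x)
        \<le> C * (sobolev_norm s u + sobolev_norm s v)\<^sup>2 * sobolev_norm s (\<lambda>x. u x - v x)"
proof -
  obtain C where C: "0 \<le> C"
    and in_s: "\<And>f g :: 'a \<Rightarrow> complex. f \<in> sobolev s \<Longrightarrow> g \<in> sobolev s \<Longrightarrow> (\<lambda>x. f x * g x) \<in> sobolev s"
    and le: "\<And>f g :: 'a \<Rightarrow> complex. f \<in> sobolev s \<Longrightarrow> g \<in> sobolev s \<Longrightarrow>
      sobolev_norm s (\<lambda>x. f x * g x) \<le> C * sobolev_norm s f * sobolev_norm s g"
    using sobolev_mult[OF s] by metis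
  have triple: "(\<lambda>x. f x * (g x * h x)) \<in> sobolev s \<and>
      sobolev_norm s (\<lambda>x. f x * (g x * h x)) \<le> C\<^sup>2 * (sobolev_norm s f * (sobolev_norm s g * sobolev_norm s h))"
    if f: "f \<in> sobolev s" and g: "g \<in> sobolev s" and h: "h \<in> sobolev s" for f g h :: "'a \<Rightarrow> complex"
  proof
    show "(\<lambda>x. f x * (g x * h x)) \<in> sobolev s" by (intro in_s f g h)
    have "sobolev_norm s (\<lambda>x. f x * (g x * h x)) \<le> C * sobolev_norm s f * sobolev_norm s (\<lambda>x. g x * h x)"
      by (intro le in_s f g h)
    also have "\<dots> \<le> C * sobolev_norm s f * (C * sobolev_norm s g * sobolev_norm s h)"
      by (intro mult_left_mono le g h) (simp add: C)
    finally show "sobolev_norm s (\<lambda>x. f x * (g x * h x)) \<le> C\<^sup>2 * (sobolev_norm s f * (sobolev_norm s g * sobolev_norm s h))"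
      by (simp add: power2_eq_square mult_ac)
  qed
  have cubic_eq: "cubic u = (\<lambda>x. u x * (cnj (u x) * u x))" for u :: "'a \<Rightarrow> complex"
    unfolding cubic_def complex_norm_square mult.assoc ..
  show thesis
  proof (rule that[of "C\<^sup>2"])
    show "cubic u \<in> sobolev s" if "u \<in> sobolev s" for u :: "'a \<Rightarrow> complex"
      unfolding cubic_eq using triple sobolev_cnj(1) that by blast
    fix u v :: "'a \<Rightarrow> complex" assume u: "u \<in> sobolev s" and v: "v \<in> sobolev s"
    let ?a = "sobolev_norm s u" and ?b = "sobolev_norm s v" and ?d = "sobolev_norm s (\<lambda>x. u x - v x)"
    note d = sobolev_diff[OF u v]
    note cu = sobolev_cnj[OF u] and cv = sobolev_cnj[OF v] and cd = sobolev_cnj[OF d]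
    note t1 = triple[OF d cu(1) u] and t2 = triple[OF v cd(1) u] and t3 = triple[OF v cv(1) d]
    have eq: "cubic u x - cubic v x = (u x - v x) * (cnj (u x) * u x)
        + (v x * (cnj (u x - v x) * u x) + v x * (cnj (v x) * (u x - v x)))" for x
      unfolding cubic_eq by (simp add: algebra_simps)
    have "sobolev_norm s (\<lambda>x. cubic u x - cubic v x)
        \<le> sobolev_norm s (\<lambda>x. (u x - v x) * (cnj (u x) * u x))
          + sobolev_norm s (\<lambda>x. v x * (cnj (u x - v x) * u x) + v x * (cnj (v x) * (u x - v x)))"
      unfolding eq using t1 t2 t3 by (intro sobolev_norm_add_le sobolev_add) blast+
    also have "\<dots> \<le> sobolev_norm s (\<lambda>x. (u x - v x) * (cnj (u x) * u x))
          + (sobolev_norm s (\<lambda>x. v x * (cnj (u x - v x) * u x)) + sobolev_norm s (\<lambda>x. v x * (cnj (v x) * (u x - v x))))"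
      using t2 t3 by (intro add_left_mono sobolev_norm_add_le) blast+
    also have "\<dots> \<le> C\<^sup>2 * (?d * (?a * ?a)) + (C\<^sup>2 * (?b * (?d * ?a)) + C\<^sup>2 * (?b * (?b * ?d)))"
      using t1 t2 t3 unfolding cu(2) cv(2) cd(2) by (intro add_mono) blast+
    also have "\<dots> = C\<^sup>2 * (?a\<^sup>2 + ?a * ?b + ?b\<^sup>2) * ?d"
      by (simp add: algebra_simps power2_eq_square)
    also have "\<dots> \<le> C\<^sup>2 * (?a + ?b)\<^sup>2 * ?d"
      by (intro mult_right_mono mult_left_mono) (simp_all add: power2_sum)
    finally show "sobolev_norm s (\<lambda>x. cubic u x - cubic v x) \<le> C\<^sup>2 * (?a + ?b)\<^sup>2 * ?d" .
  qed (use C in simp)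
qed


subsection \<open>Averaging and Gronwall\<close>

lemma interval_integral_affine:
  fixes f :: "real \<Rightarrow> real"
  assumes "0 < c"
  shows "(LBINT x=ereal a..ereal b. f (d + c * x)) = (LBINT x=ereal (d + c * a)..ereal (d + c * b). f x) / c"
proof -
  have *: "(LBINT x=ereal a..ereal b. f (d + c * x)) = (LBINT x=ereal (d + c * a)..ereal (d + c * b). f x) / c"
    if "a \<le> b" for a b
  proof -
    have "(LBINT x=ereal (d + c * a)..ereal (d + c * b). f x)
        = (LINT x|lborel. indicat_real {d + c * a<..<d + c * b} x * f x)"
      using that assms by (simp add: interval_lebesgue_integral_def set_lebesgue_integral_def)
    also have "\<dots> = \<bar>c\<bar> *\<^sub>R (LINT x|lborel. indicat_real {d + c * a<..<d + c * b} (d + c * x) * f (d + c * x))"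
      using assms by (intro lborel_integral_real_affine) simp
    also have "(\<lambda>x. indicat_real {d + c * a<..<d + c * b} (d + c * x) * f (d + c * x))
        = (\<lambda>x. indicat_real {a<..<b} x * f (d + c * x))"
      using assms by (auto simp: indicator_def)
    also have "(LINT x|lborel. indicat_real {a<..<b} x * f (d + c * x)) = (LBINT x=ereal a..ereal b. f (d + c * x))"
      using that by (simp add: interval_lebesgue_integral_def set_lebesgue_integral_def)
    finally show ?thesis using assms by simp
  qed
  show ?thesis
  proof (cases "a \<le> b")
    case False
    then have "(LBINT x=ereal b..ereal a. f (d + c * x)) = (LBINT x=ereal (d + c * b)..ereal (d + c * a). f x) / c"
      by (intro *) simp
    then show ?thesis
      by (subst (1 2) interval_integral_endpoints_reverse) simp
  qed (rule *)
qed

lemma interval_integrable_bounded: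
  fixes f :: "real \<Rightarrow> real"
  assumes [measurable]: "f \<in> borel_measurable borel" and M: "\<And>x. \<bar>f x\<bar> \<le> M"
  shows "interval_lebesgue_integrable lborel (ereal a) (ereal b) f"
proof -
  have "set_integrable lborel {c<..<d} f" for c d
    unfolding set_integrable_def
  proof (rule Bochner_Integration.integrable_bound)
    have "integrable lborel (indicat_real {c<..<d})"
      using emeasure_bounded_finite[of "{c<..<d}"] by (intro integrable_real_indicator) auto
    then show "integrable lborel (\<lambda>x. indicat_real {c<..<d} x * M)"
      by (rule integrable_mult_left)
    show "AE x in lborel. norm (indicat_real {c<..<d} x *\<^sub>R f x) \<le> norm (indicat_real {c<..<d} x * M)"
      using M by (intro AE_I2) (auto simp: abs_mult intro!: mult_left_mono order_trans[OF M abs_ge_self])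
  qed measurable
  then show ?thesis
    by (simp add: interval_lebesgue_integrable_def)
qed

lemma interval_integral_abs_le:
  fixes f :: "real \<Rightarrow> real"
  assumes f: "f \<in> borel_measurable borel" and M: "\<And>x. \<bar>f x\<bar> \<le> M" and "a \<le> b"
  shows "\<bar>LBINT x=ereal a..ereal b. f x\<bar> \<le> M * (b - a)"
proof -
  note I = interval_integrable_bounded[OF f M, of a b]
  have si: "set_integrable lborel {a<..<b} f" "set_integrable lborel {a<..<b} (\<lambda>x. M)"
    using I interval_integrable_bounded[of "\<lambda>x. M" "\<bar>M\<bar>" a b] \<open>a \<le> b\<close> by (auto simp: interval_lebesgue_integrable_def)
  have "\<bar>LBINT x=ereal a..ereal b. f x\<bar> = norm (set_lebesgue_integral lborel {a<..<b} f)"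
    using \<open>a \<le> b\<close> by (simp add: interval_lebesgue_integral_def)
  also have "\<dots> \<le> (LINT x|lborel. norm (indicat_real {a<..<b} x *\<^sub>R f x))"
    unfolding set_lebesgue_integral_def by (rule integral_norm_bound)
  also have "\<dots> \<le> (LINT x|lborel. indicat_real {a<..<b} x *\<^sub>R M)"
    using si unfolding set_integrable_def
    by (intro integral_mono integrable_norm) (auto simp: indicator_def M)
  also have "\<dots> = (LBINT x=ereal a..ereal b. M)"
    using \<open>a \<le> b\<close> by (simp only: interval_lebesgue_integral_def set_lebesgue_integral_def) simp
  also have "\<dots> = M * (b - a)" by (rule interval_integral_const)
  finally show ?thesis .
qed

text \<open>The substitution \<open>x / e\<close> produces a factor e in front of an increment of
  the periodic, hence bounded, function \<open>D\<close>; the bound is therefore uniform in both end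
  points, however far apart they are.\<close>

lemma periodic_averaging:
  fixes f :: "real \<Rightarrow> real"
  assumes f: "f \<in> borel_measurable borel" and M: "\<And>x. \<bar>f x\<bar> \<le> M" and P: "0 < P"
    and per: "\<And>x. f (x + P) = f x"
  shows "\<exists>C\<ge>0. \<forall>e>0. \<forall>r t.
    \<bar>(LBINT x=ereal r..ereal t. f (x / e)) - (LBINT x=ereal r..ereal t. period_mean P f)\<bar> \<le> C * e"
proof -
  define F where "F x = (LBINT y=ereal 0..ereal x. f y)" for x
  have F_diff: "(LBINT y=ereal a..ereal b. f y) = F b - F a" for a b
  proof -
    have "(LBINT y=ereal 0..ereal a. f y) + (LBINT y=ereal a..ereal b. f y) = (LBINT y=ereal 0..ereal b. f y)"
    proof (rule interval_integral_sum)
      show "interval_lebesgue_integrable lborel (min (ereal 0) (min (ereal a) (ereal b)))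
          (max (ereal 0) (max (ereal a) (ereal b))) f"
        using interval_integrable_bounded[OF f M, of "min 0 (min a b)" "max 0 (max a b)"]
        by (simp add: min_def max_def split: if_splits)
    qed
    then show ?thesis by (simp add: F_def)
  qed
  define m where "m = period_mean P f"
  have mF: "m = F P / P" by (simp add: m_def period_mean_def F_def)
  \<comment> \<open>Over one period \<open>F\<close> grows by \<open>F P = m * P\<close>, exactly
    what the linear term removes.\<close>
  define D where "D x = F x - m * x" for x
  have D_per: "D (x + P) = D x" for x
  proof -
    have "F (x + P) - F P = (LBINT y=ereal (P + 1 * 0)..ereal (P + 1 * x). f y)"
      using F_diff[of P "x + P"] by (simp add: add.commute)
    also have "\<dots> = (LBINT y=ereal 0..ereal x. f (P + 1 * y)) "
      using interval_integral_affine[of 1 0 x f P] by simp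
    also have "\<dots> = F x"
      unfolding F_def using per by (simp add: add.commute)
    finally show ?thesis using P by (simp add: D_def mF algebra_simps add_divide_distrib)
  qed
  have D_nat: "D (x + real k * P) = D x" for x k
    by (induction k) (use D_per in \<open>auto simp: algebra_simps, metis add.assoc add.commute\<close>)
  have D_int: "D (x + of_int k * P) = D x" for x k
  proof (cases "0 \<le> k")
    case True then show ?thesis using D_nat[of x "nat k"] by simp
  next
    case False
    then show ?thesis using D_nat[of "x + of_int k * P" "nat (- k)"] by (simp add: algebra_simps)
  qed
  have M0: "0 \<le> M" using M[of 0] by linarith
  have D_bound: "\<bar>D x\<bar> \<le> 2 * M * P" for x
  proof -
    \<comment> \<open>Reduction to one period, where \<open>F\<close> and the linear term are each
      at most \<open>M * P\<close> in absolute value.\<close>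
    define y where "y = x + of_int (- \<lfloor>x / P\<rfloor>) * P"
    have "of_int \<lfloor>x / P\<rfloor> \<le> x / P" "x / P < of_int \<lfloor>x / P\<rfloor> + 1" by linarith+
    then have "of_int \<lfloor>x / P\<rfloor> * P \<le> x" "x < (of_int \<lfloor>x / P\<rfloor> + 1) * P"
      using P by (simp_all only: pos_le_divide_eq pos_divide_less_eq)
    then have y: "0 \<le> y" "y \<le> P"
      by (auto simp: y_def algebra_simps)
    have F: "\<bar>F z\<bar> \<le> M * z" if "0 \<le> z" for z
      using interval_integral_abs_le[OF f M that] by (simp add: F_def)
    have "\<bar>m\<bar> \<le> M" using F[of P] P by (simp add: mF field_simps)
    then have "\<bar>m * y\<bar> \<le> M * P" using y M0 by (simp add: abs_mult mult_mono)
    moreover have "\<bar>F y\<bar> \<le> M * P"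
      using F[OF y(1)] y M0 by (meson mult_left_mono order_trans)
    moreover have "D x = F y - m * y"
    proof -
      have "D y = D x" using D_int[of x "- \<lfloor>x / P\<rfloor>"] by (simp only: y_def)
      then show ?thesis by (simp only: D_def[of y, symmetric])
    qed
    ultimately show ?thesis by linarith
  qed
  \<comment> \<open>Each of the two values of \<open>D\<close> is at most \<open>2 * M * P\<close>
    in absolute value, which explains the witness \<open>4 * M * P\<close>.\<close>
  show ?thesis
  proof (intro exI[of _ "4 * M * P"] conjI allI impI)
    show "0 \<le> 4 * M * P" using M0 P by simp
    fix e r t :: real assume e: "0 < e"
    have "(LBINT x=ereal r..ereal t. f (x / e)) = e * (F (t / e) - F (r / e))"
      using interval_integral_affine[of "1 / e" r t f 0] e F_diff[of "r / e" "t / e"] by simp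
    moreover have "(LBINT x=ereal r..ereal t. period_mean P f) = m * (t - r)"
      unfolding m_def by (rule interval_integral_const)
    moreover have "m * (t - r) = e * (m * (t / e) - m * (r / e))"
      using e by (simp add: field_simps)
    ultimately have "(LBINT x=ereal r..ereal t. f (x / e)) - (LBINT x=ereal r..ereal t. period_mean P f)
        = e * (D (t / e) - D (r / e))"
      by (simp only: D_def right_diff_distrib)
    moreover have "\<bar>D (t / e) - D (r / e)\<bar> \<le> 4 * M * P"
      using D_bound[of "t / e"] D_bound[of "r / e"] by linarith
    ultimately show "\<bar>(LBINT x=ereal r..ereal t. f (x / e)) - (LBINT x=ereal r..ereal t. period_mean P f)\<bar>
        \<le> 4 * M * P * e"
      using e by (simp add: abs_mult mult.commute[of e])
  qed
qed

text \<open>Reducing the argument modulo the period through the floor function gives an explicit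
  formula for \<open>f\<close> on the whole line, from which measurability and boundedness are read
  off.\<close>

lemma two_step_periodic:
  fixes f :: "real \<Rightarrow> real"
  assumes P: "0 < P" and p: "0 < p" "p < P"
    and pos: "\<And>t. 0 < t \<Longrightarrow> t \<le> p \<Longrightarrow> f t = A" and neg: "\<And>t. p - P < t \<Longrightarrow> t \<le> 0 \<Longrightarrow> f t = B"
    and per: "\<And>t. f (t + P) = f t"
  shows "f \<in> borel_measurable borel" "\<bar>f x\<bar> \<le> \<bar>A\<bar> + \<bar>B\<bar>"
proof -
  have per_nat: "f (x + real k * P) = f x" for x k
    by (induction k) (use per in \<open>auto simp: algebra_simps, metis add.assoc add.commute\<close>)
  have per_int: "f (x + of_int k * P) = f x" for x k
  proof (cases "0 \<le> k")
    case True then show ?thesis using per_nat[of x "nat k"] by simp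
  next
    case False
    then show ?thesis using per_nat[of "x + of_int k * P" "nat (- k)"] by (simp add: algebra_simps)
  qed
  \<comment> \<open>The representative lies in the half-open interval from 0 to \<open>P\<close>,
    whereas the two pieces are described on an interval ending at \<open>p\<close>. The value 0 thus
    takes the second constant, and arguments above \<open>p\<close> are moved back by one
    period.\<close>
  define y where "y x = x - of_int \<lfloor>x / P\<rfloor> * P" for x
  have f_eq: "f x = (if 0 < y x \<and> y x \<le> p then A else B)" for x
  proof -
    have "of_int \<lfloor>x / P\<rfloor> \<le> x / P" "x / P < of_int \<lfloor>x / P\<rfloor> + 1" by linarith+
    then have "of_int \<lfloor>x / P\<rfloor> * P \<le> x" "x < (of_int \<lfloor>x / P\<rfloor> + 1) * P"
      using P by (simp_all only: pos_le_divide_eq pos_divide_less_eq)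
    then have yx: "0 \<le> y x" "y x < P"
      by (auto simp: y_def algebra_simps)
    have fy: "f x = f (y x)"
      using per_int[of x "- \<lfloor>x / P\<rfloor>"] by (simp add: y_def)
    consider "y x = 0" | "0 < y x" "y x \<le> p" | "p < y x" using yx by linarith
    then show ?thesis
    proof cases
      case 1 then show ?thesis using neg[of 0] p by (simp add: fy)
    next
      case 2 then show ?thesis using pos by (simp add: fy)
    next
      case 3
      then have "f (y x - P) = B" using yx by (intro neg) auto
      then show ?thesis using 3 per[of "y x - P"] by (simp add: fy)
    qed
  qed
  have [measurable]: "y \<in> borel_measurable borel"
    unfolding y_def[abs_def] by measurable
  show "f \<in> borel_measurable borel"
    unfolding f_eq[abs_def] by measurable
  show "\<bar>f x\<bar> \<le> \<bar>A\<bar> + \<bar>B\<bar>"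
    unfolding f_eq by auto
qed

text \<open>The supremum of \<open>exp (- 2 L t) y t\<close> absorbs half of itself.\<close>

lemma gronwall:
  fixes y :: "real \<Rightarrow> real"
  assumes y: "continuous_on {0..T} y" and L: "0 < L" and A: "0 \<le> A" and T: "0 \<le> T"
    and le: "\<And>t. t \<in> {0..T} \<Longrightarrow> y t \<le> A + L * integral {0..t} y"
    and t: "t \<in> {0..T}"
  shows "y t \<le> 2 * A * exp (2 * L * T)"
proof -
  define z where "z t = exp (- 2 * L * t) * y t" for t
  have "continuous_on {0..T} z"
    unfolding z_def[abs_def] by (intro continuous_intros y)
  then obtain u where u: "u \<in> {0..T}" "\<And>t. t \<in> {0..T} \<Longrightarrow> z t \<le> z u"
    using continuous_attains_sup[of "{0..T}" z] T by auto
  have y_le: "y t \<le> z u * exp (2 * L * t)" if "t \<in> {0..T}" for t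
  proof -
    have "y t = z t * exp (2 * L * t)" by (simp add: z_def exp_minus field_simps)
    then show ?thesis using u(2)[OF that] by simp
  qed
  have "z u \<le> 2 * A"
  proof (cases "0 \<le> z u")
    case True
    have I: "((\<lambda>t. z u * exp (2 * L * t)) has_integral z u * (exp (2 * L * u) / (2 * L)) - z u * (exp (2 * L * 0) / (2 * L))) {0..u}"
    proof (rule fundamental_theorem_of_calculus)
      show "0 \<le> u" using u by simp
      show "((\<lambda>t. z u * (exp (2 * L * t) / (2 * L))) has_vector_derivative z u * exp (2 * L * x)) (at x within {0..u})" for x
        unfolding has_real_derivative_iff_has_vector_derivative[symmetric]
        using L by (auto intro!: derivative_eq_intros)
    qed
    have yi: "y integrable_on {0..u}"
      using u by (intro integrable_continuous_interval continuous_on_subset[OF y]) auto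
    have "integral {0..u} y \<le> integral {0..u} (\<lambda>t. z u * exp (2 * L * t))"
      using u I by (intro integral_le yi y_le) auto
    also have "\<dots> \<le> z u * (exp (2 * L * u) / (2 * L))"
      unfolding integral_unique[OF I] using L True by simp
    finally have "L * integral {0..u} y \<le> L * (z u * (exp (2 * L * u) / (2 * L)))"
      using L by (intro mult_left_mono) auto
    then have "y u \<le> A + z u * exp (2 * L * u) / 2"
      using le[OF u(1)] L by simp
    then have "exp (- 2 * L * u) * y u \<le> exp (- 2 * L * u) * (A + z u * exp (2 * L * u) / 2)"
      by (intro mult_left_mono) auto
    also have "\<dots> = exp (- 2 * L * u) * A + z u / 2"
      by (simp add: exp_minus field_simps)
    also have "\<dots> \<le> A + z u / 2"
      using A L u by (auto intro!: mult_left_le_one_le)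
    finally show ?thesis by (simp add: z_def)
  qed (use A in linarith)
  then have "z u * exp (2 * L * t) \<le> 2 * A * exp (2 * L * T)"
    using t A L by (intro mult_mono) auto
  with y_le[OF t] show ?thesis by linarith
qed

text \<open>The integral inequality is available only while \<open>y\<close> has stayed at most 1.
  Up to the first time at which \<open>y\<close> reaches 1 it does hold, so Gronwall bounds
  \<open>y\<close> there by a number smaller than 1, a contradiction; the restriction is therefore
  never active.\<close>

lemma gronwall_bootstrap:
  fixes y :: "real \<Rightarrow> real"
  assumes y: "continuous_on {0..T} y" and L: "0 < L" and A: "0 \<le> A" and small: "2 * A * exp (2 * L * T) < 1"
    and le: "\<And>t. t \<in> {0..T} \<Longrightarrow> (\<And>r. r \<in> {0..t} \<Longrightarrow> y r \<le> 1) \<Longrightarrow> y t \<le> A + L * integral {0..t} y"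
    and y0: "y 0 \<le> A" and t: "t \<in> {0..T}"
  shows "y t \<le> 2 * A * exp (2 * L * T)"
proof -
  have T: "0 \<le> T" using t by simp
  have e1: "1 \<le> exp (2 * L * T)" using L T by simp
  have "y 0 < 1"
  proof -
    have "A \<le> 2 * A * exp (2 * L * T)"
      using mult_left_mono[OF e1, of "2 * A"] A by linarith
    then show ?thesis using y0 small by linarith
  qed
  have le1: "y r \<le> 1" if "r \<in> {0..T}" for r
  proof (rule ccontr)
    assume "\<not> y r \<le> 1"
    \<comment> \<open>The preimage is closed by continuity, so its infimum is attained and is the
      first time at which \<open>y\<close> reaches 1.\<close>
    define S where "S = {0..T} \<inter> y -` {1..}"
    have "closed S"
      unfolding S_def by (rule continuous_closed_preimage[OF y]) auto
    moreover have "S \<noteq> {}" "bdd_below S"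
      using \<open>\<not> y r \<le> 1\<close> that by (auto simp: S_def)
    ultimately have Inf: "Inf S \<in> S" by (intro closed_contains_Inf)
    define q where "q = Inf S"
    have q: "q \<in> {0..T}" "1 \<le> y q" using Inf by (auto simp: S_def q_def)
    have less: "y x < 1" if "x \<in> {0..<q}" for x
    proof (rule ccontr)
      assume "\<not> y x < 1"
      then have "x \<in> S" using that q by (auto simp: S_def)
      then have "q \<le> x" unfolding q_def using \<open>bdd_below S\<close> by (rule cInf_lower)
      then show False using that by simp
    qed
    have "0 < q" using q \<open>y 0 < 1\<close> by (cases "q = 0") auto
    \<comment> \<open>At \<open>q\<close> itself the bound comes from continuity; it is needed
      because the hypothesis \<open>le\<close> speaks about the closed interval.\<close>
    have le1q: "y x \<le> 1" if "x \<in> {0..q}" for x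
    proof (cases "x = q")
      case False then show ?thesis using less[of x] that by simp
    next
      case True
      have "continuous_on {0..q} y" using y q by (auto intro: continuous_on_subset)
      moreover have "closure {0..<q} = {0..q}" using \<open>0 < q\<close> by simp
      ultimately have "\<forall>x\<in>{0..q}. y x \<le> 1"
        using continuous_le_on_closure[of "{0..<q}" y _ 1] less by (metis atLeastLessThan_iff less_imp_le)
      then show ?thesis using that by blast
    qed
    have "y q \<le> 2 * A * exp (2 * L * q)"
    proof (rule gronwall[where y=y and T=q and t=q, OF _ L A])
      show "continuous_on {0..q} y" using y q by (auto intro: continuous_on_subset)
      show "y t \<le> A + L * integral {0..t} y" if "t \<in> {0..q}" for t
        using that q by (intro le le1q) auto
    qed (use \<open>0 < q\<close> in auto)
    also have "\<dots> \<le> 2 * A * exp (2 * L * T)"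
      using q L A by (intro mult_left_mono) auto
    finally show False using q small by linarith
  qed
  show ?thesis
    by (rule gronwall[where y=y and T=T and t=t, OF y L A T _ t]) (rule le, auto intro: le1)
qed


subsection \<open>Propagators and integrals in Sobolev spaces\<close>

text \<open>The symbol of \<open>propagator\<close>, with the two time integrals of the coefficients
  replaced by numbers. It isolates the only way in which the coefficients enter.\<close>

definition dispersion :: "real \<Rightarrow> real \<Rightarrow> 'a::euclidean_space \<Rightarrow> complex" where
  "dispersion A B \<xi> = exp (- \<i> * complex_of_real ((norm \<xi>)\<^sup>2 * A) + \<i> * complex_of_real ((norm \<xi>) ^ 4 * B))"

lemma dispersion_eq_cis: "dispersion A B \<xi> = cis ((norm \<xi>) ^ 4 * B - (norm \<xi>)\<^sup>2 * A)"
  by (simp add: dispersion_def cis_conv_exp algebra_simps)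

lemma norm_dispersion [simp]: "cmod (dispersion A B \<xi>) = 1"
  by (simp add: dispersion_eq_cis)

lemma borel_measurable_dispersion [measurable]: "dispersion A B \<in> borel_measurable borel"
  unfolding dispersion_eq_cis[abs_def] by measurable

lemma propagator_eq:
  "propagator a b t r f = inverse_fourier (\<lambda>\<xi>.
    dispersion (LBINT \<tau>=ereal r..ereal t. a \<tau>) (LBINT \<tau>=ereal r..ereal t. b \<tau>) \<xi> * fourier f \<xi>)"
  by (simp add: propagator_def dispersion_def)

lemma cmod_cis_diff_le: "cmod (cis x - cis y) \<le> \<bar>x - y\<bar>"
proof -
  have "cis x - cis y = cis y * (cis (x - y) - 1)"
    by (simp add: right_diff_distrib cis_mult)
  then have "cmod (cis x - cis y) = cmod (cis (x - y) - 1)"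
    by (simp add: norm_mult)
  also have "\<dots> \<le> \<bar>x - y\<bar>"
    using iexp_approx1[of "x - y" 0] by (simp add: cis_conv_exp)
  finally show ?thesis .
qed

text \<open>2 is the trivial bound for two points of the unit circle and takes over at high
  frequencies; a single \<delta> covers the errors of both time integrals.\<close>

definition phase_bound :: "real \<Rightarrow> 'a::euclidean_space \<Rightarrow> real" where
  "phase_bound \<delta> \<xi> = min 2 (\<delta> * ((norm \<xi>)\<^sup>2 + (norm \<xi>) ^ 4))"

lemma borel_measurable_phase_bound [measurable]: "phase_bound \<delta> \<in> borel_measurable borel"
  unfolding phase_bound_def[abs_def] by measurable

lemma phase_bound_range: "0 \<le> \<delta> \<Longrightarrow> 0 \<le> phase_bound \<delta> \<xi>" "phase_bound \<delta> \<xi> \<le> 2"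
  by (simp_all add: phase_bound_def)

lemma dispersion_diff_le:
  assumes "\<bar>A - A'\<bar> \<le> \<delta>" "\<bar>B - B'\<bar> \<le> \<delta>"
  shows "cmod (dispersion A B \<xi> - dispersion A' B' \<xi>) \<le> phase_bound \<delta> \<xi>"
  unfolding phase_bound_def
proof (rule min.boundedI)
  show "cmod (dispersion A B \<xi> - dispersion A' B' \<xi>) \<le> 2"
    using norm_triangle_ineq4[of "dispersion A B \<xi>" "dispersion A' B' \<xi>"] by simp
  have "cmod (dispersion A B \<xi> - dispersion A' B' \<xi>)
      \<le> \<bar>(norm \<xi> ^ 4 * B - (norm \<xi>)\<^sup>2 * A) - (norm \<xi> ^ 4 * B' - (norm \<xi>)\<^sup>2 * A')\<bar>"
    unfolding dispersion_eq_cis by (rule cmod_cis_diff_le)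
  also have "\<dots> = \<bar>norm \<xi> ^ 4 * (B - B') - (norm \<xi>)\<^sup>2 * (A - A')\<bar>"
    by (simp add: algebra_simps)
  also have "\<dots> \<le> norm \<xi> ^ 4 * \<bar>B - B'\<bar> + (norm \<xi>)\<^sup>2 * \<bar>A - A'\<bar>"
    using abs_triangle_ineq4[of "norm \<xi> ^ 4 * (B - B')" "(norm \<xi>)\<^sup>2 * (A - A')"] by (simp add: abs_mult)
  also have "\<dots> \<le> norm \<xi> ^ 4 * \<delta> + (norm \<xi>)\<^sup>2 * \<delta>"
    using assms by (intro add_mono mult_left_mono) auto
  finally show "cmod (dispersion A B \<xi> - dispersion A' B' \<xi>) \<le> \<delta> * ((norm \<xi>)\<^sup>2 + norm \<xi> ^ 4)"
    by (simp add: algebra_simps)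
qed

lemma sobolev_norm_diff_AE:
  assumes f: "f \<in> sobolev s" and g: "g \<in> sobolev s"
    and F: "F \<in> borel_measurable borel" "AE \<xi> in lborel. fourier f \<xi> = F \<xi>"
    and G: "G \<in> borel_measurable borel" "AE \<xi> in lborel. fourier g \<xi> = G \<xi>"
  shows "sobolev_norm s (\<lambda>x. f x - g x) = L2norm (weighted s (\<lambda>\<xi>. F \<xi> - G \<xi>))"
proof (rule sobolev_norm_AE_eq)
  show "square_integrable (\<lambda>x. f x - g x)"
    by (intro square_integrable_diff sobolev_square_integrable(1)[OF f] sobolev_square_integrable(1)[OF g])
  show "(\<lambda>\<xi>. F \<xi> - G \<xi>) \<in> borel_measurable borel"
    using F(1) G(1) by measurable
  show "AE \<xi> in lborel. fourier (\<lambda>x. f x - g x) \<xi> = F \<xi> - G \<xi>"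
    using fourier_diff[OF sobolev_square_integrable(1)[OF f] sobolev_square_integrable(1)[OF g]] F(2) G(2)
    by eventually_elim simp
qed

lemma propagator_sobolev:
  assumes f: "f \<in> sobolev s"
  shows "propagator a b t r f \<in> sobolev s"
    and "AE \<xi> in lborel. fourier (propagator a b t r f) \<xi>
      = dispersion (LBINT \<tau>=ereal r..ereal t. a \<tau>) (LBINT \<tau>=ereal r..ereal t. b \<tau>) \<xi> * fourier f \<xi>"
  unfolding propagator_eq by (rule sobolev_multiplier[OF f]; simp)+

lemma propagator_diff_le:
  assumes f: "f \<in> sobolev s" and g: "g \<in> sobolev s"
  shows "sobolev_norm s (\<lambda>x. propagator a b t r f x - propagator a b t r g x) \<le> sobolev_norm s (\<lambda>x. f x - g x)"
proof -
  let ?m = "dispersion (LBINT \<tau>=ereal r..ereal t. a \<tau>) (LBINT \<tau>=ereal r..ereal t. b \<tau>)"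
  have [measurable]: "fourier f \<in> borel_measurable borel" "fourier g \<in> borel_measurable borel"
    using f g by (auto intro: square_integrable_measurable sobolev_square_integrable)
  have "sobolev_norm s (\<lambda>x. propagator a b t r f x - propagator a b t r g x)
      = L2norm (weighted s (\<lambda>\<xi>. ?m \<xi> * fourier f \<xi> - ?m \<xi> * fourier g \<xi>))"
    by (rule sobolev_norm_diff_AE[OF propagator_sobolev(1)[OF f] propagator_sobolev(1)[OF g]
          _ propagator_sobolev(2)[OF f] _ propagator_sobolev(2)[OF g]]) measurable
  also have "\<dots> = L2norm (weighted s (\<lambda>\<xi>. fourier f \<xi> - fourier g \<xi>))"
    unfolding L2norm_def right_diff_distrib[symmetric] by (simp add: norm_mult)
  also have "\<dots> = sobolev_norm s (\<lambda>x. f x - g x)"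
    by (rule sobolev_norm_diff_eq[OF f g, symmetric])
  finally show ?thesis by simp
qed

text \<open>An upper bound for the distance of two propagators on \<open>f\<close> whenever both
  time integrals agree up to \<delta>; it mentions neither the coefficients nor the two
  times.\<close>

definition dispersion_defect :: "real \<Rightarrow> real \<Rightarrow> ('a::euclidean_space \<Rightarrow> complex) \<Rightarrow> real" where
  "dispersion_defect s \<delta> f = L2norm (weighted s (\<lambda>\<xi>. complex_of_real (phase_bound \<delta> \<xi>) * fourier f \<xi>))"

lemma square_integrable_phase_bound:
  assumes F: "F \<in> borel_measurable borel" "square_integrable (weighted s F)" and "0 \<le> \<delta>"
  shows "square_integrable (weighted s (\<lambda>\<xi>. complex_of_real (phase_bound \<delta> \<xi>) * F \<xi>))"
    and "L2norm (weighted s (\<lambda>\<xi>. complex_of_real (phase_bound \<delta> \<xi>) * F \<xi>)) \<le> 2 * L2norm (weighted s F)"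
proof -
  have [measurable]: "F \<in> borel_measurable borel" by fact
  have sq: "square_integrable (\<lambda>\<xi>. 2 * weighted s F \<xi>)"
    by (rule square_integrable_cmult[OF F(2)])
  have le: "cmod (weighted s (\<lambda>\<xi>. complex_of_real (phase_bound \<delta> \<xi>) * F \<xi>) \<xi>) \<le> cmod (2 * weighted s F \<xi>)" for \<xi>
  proof -
    have "\<bar>phase_bound \<delta> \<xi>\<bar> * (\<bar>sobolev_weight s \<xi>\<bar> * cmod (F \<xi>)) \<le> 2 * (\<bar>sobolev_weight s \<xi>\<bar> * cmod (F \<xi>))"
      using phase_bound_range(1)[OF \<open>0 \<le> \<delta>\<close>, of \<xi>] phase_bound_range(2)[of \<delta> \<xi>] by (intro mult_right_mono) auto
    then show ?thesis by (simp add: norm_mult mult_ac)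
  qed
  have m: "weighted s (\<lambda>\<xi>. complex_of_real (phase_bound \<delta> \<xi>) * F \<xi>) \<in> borel_measurable borel"
    by measurable
  from square_integrable_bound[OF sq m le]
  show "square_integrable (weighted s (\<lambda>\<xi>. complex_of_real (phase_bound \<delta> \<xi>) * F \<xi>))"
    "L2norm (weighted s (\<lambda>\<xi>. complex_of_real (phase_bound \<delta> \<xi>) * F \<xi>)) \<le> 2 * L2norm (weighted s F)"
    by (simp_all only: L2norm_cmult norm_numeral)
qed

lemma propagator_defect:
  assumes f: "f \<in> sobolev s"
    and A: "\<bar>(LBINT \<tau>=ereal r..ereal t. a \<tau>) - (LBINT \<tau>=ereal r..ereal t. a' \<tau>)\<bar> \<le> \<delta>"
    and B: "\<bar>(LBINT \<tau>=ereal r..ereal t. b \<tau>) - (LBINT \<tau>=ereal r..ereal t. b' \<tau>)\<bar> \<le> \<delta>"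
  shows "sobolev_norm s (\<lambda>x. propagator a b t r f x - propagator a' b' t r f x) \<le> dispersion_defect s \<delta> f"
proof -
  let ?m = "dispersion (LBINT \<tau>=ereal r..ereal t. a \<tau>) (LBINT \<tau>=ereal r..ereal t. b \<tau>)"
  let ?n = "dispersion (LBINT \<tau>=ereal r..ereal t. a' \<tau>) (LBINT \<tau>=ereal r..ereal t. b' \<tau>)"
  note F = sobolev_square_integrable[OF f]
  have [measurable]: "fourier f \<in> borel_measurable borel"
    using F(2) by (rule square_integrable_measurable)
  have \<delta>: "0 \<le> \<delta>" using A by linarith
  have "sobolev_norm s (\<lambda>x. propagator a b t r f x - propagator a' b' t r f x)
      = L2norm (weighted s (\<lambda>\<xi>. ?m \<xi> * fourier f \<xi> - ?n \<xi> * fourier f \<xi>))"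
    by (rule sobolev_norm_diff_AE[OF propagator_sobolev(1)[OF f] propagator_sobolev(1)[OF f]
          _ propagator_sobolev(2)[OF f] _ propagator_sobolev(2)[OF f]]) measurable
  also have "\<dots> \<le> dispersion_defect s \<delta> f"
    unfolding dispersion_defect_def
  proof (rule square_integrable_bound(2)[OF square_integrable_phase_bound(1)[OF _ F(3) \<delta>]])
    fix \<xi>
    have "cmod (?m \<xi> * fourier f \<xi> - ?n \<xi> * fourier f \<xi>) = cmod (?m \<xi> - ?n \<xi>) * cmod (fourier f \<xi>)"
      by (simp only: left_diff_distrib[symmetric] norm_mult)
    also have "\<dots> \<le> \<bar>phase_bound \<delta> \<xi>\<bar> * cmod (fourier f \<xi>)"
      by (intro mult_right_mono order_trans[OF dispersion_diff_le[OF A B] abs_ge_self]) simp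
    finally have "\<bar>sobolev_weight s \<xi>\<bar> * cmod (?m \<xi> * fourier f \<xi> - ?n \<xi> * fourier f \<xi>)
        \<le> \<bar>sobolev_weight s \<xi>\<bar> * (\<bar>phase_bound \<delta> \<xi>\<bar> * cmod (fourier f \<xi>))"
      by (intro mult_left_mono) auto
    then show "cmod (weighted s (\<lambda>\<xi>. ?m \<xi> * fourier f \<xi> - ?n \<xi> * fourier f \<xi>) \<xi>)
        \<le> cmod (weighted s (\<lambda>\<xi>. complex_of_real (phase_bound \<delta> \<xi>) * fourier f \<xi>) \<xi>)"
      by (simp only: norm_mult norm_of_real)
  qed measurable
  finally show ?thesis .
qed

lemma dispersion_defect_mono:
  assumes f: "f \<in> sobolev s" and "0 \<le> \<delta>" "\<delta> \<le> \<delta>'"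
  shows "dispersion_defect s \<delta> f \<le> dispersion_defect s \<delta>' f"
  unfolding dispersion_defect_def
proof (rule square_integrable_bound(2))
  have [measurable]: "fourier f \<in> borel_measurable borel"
    using sobolev_square_integrable(2)[OF f] by (rule square_integrable_measurable)
  show "square_integrable (weighted s (\<lambda>\<xi>. complex_of_real (phase_bound \<delta>' \<xi>) * fourier f \<xi>))"
    using assms by (intro square_integrable_phase_bound sobolev_square_integrable) auto
  show "weighted s (\<lambda>\<xi>. complex_of_real (phase_bound \<delta> \<xi>) * fourier f \<xi>) \<in> borel_measurable borel"
    by measurable
  fix \<xi> :: 'a
  have "phase_bound \<delta> \<xi> \<le> phase_bound \<delta>' \<xi>"
    unfolding phase_bound_def by (intro min.mono order_refl mult_right_mono assms) auto
  then have "\<bar>phase_bound \<delta> \<xi>\<bar> \<le> \<bar>phase_bound \<delta>' \<xi>\<bar>"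
    using phase_bound_range(1)[of \<delta> \<xi>] assms by simp
  then show "cmod (weighted s (\<lambda>\<xi>. complex_of_real (phase_bound \<delta> \<xi>) * fourier f \<xi>) \<xi>)
      \<le> cmod (weighted s (\<lambda>\<xi>. complex_of_real (phase_bound \<delta>' \<xi>) * fourier f \<xi>) \<xi>)"
    by (simp only: norm_mult norm_of_real) (intro mult_left_mono mult_right_mono, auto)
qed

lemma dispersion_defect_nonneg [simp]: "0 \<le> dispersion_defect s \<delta> f"
  by (simp add: dispersion_defect_def)

text \<open>For a fixed function the factor \<open>phase_bound\<close> tends to 0 at every frequency
  and stays below 2, so dominated convergence applies. No rate results, as \<open>f\<close> has only
  s derivatives.\<close>

lemma dispersion_defect_small:
  fixes f :: "'a::euclidean_space \<Rightarrow> complex"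
  assumes f: "f \<in> sobolev s" and "0 < e"
  obtains \<delta> where "0 < \<delta>" "dispersion_defect s \<delta> f < e"
proof -
  note F = sobolev_square_integrable[OF f]
  have [measurable]: "fourier f \<in> borel_measurable borel"
    using F(2) by (rule square_integrable_measurable)
  define G where "G k \<xi> = weighted s (\<lambda>\<xi>. complex_of_real (phase_bound (1 / real (Suc k)) \<xi>) * fourier f \<xi>) \<xi>" for k \<xi>
  define H where "H \<xi> = 2 * weighted s (fourier f) \<xi>" for \<xi>
  have [measurable]: "G k \<in> borel_measurable borel" "H \<in> borel_measurable borel" for k
    unfolding G_def[abs_def] H_def[abs_def] by measurable
  \<comment> \<open>\<open>L2_dominated_convergence\<close> is phrased for functions converging to
    their own majorant; subtracting \<open>G k\<close> from the majorant \<open>H\<close> brings the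
    null sequence \<open>G k\<close> into this form.\<close>
  have "(\<lambda>k. L2norm (\<lambda>\<xi>. (H \<xi> - G k \<xi>) - H \<xi>)) \<longlonglongrightarrow> 0"
  proof (rule L2_dominated_convergence)
    show "square_integrable H"
      unfolding H_def[abs_def] by (rule square_integrable_cmult[OF F(3)])
    show "(\<lambda>\<xi>. H \<xi> - G k \<xi>) \<in> borel_measurable borel" for k by measurable
    show "cmod ((H \<xi> - G k \<xi>) - H \<xi>) \<le> cmod (H \<xi>)" for k \<xi>
    proof -
      have "\<bar>phase_bound (1 / real (Suc k)) \<xi>\<bar> * (\<bar>sobolev_weight s \<xi>\<bar> * cmod (fourier f \<xi>))
          \<le> 2 * (\<bar>sobolev_weight s \<xi>\<bar> * cmod (fourier f \<xi>))"
        using phase_bound_range[of "1 / real (Suc k)" \<xi>] by (intro mult_right_mono) auto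
      then show ?thesis by (simp add: G_def H_def norm_mult mult_ac del: of_nat_Suc)
    qed
    show "(\<lambda>k. H \<xi> - G k \<xi>) \<longlonglongrightarrow> H \<xi>" for \<xi>
    proof -
      have "(\<lambda>k. phase_bound (1 / real (Suc k)) \<xi>) \<longlonglongrightarrow> min 2 (0 * ((norm \<xi>)\<^sup>2 + norm \<xi> ^ 4))"
        unfolding phase_bound_def
        using LIMSEQ_inverse_real_of_nat by (intro tendsto_intros) (simp add: inverse_eq_divide)
      then have "(\<lambda>k. phase_bound (1 / real (Suc k)) \<xi>) \<longlonglongrightarrow> 0" by simp
      then have "(\<lambda>k. complex_of_real (phase_bound (1 / real (Suc k)) \<xi>)) \<longlonglongrightarrow> 0"
        using tendsto_of_real[of _ 0] by fastforce
      then have "(\<lambda>k. H \<xi> - complex_of_real (sobolev_weight s \<xi>) *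
          (complex_of_real (phase_bound (1 / real (Suc k)) \<xi>) * fourier f \<xi>))
          \<longlonglongrightarrow> H \<xi> - complex_of_real (sobolev_weight s \<xi>) * (0 * fourier f \<xi>)"
        by (intro tendsto_intros)
      then show ?thesis by (simp add: G_def del: of_nat_Suc)
    qed
  qed
  then have "(\<lambda>k. L2norm (\<lambda>\<xi>. - G k \<xi>)) \<longlonglongrightarrow> 0" by simp
  then have "(\<lambda>k. dispersion_defect s (1 / real (Suc k)) f) \<longlonglongrightarrow> 0"
    unfolding L2norm_minus by (simp only: dispersion_defect_def G_def[abs_def])
  from order_tendstoD(2)[OF this \<open>0 < e\<close>] obtain k where "dispersion_defect s (1 / real (Suc k)) f < e"
    by (auto simp: eventually_sequentially)
  then show thesis by (intro that[of "1 / real (Suc k)"]) simp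
qed

text \<open>The defect is Lipschitz in the function with constant 2, because
  \<open>phase_bound\<close> never exceeds 2; what matters is that the constant does not depend on
  \<delta>.\<close>

lemma dispersion_defect_perturb:
  assumes f: "f \<in> sobolev s" and g: "g \<in> sobolev s" and \<delta>: "0 \<le> \<delta>"
  shows "dispersion_defect s \<delta> f \<le> dispersion_defect s \<delta> g + 2 * sobolev_norm s (\<lambda>x. f x - g x)"
proof -
  note F = sobolev_square_integrable[OF f] and G = sobolev_square_integrable[OF g]
  note Fm [measurable] = square_integrable_measurable[OF F(2)] square_integrable_measurable[OF G(2)]
  have sq: "square_integrable (weighted s (\<lambda>\<xi>. fourier f \<xi> - fourier g \<xi>))"
    unfolding right_diff_distrib by (rule square_integrable_diff[OF F(3) G(3)])
  have m: "(\<lambda>\<xi>. fourier f \<xi> - fourier g \<xi>) \<in> borel_measurable borel" by measurable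
  note d = square_integrable_phase_bound[OF m sq \<delta>]
  have "dispersion_defect s \<delta> f
      = L2norm (\<lambda>\<xi>. weighted s (\<lambda>\<xi>. complex_of_real (phase_bound \<delta> \<xi>) * fourier g \<xi>) \<xi>
          + weighted s (\<lambda>\<xi>. complex_of_real (phase_bound \<delta> \<xi>) * (fourier f \<xi> - fourier g \<xi>)) \<xi>)"
    unfolding dispersion_defect_def by (rule arg_cong[where f=L2norm]) (simp add: algebra_simps)
  also have "\<dots> \<le> dispersion_defect s \<delta> g
      + L2norm (weighted s (\<lambda>\<xi>. complex_of_real (phase_bound \<delta> \<xi>) * (fourier f \<xi> - fourier g \<xi>)))"
    unfolding dispersion_defect_def
    by (rule L2norm_triangle[OF square_integrable_phase_bound(1)[OF Fm(2) G(3) \<delta>] d(1)])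
  also have "\<dots> \<le> dispersion_defect s \<delta> g + 2 * sobolev_norm s (\<lambda>x. f x - g x)"
    unfolding sobolev_norm_diff_eq[OF f g] by (intro add_left_mono d(2))
  finally show ?thesis .
qed

text \<open>A \<delta> found at one time remains good on a neighbourhood, by continuity in time and
  \<open>dispersion_defect_perturb\<close>. Finitely many neighbourhoods cover \<open>K\<close>, and
  by monotonicity the least of the corresponding values serves all of them.\<close>

lemma dispersion_defect_uniformly_small:
  fixes h :: "real \<Rightarrow> 'a::euclidean_space \<Rightarrow> complex"
  assumes h: "\<And>t. h t \<in> sobolev s"
    and cont: "\<And>t. ((\<lambda>r. sobolev_norm s (\<lambda>x. h r x - h t x)) \<longlongrightarrow> 0) (at t)"
    and K: "compact K" and e: "0 < e"
  obtains \<delta> where "0 < \<delta>" "\<And>t. t \<in> K \<Longrightarrow> dispersion_defect s \<delta> (h t) \<le> e"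
proof -
  have "\<exists>\<delta> U. 0 < \<delta> \<and> open U \<and> t \<in> U \<and> (\<forall>r\<in>U. dispersion_defect s \<delta> (h r) \<le> e)" for t
  proof -
    \<comment> \<open>Half of e is spent at t itself; the other half is twice the distance
      \<open>e / 4\<close> allowed within the neighbourhood.\<close>
    obtain \<delta> where \<delta>: "0 < \<delta>" "dispersion_defect s \<delta> (h t) < e / 2"
      using dispersion_defect_small[OF h, of "e / 2"] e by auto
    have "\<forall>\<^sub>F r in at t. sobolev_norm s (\<lambda>x. h r x - h t x) < e / 4"
      using order_tendstoD(2)[OF cont[of t], of "e / 4"] e by simp
    then obtain U where U: "open U" "t \<in> U" "\<And>r. r \<in> U \<Longrightarrow> r \<noteq> t \<Longrightarrow> sobolev_norm s (\<lambda>x. h r x - h t x) < e / 4"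
      by (auto simp: eventually_at_topological)
    have "dispersion_defect s \<delta> (h r) \<le> e" if "r \<in> U" for r
    proof (cases "r = t")
      case False
      show ?thesis
        using dispersion_defect_perturb[OF h h less_imp_le[OF \<delta>(1)], of r t] \<delta>(2) U(3)[OF that False] by linarith
    qed (use \<delta> e in simp)
    with \<delta>(1) U show ?thesis by blast
  qed
  then obtain \<delta> U where U: "\<And>t. 0 < \<delta> t" "\<And>t. open (U t)" "\<And>t. t \<in> U t"
    "\<And>t r. r \<in> U t \<Longrightarrow> dispersion_defect s (\<delta> t) (h r) \<le> e"
    by metis
  obtain T where T: "T \<subseteq> K" "finite T" "K \<subseteq> (\<Union>t\<in>T. U t)"
    using compactE_image[OF K, of K U] U(2,3) by blast
  \<comment> \<open>Inserting 1 keeps the minimum meaningful when the subcover is empty.\<close>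
  define d where "d = Min (insert 1 (\<delta> ` T))"
  have d: "0 < d" "\<And>t. t \<in> T \<Longrightarrow> d \<le> \<delta> t"
    using T(2) U(1) by (auto simp: d_def)
  show thesis
  proof (rule that[OF d(1)])
    fix r assume "r \<in> K"
    then obtain t where "t \<in> T" "r \<in> U t" using T(3) by auto
    then show "dispersion_defect s d (h r) \<le> e"
      using U(4)[of r t] dispersion_defect_mono[OF h[of r] less_imp_le[OF d(1)] d(2)] by fastforce
  qed
qed

text \<open>The triangle inequality for integrals, obtained from Riemann sums over the same tagged
  division: the sums of \<open>G\<close> and \<open>G'\<close> differ by at most the Riemann sum of
  \<open>g\<close>, and all three converge along the division filter. The filter is nontrivial, so
  the bound survives the limit.\<close>

lemma has_sobolev_integral_diff_le:
  fixes G :: "real \<Rightarrow> 'a::euclidean_space \<Rightarrow> complex"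
  assumes G: "has_sobolev_integral s G J a b" and G': "has_sobolev_integral s G' J' a b"
    and g: "g integrable_on {a..b}"
    and le: "\<And>t. t \<in> {a..b} \<Longrightarrow> sobolev_norm s (\<lambda>x. G t x - G' t x) \<le> g t"
  shows "sobolev_norm s (\<lambda>x. J x - J' x) \<le> integral {a..b} g"
proof -
  let ?F = "division_filter {a..b}"
  let ?S = "\<lambda>G p x. \<Sum>(\<tau>, k)\<in>p. measure lborel k *\<^sub>R (G \<tau> x :: complex)"
  have J: "J \<in> sobolev s" "\<And>t. t \<in> {a..b} \<Longrightarrow> G t \<in> sobolev s" "((\<lambda>p. sobolev_norm s (\<lambda>x. ?S G p x - J x)) \<longlongrightarrow> 0) ?F"
    and J': "J' \<in> sobolev s" "\<And>t. t \<in> {a..b} \<Longrightarrow> G' t \<in> sobolev s" "((\<lambda>p. sobolev_norm s (\<lambda>x. ?S G' p x - J' x)) \<longlongrightarrow> 0) ?F"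
    using G G' by (auto simp: has_sobolev_integral_def)
  have gint: "((\<lambda>p. \<Sum>(\<tau>, k)\<in>p. measure lborel k *\<^sub>R g \<tau>) \<longlongrightarrow> integral {a..b} g) ?F"
    using integrable_integral[OF g] has_integral_cbox[of g _ a b] by simp
  have nb: "?F \<noteq> bot"
    using division_filter_not_empty[of a b] by simp
  have lim: "((\<lambda>p. (\<Sum>(\<tau>, k)\<in>p. measure lborel k *\<^sub>R g \<tau>) + (sobolev_norm s (\<lambda>x. ?S G p x - J x)
      + sobolev_norm s (\<lambda>x. ?S G' p x - J' x))) \<longlongrightarrow> integral {a..b} g + (0 + 0)) ?F"
    by (intro tendsto_add gint J J')
  have "sobolev_norm s (\<lambda>x. J x - J' x) \<le> integral {a..b} g + (0 + 0)"
  proof (rule tendsto_lowerbound[OF lim _ nb])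
    show "\<forall>\<^sub>F p in ?F. sobolev_norm s (\<lambda>x. J x - J' x) \<le> (\<Sum>(\<tau>, k)\<in>p. measure lborel k *\<^sub>R g \<tau>)
        + (sobolev_norm s (\<lambda>x. ?S G p x - J x) + sobolev_norm s (\<lambda>x. ?S G' p x - J' x))"
      using eventually_division_filter_tagged_division[of "{a..b}"]
    proof eventually_elim
      fix p assume p: "p tagged_division_of {a..b}"
      then have fin: "finite p" and tag: "\<And>i. i \<in> p \<Longrightarrow> fst i \<in> {a..b}"
        by (auto dest: tag_in_interval)
      have S_eq: "?S H p = (\<lambda>x. \<Sum>i\<in>p. complex_of_real (measure lborel (snd i)) * H (fst i) x)" for H
        by (simp add: split_def scaleR_conv_of_real)
      have SG: "?S G p \<in> sobolev s"
        unfolding S_eq by (rule sobolev_sum[OF fin, THEN conjunct1]) (intro sobolev_cmult J tag)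
      have SG': "?S G' p \<in> sobolev s"
        unfolding S_eq by (rule sobolev_sum[OF fin, THEN conjunct1]) (intro sobolev_cmult J' tag)
      have S_diff: "(\<lambda>x. ?S G p x - ?S G' p x)
          = (\<lambda>x. \<Sum>i\<in>p. complex_of_real (measure lborel (snd i)) * (G (fst i) x - G' (fst i) x))"
        by (simp only: split_def scaleR_conv_of_real sum_subtractf right_diff_distrib)
      have "sobolev_norm s (\<lambda>x. ?S G p x - ?S G' p x)
          \<le> (\<Sum>i\<in>p. sobolev_norm s (\<lambda>x. complex_of_real (measure lborel (snd i)) * (G (fst i) x - G' (fst i) x)))"
        unfolding S_diff
        by (rule sobolev_sum[OF fin, THEN conjunct2]) (intro sobolev_cmult sobolev_diff J J' tag)
      also have "\<dots> \<le> (\<Sum>i\<in>p. measure lborel (snd i) * g (fst i))"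
      proof (rule sum_mono)
        fix i assume i: "i \<in> p"
        have "sobolev_norm s (\<lambda>x. complex_of_real (measure lborel (snd i)) * (G (fst i) x - G' (fst i) x))
            = cmod (complex_of_real (measure lborel (snd i))) * sobolev_norm s (\<lambda>x. G (fst i) x - G' (fst i) x)"
          by (intro sobolev_cmult sobolev_diff J J' tag i)
        also have "\<dots> \<le> measure lborel (snd i) * g (fst i)"
          using le[OF tag[OF i]] by (auto intro!: mult_left_mono)
        finally show "sobolev_norm s (\<lambda>x. complex_of_real (measure lborel (snd i)) * (G (fst i) x - G' (fst i) x))
            \<le> measure lborel (snd i) * g (fst i)" .
      qed
      also have "\<dots> = (\<Sum>(\<tau>, k)\<in>p. measure lborel k *\<^sub>R g \<tau>)" by (simp add: split_def)
      finally have 1: "sobolev_norm s (\<lambda>x. ?S G p x - ?S G' p x) \<le> (\<Sum>(\<tau>, k)\<in>p. measure lborel k *\<^sub>R g \<tau>)" .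
      have "sobolev_norm s (\<lambda>x. J x - J' x)
          \<le> sobolev_norm s (\<lambda>x. J x - ?S G p x) + sobolev_norm s (\<lambda>x. ?S G p x - J' x)"
        by (rule sobolev_norm_triangle3[OF J(1) SG J'(1)])
      also have "sobolev_norm s (\<lambda>x. ?S G p x - J' x)
          \<le> sobolev_norm s (\<lambda>x. ?S G p x - ?S G' p x) + sobolev_norm s (\<lambda>x. ?S G' p x - J' x)"
        by (rule sobolev_norm_triangle3[OF SG SG' J'(1)])
      also have "sobolev_norm s (\<lambda>x. J x - ?S G p x) = sobolev_norm s (\<lambda>x. ?S G p x - J x)"
        by (rule sobolev_norm_diff_commute[OF J(1) SG])
      finally show "sobolev_norm s (\<lambda>x. J x - J' x) \<le> (\<Sum>(\<tau>, k)\<in>p. measure lborel k *\<^sub>R g \<tau>)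
        + (sobolev_norm s (\<lambda>x. ?S G p x - J x) + sobolev_norm s (\<lambda>x. ?S G' p x - J' x))"
        using 1 by linarith
    qed
  qed
  then show ?thesis by simp
qed

text \<open>For reversed end points the definition integrates forwards to the negative of
  \<open>J\<close>; the sign does not affect the norm, so both directions of time share one
  estimate.\<close>

lemma has_oriented_sobolev_integral_diff_le:
  fixes G :: "real \<Rightarrow> 'a::euclidean_space \<Rightarrow> complex"
  assumes G: "has_oriented_sobolev_integral s G J a b" and G': "has_oriented_sobolev_integral s G' J' a b"
    and g: "g integrable_on {min a b..max a b}"
    and le: "\<And>t. t \<in> {min a b..max a b} \<Longrightarrow> sobolev_norm s (\<lambda>x. G t x - G' t x) \<le> g t"
  shows "J \<in> sobolev s" "J' \<in> sobolev s" "sobolev_norm s (\<lambda>x. J x - J' x) \<le> integral {min a b..max a b} g"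
proof -
  show J: "J \<in> sobolev s" and J': "J' \<in> sobolev s"
    using G G' sobolev_minus(1)[of "\<lambda>x. - J x" s] sobolev_minus(1)[of "\<lambda>x. - J' x" s]
    by (auto simp: has_oriented_sobolev_integral_def has_sobolev_integral_def split: if_splits)
  show "sobolev_norm s (\<lambda>x. J x - J' x) \<le> integral {min a b..max a b} g"
  proof (cases "a \<le> b")
    case True
    then show ?thesis
      using G G' g le by (intro has_sobolev_integral_diff_le) (auto simp: has_oriented_sobolev_integral_def min_def max_def)
  next
    case False
    then have "sobolev_norm s (\<lambda>x. - J x - - J' x) \<le> integral {min a b..max a b} g"
      using G G' g le by (intro has_sobolev_integral_diff_le[of s G _ _ _ G']) (auto simp: has_oriented_sobolev_integral_def min_def max_def)
    moreover have "sobolev_norm s (\<lambda>x. - J x - - J' x) = sobolev_norm s (\<lambda>x. J x - J' x)"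
      using sobolev_minus(2)[OF sobolev_diff[OF J J']] by simp
    ultimately show ?thesis by simp
  qed
qed

section \<open>Norms along continuous curves in the Sobolev space\<close>

lemma sobolev_continuousD:
  assumes "sobolev_continuous s u"
  shows "u t \<in> sobolev s" "((\<lambda>r. sobolev_norm s (\<lambda>x. u r x - u t x)) \<longlongrightarrow> 0) (at t)"
  using assms by (auto simp: sobolev_continuous_def)

lemma sobolev_continuous_norm_diff:
  assumes u: "sobolev_continuous s u" and v: "sobolev_continuous s v"
  shows "isCont (\<lambda>t. sobolev_norm s (\<lambda>x. u t x - v t x)) t"
  unfolding isCont_def
proof (rule LIM_zero_cancel, rule Lim_null_comparison[OF always_eventually, OF allI])
  note U = sobolev_continuousD[OF u] and V = sobolev_continuousD[OF v]
  show "((\<lambda>r. sobolev_norm s (\<lambda>x. u r x - u t x) + sobolev_norm s (\<lambda>x. v r x - v t x)) \<longlongrightarrow> 0) (at t)"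
    using tendsto_add[OF U(2) V(2)] by simp
  fix r
  have "sobolev_norm s (\<lambda>x. u r x - v r x) \<le> sobolev_norm s (\<lambda>x. u r x - u t x)
      + (sobolev_norm s (\<lambda>x. u t x - v t x) + sobolev_norm s (\<lambda>x. v t x - v r x))"
    using sobolev_norm_triangle3[of "u r" s "u t" "v r", OF U(1) U(1) V(1)]
      sobolev_norm_triangle3[of "u t" s "v t" "v r", OF U(1) V(1) V(1)]
    by linarith
  moreover have "sobolev_norm s (\<lambda>x. u t x - v t x) \<le> sobolev_norm s (\<lambda>x. u t x - u r x)
      + (sobolev_norm s (\<lambda>x. u r x - v r x) + sobolev_norm s (\<lambda>x. v r x - v t x))"
    using sobolev_norm_triangle3[of "u t" s "u r" "v t", OF U(1) U(1) V(1)]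
      sobolev_norm_triangle3[of "u r" s "v r" "v t", OF U(1) V(1) V(1)]
    by linarith
  ultimately show "norm (sobolev_norm s (\<lambda>x. u r x - v r x) - sobolev_norm s (\<lambda>x. u t x - v t x))
      \<le> sobolev_norm s (\<lambda>x. u r x - u t x) + sobolev_norm s (\<lambda>x. v r x - v t x)"
    using sobolev_norm_diff_commute[of "u t" s "u r", OF U(1) U(1)]
      sobolev_norm_diff_commute[of "v t" s "v r", OF V(1) V(1)]
    by (simp add: abs_le_iff)
qed

lemma sobolev_continuous_norm:
  assumes u: "sobolev_continuous s u"
  shows "isCont (\<lambda>t. sobolev_norm s (u t)) t"
proof -
  have "sobolev_continuous s (\<lambda>t x. 0)"
    by (simp add: sobolev_continuous_def zero_in_sobolev)
  from sobolev_continuous_norm_diff[OF u this] show ?thesis by simp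
qed

lemma cubic_continuous:
  fixes u :: "real \<Rightarrow> 'a::euclidean_space \<Rightarrow> complex"
  assumes s: "real DIM('a) / 2 < s" and u: "sobolev_continuous s u"
  shows "((\<lambda>r. sobolev_norm s (\<lambda>x. cubic (u r) x - cubic (u t) x)) \<longlongrightarrow> 0) (at t)"
proof -
  note U = sobolev_continuousD[OF u]
  obtain C where C: "\<And>u v :: 'a \<Rightarrow> complex. u \<in> sobolev s \<Longrightarrow> v \<in> sobolev s \<Longrightarrow>
      sobolev_norm s (\<lambda>x. cubic u x - cubic v x)
        \<le> C * (sobolev_norm s u + sobolev_norm s v)\<^sup>2 * sobolev_norm s (\<lambda>x. u x - v x)"
    using cubic_Lipschitz[OF s] by metis
  show ?thesis
  proof (rule Lim_null_comparison[OF always_eventually, OF allI])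
    have "((\<lambda>r. sobolev_norm s (u r)) \<longlongrightarrow> sobolev_norm s (u t)) (at t)"
      using sobolev_continuous_norm[OF u] by (simp add: isCont_def)
    then have "((\<lambda>r. C * (sobolev_norm s (u r) + sobolev_norm s (u t))\<^sup>2 * sobolev_norm s (\<lambda>x. u r x - u t x))
        \<longlongrightarrow> C * (sobolev_norm s (u t) + sobolev_norm s (u t))\<^sup>2 * 0) (at t)"
      by (intro tendsto_intros U)
    then show "((\<lambda>r. C * (sobolev_norm s (u r) + sobolev_norm s (u t))\<^sup>2 * sobolev_norm s (\<lambda>x. u r x - u t x)) \<longlongrightarrow> 0) (at t)"
      by simp
    show "norm (sobolev_norm s (\<lambda>x. cubic (u r) x - cubic (u t) x))
        \<le> C * (sobolev_norm s (u r) + sobolev_norm s (u t))\<^sup>2 * sobolev_norm s (\<lambda>x. u r x - u t x)" for r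
      using C[OF U(1) U(1)] by simp
  qed
qed


subsection \<open>Stability of mild solutions\<close>

text \<open>Duhamel's formulas for u and v are subtracted, and \<open>propagator a b\<close> applied
  to the nonlinearity of v is inserted between the two integrands. The datum contributes \<eta> and
  the integral over a time of length at most T contributes \<eta> per unit time, whence
  \<open>\<eta> * (1 + \<bar>\<theta>\<bar> * T)\<close>. As v is bounded by \<open>R\<close> and
  the distance by \<open>Q\<close>, the norm of u is at most \<open>R + Q\<close>.\<close>

lemma mild_solution_diff_le:
  fixes u v :: "real \<Rightarrow> 'a::euclidean_space \<Rightarrow> complex" and \<phi> :: "'a \<Rightarrow> complex"
  assumes C: "0 \<le> C" "\<And>u :: 'a \<Rightarrow> complex. u \<in> sobolev s \<Longrightarrow> cubic u \<in> sobolev s"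
      "\<And>u v :: 'a \<Rightarrow> complex. u \<in> sobolev s \<Longrightarrow> v \<in> sobolev s \<Longrightarrow>
      sobolev_norm s (\<lambda>x. cubic u x - cubic v x)
        \<le> C * (sobolev_norm s u + sobolev_norm s v)\<^sup>2 * sobolev_norm s (\<lambda>x. u x - v x)"
    and \<phi>: "\<phi> \<in> sobolev s"
    and u: "sobolev_continuous s u" "mild_solution s a b \<theta> t0 \<phi> u"
    and v: "sobolev_continuous s v" "mild_solution s a' b' \<theta> t0 \<phi> v"
    and R: "\<And>t. t \<in> {t0 - T..t0 + T} \<Longrightarrow> sobolev_norm s (v t) \<le> R"
    and a: "\<And>r t. \<bar>(LBINT \<tau>=ereal r..ereal t. a \<tau>) - (LBINT \<tau>=ereal r..ereal t. a' \<tau>)\<bar> \<le> \<delta>"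
    and b: "\<And>r t. \<bar>(LBINT \<tau>=ereal r..ereal t. b \<tau>) - (LBINT \<tau>=ereal r..ereal t. b' \<tau>)\<bar> \<le> \<delta>"
    and \<eta>: "dispersion_defect s \<delta> \<phi> \<le> \<eta>"
      "\<And>t. t \<in> {t0 - T..t0 + T} \<Longrightarrow> dispersion_defect s \<delta> (cubic (v t)) \<le> \<eta>"
    and t: "t \<in> {t0 - T..t0 + T}"
    and Q: "\<And>r. r \<in> {min t0 t..max t0 t} \<Longrightarrow> sobolev_norm s (\<lambda>x. u r x - v r x) \<le> Q"
  shows "sobolev_norm s (\<lambda>x. u t x - v t x) \<le> \<eta> * (1 + \<bar>\<theta>\<bar> * T)
    + \<bar>\<theta>\<bar> * (C * (2 * R + Q)\<^sup>2) * integral {min t0 t..max t0 t} (\<lambda>r. sobolev_norm s (\<lambda>x. u r x - v r x))"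
proof -
  define w where "w r = sobolev_norm s (\<lambda>x. u r x - v r x)" for r
  let ?I = "{min t0 t..max t0 t}"
  let ?K = "C * (2 * R + Q)\<^sup>2"
  have I: "?I \<subseteq> {t0 - T..t0 + T}" using t by auto
  note U = sobolev_continuousD(1)[OF u(1)] and V = sobolev_continuousD(1)[OF v(1)]
  have \<eta>0: "0 \<le> \<eta>" using \<eta>(1) dispersion_defect_nonneg[of s \<delta> \<phi>] by linarith
  obtain J where J: "has_oriented_sobolev_integral s (\<lambda>\<tau>. propagator a b t \<tau> (cubic (u \<tau>))) J t0 t"
    "AE x in lborel. u t x = propagator a b t t0 \<phi> x + \<i> * complex_of_real \<theta> * J x"
    using u(2) unfolding mild_solution_def cubic_def by blast
  obtain J' where J': "has_oriented_sobolev_integral s (\<lambda>\<tau>. propagator a' b' t \<tau> (cubic (v \<tau>))) J' t0 t"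
    "AE x in lborel. v t x = propagator a' b' t t0 \<phi> x + \<i> * complex_of_real \<theta> * J' x"
    using v(2) unfolding mild_solution_def cubic_def by blast
  have w_cont: "continuous_on ?I w"
    unfolding w_def[abs_def]
    by (intro continuous_at_imp_continuous_on ballI sobolev_continuous_norm_diff u(1) v(1))
  have Kw_int: "(\<lambda>r. ?K * w r) integrable_on ?I" and g_int: "(\<lambda>r. ?K * w r + \<eta>) integrable_on ?I"
    by (intro integrable_continuous_interval continuous_intros w_cont)+
  have le: "sobolev_norm s (\<lambda>x. propagator a b t r (cubic (u r)) x - propagator a' b' t r (cubic (v r)) x) \<le> ?K * w r + \<eta>"
    if r: "r \<in> ?I" for r
  proof -
    have nv: "sobolev_norm s (v r) \<le> R" using R r I by blast
    have nu: "sobolev_norm s (u r) \<le> R + Q"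
      using sobolev_norm_le_diff[OF U V, of r r] Q[OF r] nv by linarith
    have "sobolev_norm s (\<lambda>x. propagator a b t r (cubic (u r)) x - propagator a' b' t r (cubic (v r)) x)
        \<le> sobolev_norm s (\<lambda>x. propagator a b t r (cubic (u r)) x - propagator a b t r (cubic (v r)) x)
          + sobolev_norm s (\<lambda>x. propagator a b t r (cubic (v r)) x - propagator a' b' t r (cubic (v r)) x)"
      by (intro sobolev_norm_triangle3 propagator_sobolev C U V)
    also have "\<dots> \<le> sobolev_norm s (\<lambda>x. cubic (u r) x - cubic (v r) x) + dispersion_defect s \<delta> (cubic (v r))"
      by (intro add_mono propagator_diff_le propagator_defect C U V a b)
    also have "\<dots> \<le> C * (sobolev_norm s (u r) + sobolev_norm s (v r))\<^sup>2 * w r + \<eta>"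
      unfolding w_def using r I by (intro add_mono C U V \<eta>) blast
    also have "\<dots> \<le> ?K * w r + \<eta>"
    proof -
      have "(sobolev_norm s (u r) + sobolev_norm s (v r))\<^sup>2 \<le> (2 * R + Q)\<^sup>2"
        using nu nv by (intro power_mono) auto
      then show ?thesis
        by (intro add_right_mono mult_right_mono mult_left_mono C(1)) (simp_all add: w_def)
    qed
    finally show ?thesis .
  qed
  note dJ = has_oriented_sobolev_integral_diff_le[OF J(1) J'(1) g_int le]
  have "integral ?I (\<lambda>r. ?K * w r + \<eta>) = ?K * integral ?I w + integral ?I (\<lambda>r. \<eta>)"
    using Kw_int by (subst integral_add) auto
  also have "integral ?I (\<lambda>r. \<eta>) \<le> \<eta> * T"
  proof -
    have "integral ?I (\<lambda>r. \<eta>) = \<eta> * (max t0 t - min t0 t)" by simp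
    also have "\<dots> \<le> \<eta> * T" using t by (intro mult_left_mono \<eta>0) auto
    finally show ?thesis .
  qed
  finally have dJ': "sobolev_norm s (\<lambda>x. J x - J' x) \<le> ?K * integral ?I w + \<eta> * T"
    using dJ(3) by linarith
  note P = propagator_sobolev(1)[OF \<phi>]
  \<comment> \<open>The mild equations hold only almost everywhere, so the norm is computed for this
    function and carried over with \<open>sobolev_cong_AE\<close>.\<close>
  let ?f = "\<lambda>x. (propagator a b t t0 \<phi> x - propagator a' b' t t0 \<phi> x) + \<i> * complex_of_real \<theta> * (J x - J' x)"
  have f: "?f \<in> sobolev s"
    by (intro sobolev_add sobolev_cmult sobolev_diff P dJ)
  have "w t = sobolev_norm s ?f"
    unfolding w_def
  proof (rule sobolev_cong_AE(2)[OF f])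
    show "(\<lambda>x. u t x - v t x) \<in> borel_measurable borel"
      by (intro square_integrable_measurable sobolev_square_integrable(1)[of _ s] sobolev_diff U V)
    show "AE x in lborel. ?f x = u t x - v t x"
      using J(2) J'(2) by eventually_elim (simp add: algebra_simps)
  qed
  also have "\<dots> \<le> sobolev_norm s (\<lambda>x. propagator a b t t0 \<phi> x - propagator a' b' t t0 \<phi> x)
      + sobolev_norm s (\<lambda>x. \<i> * complex_of_real \<theta> * (J x - J' x))"
    by (intro sobolev_norm_add_le sobolev_cmult sobolev_diff P dJ)
  also have "sobolev_norm s (\<lambda>x. \<i> * complex_of_real \<theta> * (J x - J' x)) = \<bar>\<theta>\<bar> * sobolev_norm s (\<lambda>x. J x - J' x)"
    using sobolev_cmult(2)[OF sobolev_diff[OF dJ(1,2)], of "\<i> * complex_of_real \<theta>"] by (simp add: norm_mult)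
  also have "sobolev_norm s (\<lambda>x. propagator a b t t0 \<phi> x - propagator a' b' t t0 \<phi> x) \<le> \<eta>"
    by (rule order_trans[OF propagator_defect[OF \<phi> a b] \<eta>(1)])
  also have "\<bar>\<theta>\<bar> * sobolev_norm s (\<lambda>x. J x - J' x) \<le> \<bar>\<theta>\<bar> * (?K * integral ?I w + \<eta> * T)"
    by (intro mult_left_mono dJ') simp
  finally show ?thesis
    unfolding w_def by (simp add: algebra_simps)
qed

text \<open>The order of quantifiers is the point: \<delta> precedes the coefficients
  \<open>a\<close>, \<open>b\<close> and the solution u, so one value serves a whole family of
  equations approaching that of v.\<close>

lemma mild_solution_stability:
  fixes v :: "real \<Rightarrow> 'a::euclidean_space \<Rightarrow> complex" and \<phi> :: "'a \<Rightarrow> complex"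
  assumes s: "real DIM('a) / 2 < s" and \<phi>: "\<phi> \<in> sobolev s"
    and v: "sobolev_continuous s v" "mild_solution s a' b' \<theta> t0 \<phi> v"
    and T: "0 \<le> T" and e: "0 < e"
  shows "\<exists>\<delta>>0. \<forall>a b u. sobolev_continuous s u \<longrightarrow> mild_solution s a b \<theta> t0 \<phi> u \<longrightarrow>
      (\<forall>r t. \<bar>(LBINT \<tau>=ereal r..ereal t. a \<tau>) - (LBINT \<tau>=ereal r..ereal t. a' \<tau>)\<bar> \<le> \<delta>) \<longrightarrow>
      (\<forall>r t. \<bar>(LBINT \<tau>=ereal r..ereal t. b \<tau>) - (LBINT \<tau>=ereal r..ereal t. b' \<tau>)\<bar> \<le> \<delta>) \<longrightarrow>
      (\<forall>t\<in>{t0 - T..t0 + T}. sobolev_norm s (\<lambda>x. u t x - v t x) \<le> e)"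
proof -
  let ?I = "{t0 - T..t0 + T}"
  obtain C where C: "0 \<le> C" "\<And>u :: 'a \<Rightarrow> complex. u \<in> sobolev s \<Longrightarrow> cubic u \<in> sobolev s"
      "\<And>u v :: 'a \<Rightarrow> complex. u \<in> sobolev s \<Longrightarrow> v \<in> sobolev s \<Longrightarrow>
      sobolev_norm s (\<lambda>x. cubic u x - cubic v x)
        \<le> C * (sobolev_norm s u + sobolev_norm s v)\<^sup>2 * sobolev_norm s (\<lambda>x. u x - v x)"
    using cubic_Lipschitz[OF s] by metis
  have "continuous_on ?I (\<lambda>t. sobolev_norm s (v t))"
    by (intro continuous_at_imp_continuous_on ballI sobolev_continuous_norm v(1))
  then have "\<exists>p\<in>?I. \<forall>t\<in>?I. sobolev_norm s (v t) \<le> sobolev_norm s (v p)"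
    using T by (intro continuous_attains_sup) auto
  then obtain p where R: "\<And>t. t \<in> ?I \<Longrightarrow> sobolev_norm s (v t) \<le> sobolev_norm s (v p)"
    by blast
  define R where "R = sobolev_norm s (v p)"
  \<comment> \<open>The Lipschitz factor while u stays within distance 1 of v, increased by 1 to be
    positive as Gronwall's lemma requires.\<close>
  define L where "L = \<bar>\<theta>\<bar> * (C * (2 * R + 1)\<^sup>2) + 1"
  have L: "0 < L" "\<bar>\<theta>\<bar> * (C * (2 * R + 1)\<^sup>2) \<le> L" using C(1) by (auto simp: L_def add_nonneg_pos)
  \<comment> \<open>Chosen so that the Gronwall bound \<open>2 * A * exp (2 * L * T)\<close> equals
    \<open>min e (1/2)\<close>: at most the desired accuracy, and strictly below the bootstrap
    threshold 1.\<close>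
  define A where "A = min e (1/2) / (2 * exp (2 * L * T))"
  have A: "0 < A" "2 * A * exp (2 * L * T) = min e (1/2)" using e by (auto simp: A_def)
  define \<eta> where "\<eta> = A / (1 + \<bar>\<theta>\<bar> * T)"
  have \<theta>T: "0 < 1 + \<bar>\<theta>\<bar> * T" using T by (simp add: add_pos_nonneg)
  have \<eta>: "0 < \<eta>" "\<eta> * (1 + \<bar>\<theta>\<bar> * T) = A" using A \<theta>T by (auto simp: \<eta>_def)
  have cv: "cubic (v t) \<in> sobolev s" for t
    by (intro C sobolev_continuousD(1)[OF v(1)])
  obtain \<delta>1 where \<delta>1: "0 < \<delta>1" "\<And>t. t \<in> ?I \<Longrightarrow> dispersion_defect s \<delta>1 (cubic (v t)) \<le> \<eta>"
    using dispersion_defect_uniformly_small[of "\<lambda>t. cubic (v t)" s ?I \<eta>, OF cv cubic_continuous[OF s v(1)] _ \<eta>(1)] by auto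
  obtain \<delta>2 where \<delta>2: "0 < \<delta>2" "dispersion_defect s \<delta>2 \<phi> < \<eta>"
    using dispersion_defect_small[OF \<phi> \<eta>(1)] by auto
  define \<delta> where "\<delta> = min \<delta>1 \<delta>2"
  have \<delta>: "0 < \<delta>" "\<delta> \<le> \<delta>1" "\<delta> \<le> \<delta>2" using \<delta>1 \<delta>2 by (auto simp: \<delta>_def)
  have d\<phi>: "dispersion_defect s \<delta> \<phi> \<le> \<eta>"
    using dispersion_defect_mono[OF \<phi> less_imp_le[OF \<delta>(1)] \<delta>(3)] \<delta>2(2) by linarith
  have dv: "dispersion_defect s \<delta> (cubic (v t)) \<le> \<eta>" if "t \<in> ?I" for t
    using dispersion_defect_mono[OF cv[of t] less_imp_le[OF \<delta>(1)] \<delta>(2)] \<delta>1(2)[OF that] by linarith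
  show ?thesis
  proof (intro exI[of _ \<delta>] conjI \<delta>(1) allI impI ballI)
    fix a b u t
    assume u: "sobolev_continuous s u" "mild_solution s a b \<theta> t0 \<phi> u"
      and ab: "\<forall>r t. \<bar>(LBINT \<tau>=ereal r..ereal t. a \<tau>) - (LBINT \<tau>=ereal r..ereal t. a' \<tau>)\<bar> \<le> \<delta>"
        "\<forall>r t. \<bar>(LBINT \<tau>=ereal r..ereal t. b \<tau>) - (LBINT \<tau>=ereal r..ereal t. b' \<tau>)\<bar> \<le> \<delta>"
      and t: "t \<in> ?I"
    note a = ab(1)[rule_format] and b = ab(2)[rule_format]
    define w where "w r = sobolev_norm s (\<lambda>x. u r x - v r x)" for r
    have w_cont: "continuous_on S w" for S
      unfolding w_def[abs_def] by (intro continuous_at_imp_continuous_on ballI sobolev_continuous_norm_diff u(1) v(1))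
    have w_le: "w t \<le> A + \<bar>\<theta>\<bar> * (C * (2 * R + Q)\<^sup>2) * integral {min t0 t..max t0 t} w"
      if "t \<in> ?I" "\<And>r. r \<in> {min t0 t..max t0 t} \<Longrightarrow> w r \<le> Q" for t Q
      using mild_solution_diff_le[where Q=Q, OF C \<phi> u v R a b d\<phi> dv that(1)] that(2)
      unfolding w_def[abs_def] \<eta>(2) R_def by blast
    \<comment> \<open>On the degenerate interval at \<open>t0\<close> the integral vanishes, and
      \<open>w t0\<close> itself is an admissible \<open>Q\<close>.\<close>
    have w0: "w t0 \<le> A"
      using w_le[of t0 "w t0"] T by simp
    have w_le1: "w t \<le> A + L * integral {min t0 t..max t0 t} w"
      if "t \<in> ?I" "\<And>r. r \<in> {min t0 t..max t0 t} \<Longrightarrow> w r \<le> 1" for t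
    proof -
      have "0 \<le> integral {min t0 t..max t0 t} w"
        by (intro integral_nonneg integrable_continuous_interval w_cont) (simp add: w_def)
      then have "\<bar>\<theta>\<bar> * (C * (2 * R + 1)\<^sup>2) * integral {min t0 t..max t0 t} w \<le> L * integral {min t0 t..max t0 t} w"
        by (intro mult_right_mono L)
      then show ?thesis using w_le[OF that] by linarith
    qed
    have small: "2 * A * exp (2 * L * T) < 1" using A(2) by simp
    \<comment> \<open>Both directions of time are reduced to a function on \<open>{0..T}\<close>, by
      a translation forwards and a reflection backwards.\<close>
    have "w t \<le> 2 * A * exp (2 * L * T)"
    proof (cases "t0 \<le> t")
      case True
      define y where "y r = w (t0 + r)" for r
      have "y (t - t0) \<le> 2 * A * exp (2 * L * T)"
      proof (rule gronwall_bootstrap[where y=y and T=T and t="t - t0", OF _ L(1) less_imp_le[OF A(1)] small])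
        show "continuous_on {0..T} y"
          unfolding y_def[abs_def] by (intro continuous_on_compose2[OF w_cont[of UNIV]] continuous_intros) auto
        show "y r \<le> A + L * integral {0..r} y" if r: "r \<in> {0..T}" and le1: "\<And>q. q \<in> {0..r} \<Longrightarrow> y q \<le> 1" for r
        proof -
          have "w (t0 + r) \<le> A + L * integral {min t0 (t0 + r)..max t0 (t0 + r)} w"
          proof (rule w_le1)
            show "w q \<le> 1" if "q \<in> {min t0 (t0 + r)..max t0 (t0 + r)}" for q
              using le1[of "q - t0"] that r by (simp add: y_def)
          qed (use r in auto)
          moreover have "integral {min t0 (t0 + r)..max t0 (t0 + r)} w = integral {0..r} y"
            using r integral_shift_real_ivl[of t0 t0 "t0 + r" w] by (simp add: y_def[abs_def] add.commute)
          ultimately show ?thesis by (simp add: y_def)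
        qed
        show "y 0 \<le> A" using w0 by (simp add: y_def)
      qed (use t True in auto)
      then show ?thesis by (simp add: y_def)
    next
      case False
      define y where "y r = w (t0 - r)" for r
      have "y (t0 - t) \<le> 2 * A * exp (2 * L * T)"
      proof (rule gronwall_bootstrap[where y=y and T=T and t="t0 - t", OF _ L(1) less_imp_le[OF A(1)] small])
        show "continuous_on {0..T} y"
          unfolding y_def[abs_def] by (intro continuous_on_compose2[OF w_cont[of UNIV]] continuous_intros) auto
        show "y r \<le> A + L * integral {0..r} y" if r: "r \<in> {0..T}" and le1: "\<And>q. q \<in> {0..r} \<Longrightarrow> y q \<le> 1" for r
        proof -
          have "w (t0 - r) \<le> A + L * integral {min t0 (t0 - r)..max t0 (t0 - r)} w"
          proof (rule w_le1)
            show "w q \<le> 1" if "q \<in> {min t0 (t0 - r)..max t0 (t0 - r)}" for q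
              using le1[of "t0 - q"] that r by (simp add: y_def)
          qed (use r in auto)
          moreover have "integral {min t0 (t0 - r)..max t0 (t0 - r)} w = integral {0..r} y"
            using r integral_shift_real_ivl[of "t0 - r" t0 t0 w]
              Henstock_Kurzweil_Integration.integral_reflect_real[where a = 0 and b = r and f = y]
            by (simp add: y_def[abs_def] add.commute)
          ultimately show ?thesis by (simp add: y_def)
        qed
        show "y 0 \<le> A" using w0 by (simp add: y_def)
      qed (use t False in auto)
      then show ?thesis by (simp add: y_def)
    qed
    then show "sobolev_norm s (\<lambda>x. u t x - v t x) \<le> e"
      unfolding A(2) w_def by simp
  qed
qed

theorem theorem6p1:
  fixes t0 \<theta> s T1 t_plus \<tau>_plus \<alpha>_plus \<alpha>_minus \<beta>_plus \<beta>_minus :: real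
    and \<alpha> \<beta> :: "real \<Rightarrow> real"
    and \<phi> :: "real ^ 'n \<Rightarrow> complex"
    and u :: "real \<Rightarrow> real \<Rightarrow> real ^ 'n \<Rightarrow> complex"
    and u0 :: "real \<Rightarrow> real ^ 'n \<Rightarrow> complex"
  assumes "\<theta> \<noteq> 0"
    and "T1 > 0"
    and "\<alpha>_plus > 0" "\<alpha>_minus > 0" "\<beta>_plus > 0" "\<beta>_minus > 0"
    and "0 < t_plus" "t_plus < T1" "0 < \<tau>_plus" "\<tau>_plus < 1"
    and "\<And>t. 0 < t \<Longrightarrow> t \<le> t_plus \<Longrightarrow> \<alpha> t = \<alpha>_plus"
    and "\<And>t. t_plus - T1 < t \<Longrightarrow> t \<le> 0 \<Longrightarrow> \<alpha> t = - \<alpha>_minus"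
    and "\<And>t. \<alpha> (t + T1) = \<alpha> t"
    and "\<And>t. 0 < t \<Longrightarrow> t \<le> \<tau>_plus \<Longrightarrow> \<beta> t = \<beta>_plus"
    and "\<And>t. \<tau>_plus - 1 < t \<Longrightarrow> t \<le> 0 \<Longrightarrow> \<beta> t = - \<beta>_minus"
    and "\<And>t. \<beta> (t + 1) = \<beta> t"
    and "s > real CARD('n) / 2"
    and "\<phi> \<in> sobolev s"
    and "\<And>\<epsilon>. \<epsilon> > 0 \<Longrightarrow> sobolev_continuous s (u \<epsilon>)"
    and "\<And>\<epsilon>. \<epsilon> > 0 \<Longrightarrow> mild_solution s (\<lambda>t. \<alpha> (t / \<epsilon>)) (\<lambda>t. \<beta> (t / \<epsilon>)) \<theta> t0 \<phi> (u \<epsilon>)"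
    and "sobolev_continuous s u0"
    and "mild_solution s (\<lambda>_. period_mean T1 \<alpha>) (\<lambda>_. period_mean 1 \<beta>) \<theta> t0 \<phi> u0"
  shows "\<forall>T>0. ((\<lambda>\<epsilon>. sobolev_Linf_norm s {t0 - T..t0 + T} (\<lambda>t x. u \<epsilon> t x - u0 t x))
           \<longlongrightarrow> 0) (at_right 0)"
proof (intro allI impI)
  fix T :: real assume T: "0 < T"
  let ?M = "restrict_space lborel {t0 - T..t0 + T}"
  let ?N = "\<lambda>\<epsilon>. sobolev_Linf_norm s {t0 - T..t0 + T} (\<lambda>t x. u \<epsilon> t x - u0 t x)"
  have s: "real DIM(real ^ 'n) / 2 < s"
    using \<open>s > real CARD('n) / 2\<close> by simp
  note \<alpha> = two_step_periodic[where f=\<alpha> and P=T1, OF assms(2,7,8,11,12,13)]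
  note \<beta> = two_step_periodic[where f=\<beta> and P=1, OF zero_less_one assms(9,10,14,15,16)]
  obtain Ca where Ca: "0 \<le> Ca" "\<forall>e>0. \<forall>r t.
    \<bar>(LBINT x=ereal r..ereal t. \<alpha> (x / e)) - (LBINT x=ereal r..ereal t. period_mean T1 \<alpha>)\<bar> \<le> Ca * e"
    using periodic_averaging[where f=\<alpha> and P=T1, OF \<alpha> assms(2,13)] by blast
  obtain Cb where Cb: "0 \<le> Cb" "\<forall>e>0. \<forall>r t.
    \<bar>(LBINT x=ereal r..ereal t. \<beta> (x / e)) - (LBINT x=ereal r..ereal t. period_mean 1 \<beta>)\<bar> \<le> Cb * e"
    using periodic_averaging[where f=\<beta> and P=1, OF \<beta> zero_less_one assms(16)] by blast
  have meas: "(\<lambda>t. ereal (sobolev_norm s (\<lambda>x. u \<epsilon> t x - u0 t x))) \<in> borel_measurable ?M" if "0 < \<epsilon>" for \<epsilon>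
  proof -
    have "continuous_on UNIV (\<lambda>t. sobolev_norm s (\<lambda>x. u \<epsilon> t x - u0 t x))"
      by (intro continuous_at_imp_continuous_on ballI sobolev_continuous_norm_diff assms that)
    then have "(\<lambda>t. sobolev_norm s (\<lambda>x. u \<epsilon> t x - u0 t x)) \<in> borel_measurable lborel"
      by (simp add: borel_measurable_continuous_onI)
    then show ?thesis
      by (intro borel_measurable_ereal measurable_restrict_space1)
  qed
  \<comment> \<open>The time window has positive measure, so the essential supremum of the constant
    0 is 0 (on a null space it would be minus infinity); monotonicity then makes the norms
    nonnegative.\<close>
  have "emeasure ?M (space ?M) \<noteq> 0"
    using T by (simp add: emeasure_restrict_space space_restrict_space)
  then have nonneg: "0 \<le> ?N \<epsilon>" if "0 < \<epsilon>" for \<epsilon>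
    using esssup_const[of ?M "0::ereal"] esssup_mono[of "\<lambda>t. 0" ?M "\<lambda>t. ereal (sobolev_norm s (\<lambda>x. u \<epsilon> t x - u0 t x))"]
    by (simp add: sobolev_Linf_norm_def)
  show "(?N \<longlongrightarrow> 0) (at_right 0)"
  proof (rule order_tendstoI)
    fix c :: ereal assume "c < 0"
    then show "\<forall>\<^sub>F \<epsilon> in at_right 0. c < ?N \<epsilon>"
      using nonneg by (auto simp: eventually_at_right_field intro!: exI[of _ 1] intro: less_le_trans)
  next
    fix c :: ereal assume "0 < c"
    then obtain e where e: "0 < e" "ereal e < c"
      using ereal_dense2[of 0 c] by auto
    \<comment> \<open>Stability around \<open>u0\<close>, whose coefficients are the two means; this
      threshold is fixed before \<epsilon> is considered.\<close>
    obtain \<delta> where \<delta>: "0 < \<delta>" "\<forall>a b u. sobolev_continuous s u \<longrightarrow> mild_solution s a b \<theta> t0 \<phi> u \<longrightarrow>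
      (\<forall>r t. \<bar>(LBINT \<tau>=ereal r..ereal t. a \<tau>) - (LBINT \<tau>=ereal r..ereal t. period_mean T1 \<alpha>)\<bar> \<le> \<delta>) \<longrightarrow>
      (\<forall>r t. \<bar>(LBINT \<tau>=ereal r..ereal t. b \<tau>) - (LBINT \<tau>=ereal r..ereal t. period_mean 1 \<beta>)\<bar> \<le> \<delta>) \<longrightarrow>
      (\<forall>t\<in>{t0 - T..t0 + T}. sobolev_norm s (\<lambda>x. u t x - u0 t x) \<le> e)"
      using mild_solution_stability[OF s assms(18,21,22) less_imp_le[OF T] e(1)] by blast
    \<comment> \<open>The denominator dominates both averaging constants, so one condition on
      \<epsilon> brings both time integrals within \<delta>; the summand 1 keeps it
      positive.\<close>
    define \<epsilon>0 where "\<epsilon>0 = \<delta> / (Ca + Cb + 1)"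
    have pos: "0 < Ca + Cb + 1" using Ca(1) Cb(1) by linarith
    have "0 < \<epsilon>0" using \<delta>(1) pos by (simp add: \<epsilon>0_def)
    moreover have "?N \<epsilon> < c" if \<epsilon>: "0 < \<epsilon>" "\<epsilon> < \<epsilon>0" for \<epsilon>
    proof -
      have "(Ca + Cb + 1) * \<epsilon> \<le> \<delta>"
        using \<epsilon> pos by (simp add: \<epsilon>0_def pos_less_divide_eq mult.commute less_imp_le)
      moreover have "Ca * \<epsilon> \<le> (Ca + Cb + 1) * \<epsilon>" "Cb * \<epsilon> \<le> (Ca + Cb + 1) * \<epsilon>"
        using \<epsilon>(1) Ca(1) Cb(1) by (auto intro!: mult_right_mono)
      ultimately have le: "Ca * \<epsilon> \<le> \<delta>" "Cb * \<epsilon> \<le> \<delta>" by linarith+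
      have ab: "\<bar>(LBINT x=ereal r..ereal t. \<alpha> (x / \<epsilon>)) - (LBINT x=ereal r..ereal t. period_mean T1 \<alpha>)\<bar> \<le> \<delta>"
        "\<bar>(LBINT x=ereal r..ereal t. \<beta> (x / \<epsilon>)) - (LBINT x=ereal r..ereal t. period_mean 1 \<beta>)\<bar> \<le> \<delta>" for r t
        by (rule order_trans[OF Ca(2)[rule_format, OF \<epsilon>(1)] le(1)],
            rule order_trans[OF Cb(2)[rule_format, OF \<epsilon>(1)] le(2)])
      have "\<forall>t\<in>{t0 - T..t0 + T}. sobolev_norm s (\<lambda>x. u \<epsilon> t x - u0 t x) \<le> e"
        by (rule ballI) (rule \<delta>(2)[rule_format, where a="\<lambda>t. \<alpha> (t / \<epsilon>)" and b="\<lambda>t. \<beta> (t / \<epsilon>)" and u="u \<epsilon>",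
            OF assms(19)[OF \<epsilon>(1)] assms(20)[OF \<epsilon>(1)] ab])
      then have "?N \<epsilon> \<le> ereal e"
        unfolding sobolev_Linf_norm_def
        by (intro esssup_I meas[OF \<epsilon>(1)] AE_I2) (simp add: space_restrict_space)
      then show ?thesis using e(2) by (rule le_less_trans)
    qed
    ultimately show "\<forall>\<^sub>F \<epsilon> in at_right 0. ?N \<epsilon> < c"
      by (auto simp: eventually_at_right_field intro!: exI[of _ \<epsilon>0])
  qed
qed

end
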